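(* Let $l\ge2$ and $n\ge1$ be integers. Let $Z^n$ be the toric variety obtained from $\mathbf A^l$ through the sequence of $n$ blow-ups along the irreducible stable subvarieties associated successively to the cones $\sigma(e_1,\dots,e_l)$ and $\sigma\big(e_1,\dots,e_{l-1},\,i(\sum_{j=1}^{l-1}e_j)+e_l\big)$ for $i=1,2,\dots,n-1$. Let $\widetilde Z^n$ be the blow-up of $Z^n$ along the stable subvariety associated to $\sigma\big(\sum_{j=1}^{l}e_j,\,e_2,\dots,e_l\big)$. Let $L_h$ be any ample line bundle on $\widetilde Z^n$. Then the product of sections $$m_{h,h}:H^0(\widetilde Z^n,L_h)\otimes H^0(\widetilde Z^n,L_h)\longrightarrow H^0(\widetilde Z^n,L_h\otimes L_h)$$ is surjective.
   Context: Work over $\mathbf C$. Let $N=\mathbf Z^l$ with basis $e_1,\dots,e_l$; $\sigma(v_1,\dots,v_r)$ is the cone generated by $v_1,\dots,v_r$. $\mathbf A^l$ is the toric variety whose fan consists of the faces of $\sigma(e_1,\dots,e_l)$. In a smooth toric variety with fan $\Delta$, the irreducible stable (i.e. torus-stable) closed subvariety associated to a cone $\gamma\in\Delta$ is the closure of the torus orbit corresponding to $\gamma$; blowing it up is the star subdivision of $\Delta$ obtained by adding the ray spanned by the sum of the primitive generators of $\gamma$. At each step the cone named in the statement belongs to the fan of the variety obtained so far. *)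

theory Defs
  imports "HOL-Analysis.Abstract_Topology" "HOL-Library.Function_Algebras"
begin

text \<open>
  Conventions. The lattice \<open>N = \<int>\<^sup>l\<close> and its dual \<open>M\<close> are both represented by the functions
  \<open>nat \<Rightarrow> int\<close> vanishing outside \<open>{1..l}\<close>; cones are sets of real vectors \<open>nat \<Rightarrow> real\<close> in
  \<open>N \<otimes> \<real>\<close>. Addition and zero of functions are pointwise (\<open>Function_Algebras\<close>).
  A toric variety over \<open>\<complex>\<close> is given by its complex (closed) points, its Zariski topology and its
  sheaf of regular functions.
\<close>

section \<open>Lattices, cones and fans\<close>

definition lattice_vecs :: "nat \<Rightarrow> (nat \<Rightarrow> int) set" where
  "lattice_vecs l = {v. \<forall>j. j \<notin> {1..l} \<longrightarrow> v j = 0}"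

definition e :: "nat \<Rightarrow> nat \<Rightarrow> int" where
  "e i = (\<lambda>j. if j = i then 1 else 0)"

definition pairing :: "nat \<Rightarrow> (nat \<Rightarrow> int) \<Rightarrow> (nat \<Rightarrow> real) \<Rightarrow> real" where
  "pairing l m x = (\<Sum>j=1..l. of_int (m j) * x j)"

text \<open>The cone \<open>\<sigma>(v\<^sub>1,\<dots>,v\<^sub>r)\<close> generated by a finite set of lattice vectors.\<close>

definition cone_of :: "(nat \<Rightarrow> int) set \<Rightarrow> (nat \<Rightarrow> real) set" where
  "cone_of A = {x. \<exists>c. (\<forall>v\<in>A. (0::real) \<le> c v) \<and> x = (\<lambda>j. \<Sum>v\<in>A. c v * of_int (v j))}"

definition dual_monoid :: "nat \<Rightarrow> (nat \<Rightarrow> real) set \<Rightarrow> (nat \<Rightarrow> int) set" where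
  "dual_monoid l \<sigma> = {m \<in> lattice_vecs l. \<forall>x\<in>\<sigma>. 0 \<le> pairing l m x}"

definition cone_faces :: "nat \<Rightarrow> (nat \<Rightarrow> real) set \<Rightarrow> (nat \<Rightarrow> real) set set" where
  "cone_faces l \<sigma> = {{x \<in> \<sigma>. pairing l m x = 0} | m. m \<in> dual_monoid l \<sigma>}"

definition primitive_vec :: "nat \<Rightarrow> (nat \<Rightarrow> int) \<Rightarrow> bool" where
  "primitive_vec l v \<longleftrightarrow> v \<in> lattice_vecs l \<and> v \<noteq> 0 \<and>
     (\<forall>w\<in>lattice_vecs l. \<forall>k::nat. v = (\<lambda>j. int k * w j) \<longrightarrow> k = 1)"

definition primitive_gens :: "nat \<Rightarrow> (nat \<Rightarrow> real) set \<Rightarrow> (nat \<Rightarrow> int) set" where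
  "primitive_gens l \<sigma> = {v. primitive_vec l v \<and> cone_of {v} \<in> cone_faces l \<sigma>}"

text \<open>
  The star subdivision of a smooth fan \<open>\<Delta>\<close> at \<open>\<gamma> \<in> \<Delta>\<close>: the cones of \<open>\<Delta>\<close> containing \<open>\<gamma>\<close> (which for
  \<open>\<gamma> \<in> \<Delta>\<close> means having \<open>\<gamma>\<close> as a face) are replaced by the cones spanned by those subsets of their
  generators together with the new ray which do not contain all generators of \<open>\<gamma>\<close>.
\<close>

definition star_subdivision ::
    "nat \<Rightarrow> (nat \<Rightarrow> real) set set \<Rightarrow> (nat \<Rightarrow> real) set \<Rightarrow> (nat \<Rightarrow> real) set set" where
  "star_subdivision l \<Delta> \<gamma> =
     {\<sigma> \<in> \<Delta>. \<not> \<gamma> \<subseteq> \<sigma>} \<union>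
     {cone_of A | A \<sigma>. \<sigma> \<in> \<Delta> \<and> \<gamma> \<subseteq> \<sigma> \<and>
        A \<subseteq> insert (\<Sum>v\<in>primitive_gens l \<gamma>. v) (primitive_gens l \<sigma>) \<and>
        \<not> primitive_gens l \<gamma> \<subseteq> A}"

definition affine_space_fan :: "nat \<Rightarrow> (nat \<Rightarrow> real) set set" where
  "affine_space_fan l = cone_faces l (cone_of (e ` {1..l}))"

text \<open>
  The cone blown up in step \<open>i\<close>, for \<open>i = 0, 1, \<dots>, n - 1\<close>. For \<open>i = 0\<close> it is
  \<open>\<sigma>(e\<^sub>1,\<dots>,e\<^sub>l)\<close>, the first cone of the sequence.
\<close>

definition blowup_cone :: "nat \<Rightarrow> nat \<Rightarrow> (nat \<Rightarrow> real) set" where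
  "blowup_cone l i =
     cone_of (insert ((\<lambda>k. int i * (\<Sum>j=1..l-1. e j k)) + e l) (e ` {1..l-1}))"

primrec Z_fan :: "nat \<Rightarrow> nat \<Rightarrow> (nat \<Rightarrow> real) set set" where
  "Z_fan l 0 = affine_space_fan l"
| "Z_fan l (Suc i) = star_subdivision l (Z_fan l i) (blowup_cone l i)"

definition Z_tilde_fan :: "nat \<Rightarrow> nat \<Rightarrow> (nat \<Rightarrow> real) set set" where
  "Z_tilde_fan l n =
     star_subdivision l (Z_fan l n) (cone_of (insert (\<Sum>j=1..l. e j) (e ` {2..l})))"


section \<open>The toric variety of a fan\<close>

text \<open>
  The points of the affine chart \<open>U\<^sub>\<sigma> = Spec \<complex>[\<sigma>\<^sup>\<or> \<inter> M]\<close> are the unital semigroup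
  homomorphisms \<open>u : \<sigma>\<^sup>\<or> \<inter> M \<rightarrow> (\<complex>, \<sqdot>)\<close>, extended by zero to all of \<open>nat \<Rightarrow> int\<close>; the character
  \<open>\<chi>\<^sup>m\<close> is the function \<open>u \<mapsto> u m\<close>.
\<close>

type_synonym affine_point = "(nat \<Rightarrow> int) \<Rightarrow> complex"

definition affine_points :: "nat \<Rightarrow> (nat \<Rightarrow> real) set \<Rightarrow> affine_point set" where
  "affine_points l \<sigma> =
     {u. u 0 = 1 \<and>
         (\<forall>m\<in>dual_monoid l \<sigma>. \<forall>m'\<in>dual_monoid l \<sigma>. u (m + m') = u m * u m') \<and>
         (\<forall>m. m \<notin> dual_monoid l \<sigma> \<longrightarrow> u m = 0)}"

definition coordinate_ring :: "nat \<Rightarrow> (nat \<Rightarrow> real) set \<Rightarrow> (affine_point \<Rightarrow> complex) set" where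
  "coordinate_ring l \<sigma> =
     {(\<lambda>u. \<Sum>m\<in>A. c m * u m) | A c. finite A \<and> A \<subseteq> dual_monoid l \<sigma>}"

text \<open>
  \<open>U\<^sub>\<sigma>\<close> and \<open>U\<^sub>\<tau>\<close> are glued along \<open>U\<^bsub>\<sigma> \<inter> \<tau>\<^esub>\<close>, which maps to both by restriction of homomorphisms.
\<close>

definition glue_rel ::
    "nat \<Rightarrow> (nat \<Rightarrow> real) set set \<Rightarrow>
     (((nat \<Rightarrow> real) set \<times> affine_point) \<times> ((nat \<Rightarrow> real) set \<times> affine_point)) set" where
  "glue_rel l \<Delta> =
     {((\<sigma>, u), (\<tau>, v)). \<sigma> \<in> \<Delta> \<and> \<tau> \<in> \<Delta> \<and> u \<in> affine_points l \<sigma> \<and> v \<in> affine_points l \<tau> \<and>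
        (\<exists>w\<in>affine_points l (\<sigma> \<inter> \<tau>).
           (\<forall>m\<in>dual_monoid l \<sigma>. u m = w m) \<and> (\<forall>m\<in>dual_monoid l \<tau>. v m = w m))}"

type_synonym toric_point = "((nat \<Rightarrow> real) set \<times> affine_point) set"

definition toric_points :: "nat \<Rightarrow> (nat \<Rightarrow> real) set set \<Rightarrow> toric_point set" where
  "toric_points l \<Delta> = (SIGMA \<sigma>:\<Delta>. affine_points l \<sigma>) // glue_rel l \<Delta>"

definition chart ::
    "nat \<Rightarrow> (nat \<Rightarrow> real) set set \<Rightarrow> (nat \<Rightarrow> real) set \<Rightarrow> affine_point \<Rightarrow> toric_point" where
  "chart l \<Delta> \<sigma> u = glue_rel l \<Delta> `` {(\<sigma>, u)}"

text \<open>
  The Zariski topology is generated by the principal open subsets of the charts. Its underlying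
  space is \<open>toric_points l \<Delta>\<close>.
\<close>

definition toric_topology :: "nat \<Rightarrow> (nat \<Rightarrow> real) set set \<Rightarrow> toric_point topology" where
  "toric_topology l \<Delta> = topology_generated_by
     {chart l \<Delta> \<sigma> ` {u \<in> affine_points l \<sigma>. f u \<noteq> 0} | \<sigma> f. \<sigma> \<in> \<Delta> \<and> f \<in> coordinate_ring l \<sigma>}"

lemma topspace_toric_topology: "topspace (toric_topology l \<Delta>) = toric_points l \<Delta>"
proof -
  define one :: "affine_point \<Rightarrow> complex" where "one = (\<lambda>u. \<Sum>m\<in>{0}. 1 * u m)"
  define D where
    "D \<sigma> f = chart l \<Delta> \<sigma> ` {u \<in> affine_points l \<sigma>. f u \<noteq> 0}" for \<sigma> and f :: "affine_point \<Rightarrow> complex"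
  have zero: "0 \<in> dual_monoid l \<sigma>" for \<sigma>
    by (simp add: dual_monoid_def lattice_vecs_def pairing_def)
  have one: "one \<in> coordinate_ring l \<sigma>" for \<sigma>
    unfolding coordinate_ring_def one_def
    by (rule CollectI, rule exI[of _ "{0}"], rule exI[of _ "\<lambda>_. 1"]) (simp add: zero)
  have "x \<in> \<Union>{D \<sigma> f | \<sigma> f. \<sigma> \<in> \<Delta> \<and> f \<in> coordinate_ring l \<sigma>}" if "x \<in> toric_points l \<Delta>" for x
  proof -
    from that obtain y where y: "y \<in> (SIGMA \<sigma>:\<Delta>. affine_points l \<sigma>)" "x = glue_rel l \<Delta> `` {y}"
      unfolding toric_points_def by (rule quotientE)
    obtain \<sigma> u where su: "y = (\<sigma>, u)" by (cases y)
    with y have *: "\<sigma> \<in> \<Delta>" "u \<in> affine_points l \<sigma>" "x = chart l \<Delta> \<sigma> u"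
      by (simp_all add: chart_def)
    from *(2) have "one u \<noteq> 0" by (simp add: affine_points_def one_def)
    with * have "x \<in> D \<sigma> one" unfolding D_def by simp
    with *(1) one[of \<sigma>] show ?thesis by blast
  qed
  moreover have "x \<in> toric_points l \<Delta>" if "x \<in> D \<sigma> f" "\<sigma> \<in> \<Delta>" for x \<sigma> f
  proof -
    from that(1) obtain u where "u \<in> affine_points l \<sigma>" "x = chart l \<Delta> \<sigma> u"
      unfolding D_def by blast
    with that(2) show ?thesis
      unfolding toric_points_def chart_def by (simp add: quotientI)
  qed
  ultimately have "\<Union>{D \<sigma> f | \<sigma> f. \<sigma> \<in> \<Delta> \<and> f \<in> coordinate_ring l \<sigma>} = toric_points l \<Delta>"
    by blast
  then show ?thesis
    unfolding toric_topology_def topology_generated_by_topspace D_def .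
qed

text \<open>
  The regular functions on an open set \<open>U\<close>: functions which locally, in some chart, are quotients of
  elements of its coordinate ring. Only the values on \<open>U\<close> matter.
\<close>

definition toric_regular ::
    "nat \<Rightarrow> (nat \<Rightarrow> real) set set \<Rightarrow> toric_point set \<Rightarrow> (toric_point \<Rightarrow> complex) set" where
  "toric_regular l \<Delta> U =
     {f. \<forall>x\<in>U. \<exists>\<sigma>\<in>\<Delta>. \<exists>p\<in>coordinate_ring l \<sigma>. \<exists>q\<in>coordinate_ring l \<sigma>. \<exists>V.
           openin (toric_topology l \<Delta>) V \<and> x \<in> V \<and> V \<subseteq> U \<and>
           V \<subseteq> chart l \<Delta> \<sigma> ` affine_points l \<sigma> \<and>
           (\<forall>u\<in>affine_points l \<sigma>. chart l \<Delta> \<sigma> u \<in> V \<longrightarrow>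
              q u \<noteq> 0 \<and> f (chart l \<Delta> \<sigma> u) = p u / q u)}"


section \<open>Line bundles\<close>

text \<open>
  Let \<open>X\<close> be a topological space and \<open>\<O> U\<close> the set of regular functions on the open set \<open>U\<close>. A line
  bundle is given by an open cover \<open>(cover L i)\<close> indexed by \<open>index L\<close> and transition functions
  \<open>trans L i j \<in> \<O>\<^sup>*(cover L i \<inter> cover L j)\<close> satisfying the cocycle condition; sections satisfy
  \<open>s\<^sub>i = trans L i j \<sqdot> s\<^sub>j\<close>.
\<close>

record ('i, 'p) line_bundle_data =
  index :: "'i set"
  cover :: "'i \<Rightarrow> 'p set"
  trans :: "'i \<Rightarrow> 'i \<Rightarrow> 'p \<Rightarrow> complex"

definition line_bundle ::
    "'p topology \<Rightarrow> ('p set \<Rightarrow> ('p \<Rightarrow> complex) set) \<Rightarrow> ('i, 'p) line_bundle_data \<Rightarrow> bool" where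
  "line_bundle X \<O> L \<longleftrightarrow>
     (\<forall>i\<in>index L. openin X (cover L i)) \<and>
     (\<Union>i\<in>index L. cover L i) = topspace X \<and>
     (\<forall>i\<in>index L. \<forall>j\<in>index L. trans L i j \<in> \<O> (cover L i \<inter> cover L j)) \<and>
     (\<forall>i\<in>index L. \<forall>j\<in>index L. \<forall>x\<in>cover L i \<inter> cover L j. trans L i j x \<noteq> 0) \<and>
     (\<forall>i\<in>index L. \<forall>x\<in>cover L i. trans L i i x = 1) \<and>
     (\<forall>i\<in>index L. \<forall>j\<in>index L. \<forall>k\<in>index L. \<forall>x\<in>cover L i \<inter> cover L j \<inter> cover L k.
        trans L i j x * trans L j k x = trans L i k x)"

text \<open>
  \<open>H\<^sup>0(X, L)\<close>. A section is a family of local functions, extended by zero, so that two sections are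
  equal iff they are equal as functions.
\<close>

type_synonym ('i, 'p) lb_section = "'i \<Rightarrow> 'p \<Rightarrow> complex"

definition H0 ::
    "('p set \<Rightarrow> ('p \<Rightarrow> complex) set) \<Rightarrow> ('i, 'p) line_bundle_data \<Rightarrow> ('i, 'p) lb_section set" where
  "H0 \<O> L =
     {s. (\<forall>i\<in>index L. s i \<in> \<O> (cover L i)) \<and>
         (\<forall>i\<in>index L. \<forall>j\<in>index L. \<forall>x\<in>cover L i \<inter> cover L j. s i x = trans L i j x * s j x) \<and>
         (\<forall>i x. \<not> (i \<in> index L \<and> x \<in> cover L i) \<longrightarrow> s i x = 0)}"

text \<open>
  The tensor product of two line bundles trivialised on the same cover; in particular \<open>L \<otimes> L\<close>
  and \<open>L\<^sup>\<otimes>\<^sup>k\<close>.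
\<close>

definition lb_tensor ::
    "('i, 'p) line_bundle_data \<Rightarrow> ('i, 'p) line_bundle_data \<Rightarrow> ('i, 'p) line_bundle_data" where
  "lb_tensor L L' = L\<lparr>trans := (\<lambda>i j x. trans L i j x * trans L' i j x)\<rparr>"

definition lb_power :: "('i, 'p) line_bundle_data \<Rightarrow> nat \<Rightarrow> ('i, 'p) line_bundle_data" where
  "lb_power L k = L\<lparr>trans := (\<lambda>i j x. trans L i j x ^ k)\<rparr>"

definition nonvanishing_locus ::
    "('i, 'p) line_bundle_data \<Rightarrow> ('i, 'p) lb_section \<Rightarrow> 'p set" where
  "nonvanishing_locus L s = {x. \<exists>i\<in>index L. x \<in> cover L i \<and> s i x \<noteq> 0}"

text \<open>
  Ampleness as in EGA II, 4.5.2--4.5.3: the (automatically open) sets \<open>X\<^sub>s\<close>, where \<open>s\<close> ranges over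
  the sections of all positive powers of \<open>L\<close>, form a basis of the Zariski topology. The standing
  assumption that \<open>X\<close> is quasi-compact and separated holds for the variety of a (finite) fan.
\<close>

definition ample ::
    "'p topology \<Rightarrow> ('p set \<Rightarrow> ('p \<Rightarrow> complex) set) \<Rightarrow> ('i, 'p) line_bundle_data \<Rightarrow> bool" where
  "ample X \<O> L \<longleftrightarrow>
     (\<forall>W x. openin X W \<and> x \<in> W \<longrightarrow>
        (\<exists>k\<ge>1. \<exists>s\<in>H0 \<O> (lb_power L k).
           x \<in> nonvanishing_locus L s \<and> nonvanishing_locus L s \<subseteq> W))"


section \<open>The product of sections\<close>

text \<open>
  The algebraic tensor product \<open>V \<otimes>\<^sub>\<complex> W\<close> of two spaces of sections: finite formal linear
  combinations of pairs in \<open>V \<times> W\<close>, modulo the bilinearity relations.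
\<close>

definition formal_pair :: "'s \<times> 't \<Rightarrow> ('s \<times> 't \<Rightarrow> complex)" where
  "formal_pair p = (\<lambda>q. if q = p then 1 else 0)"

definition formal_sums :: "'s set \<Rightarrow> 't set \<Rightarrow> ('s \<times> 't \<Rightarrow> complex) set" where
  "formal_sums V W = {a. finite {p. a p \<noteq> 0} \<and> {p. a p \<noteq> 0} \<subseteq> V \<times> W}"

definition sec_scale :: "complex \<Rightarrow> ('i, 'p) lb_section \<Rightarrow> ('i, 'p) lb_section" where
  "sec_scale c s = (\<lambda>i x. c * s i x)"

definition bilinear_relations ::
    "('i, 'p) lb_section set \<Rightarrow> ('i, 'p) lb_section set \<Rightarrow>
     (('i, 'p) lb_section \<times> ('i, 'p) lb_section \<Rightarrow> complex) set" where
  "bilinear_relations V W =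
     {formal_pair (s + s', t) - formal_pair (s, t) - formal_pair (s', t) | s s' t.
        s \<in> V \<and> s' \<in> V \<and> t \<in> W} \<union>
     {formal_pair (s, t + t') - formal_pair (s, t) - formal_pair (s, t') | s t t'.
        s \<in> V \<and> t \<in> W \<and> t' \<in> W} \<union>
     {formal_pair (sec_scale c s, t) - (\<lambda>p. c * formal_pair (s, t) p) | c s t. s \<in> V \<and> t \<in> W} \<union>
     {formal_pair (s, sec_scale c t) - (\<lambda>p. c * formal_pair (s, t) p) | c s t. s \<in> V \<and> t \<in> W}"

definition tensor_product ::
    "('i, 'p) lb_section set \<Rightarrow> ('i, 'p) lb_section set \<Rightarrow>
     (('i, 'p) lb_section \<times> ('i, 'p) lb_section \<Rightarrow> complex) set set" where
  "tensor_product V W = formal_sums V W //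
     {(a, b). a \<in> formal_sums V W \<and> b \<in> formal_sums V W \<and>
        a - b \<in> module.span (\<lambda>(c::complex) a p. c * a p) (bilinear_relations V W)}"

text \<open>
  The linear map on \<open>V \<otimes> W\<close> induced by \<open>s \<otimes> t \<mapsto> s \<sqdot> t\<close>, where products of sections are computed in
  the local trivialisations. All representatives of an element of \<open>V \<otimes> W\<close> have the same image.
\<close>

definition formal_product ::
    "(('i, 'p) lb_section \<times> ('i, 'p) lb_section \<Rightarrow> complex) \<Rightarrow> ('i, 'p) lb_section" where
  "formal_product a = (\<lambda>i x. \<Sum>(s, t)\<in>{p. a p \<noteq> 0}. a (s, t) * (s i x * t i x))"

definition section_product ::
    "(('i, 'p) lb_section \<times> ('i, 'p) lb_section \<Rightarrow> complex) set \<Rightarrow> ('i, 'p) lb_section" where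
  "section_product T = the_elem (formal_product ` T)"

end

(*
  Over an affine chart, which is an affine space, every line bundle is trivial because the polynomial
  ring is factorial. Comparing two such trivialisations on the overlap of their charts gives a unit
  there, i.e. a constant times a character. Hence the sections of the k-th power of L have as basis the
  characters in the lattice points of the k-th multiple of a polyhedron, cut out by one inequality per
  ray. A section of a power of L that does not vanish at a torus-fixed point shows that the vertex
  belonging to this point lies in the polyhedron.

  It remains to write every lattice point m of twice the polyhedron as a sum of two lattice points of
  the polyhedron. Translate so that the inequalities of the rays e_j become m_j >= 0, and put
  S = m_1 + ... + m_{l-1}. The rays i (e_1 + ... + e_{l-1}) + e_l only see S and m_l and bound a
  polygon with integral breakpoints d_0 >= d_1 >= ... >= 0 in the coordinate S, while the inequality of
  the last ray is implied by the others where S <= d_1. If S < 2 d_1, halve S with rounding and ignore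
  the last ray. If S >= 2 d_1, keep both summands in the region S >= d_1, where only the first chain
  ray and the last ray are left; there halving with rounding works, except for one parity in which the
  halves of m_1 have to be moved by one unit.
*)

theory Submission
  imports Defs "HOL-Computational_Algebra.Fundamental_Theorem_Algebra"
begin


section \<open>Divisibility and factorization in subrings\<close>

text \<open>The variety is given by points and functions, so polynomial rings occur as rings of
  functions and algebraic facts must become facts about zeros. The bridge: for a prime
  \<open>p\<close> not dividing \<open>g\<close> there is a point with \<open>p = 0\<close> and
  \<open>g\<close> nonzero. With factoriality it shows that nowhere vanishing polynomials are units,
  that a fraction in lowest terms has no removable poles and that hypersurfaces are irreducible;
  this suffices to trivialise line bundles on a chart.

  In the arithmetic the threshold \<open>d_1\<close> is where convexity at the last ray acts: after
  translation its height \<open>c\<close> satisfies \<open>b_1 \<le> c \<le> 2 b_1 - d_1\<close>,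
  with \<open>b_i\<close> the heights of the chain rays. The upper bound makes the last inequality
  follow from the chain where \<open>S \<le> d_1\<close>. The trouble with parity comes from the
  last ray being \<open>e_1 + 2 (e_2 + ... + e_l)\<close>: because of the odd coefficient at
  \<open>m_1\<close>, rounded halves miss its inequality by one unit exactly when \<open>m_1\<close>
  is even, \<open>m_1 + ... + m_l\<close> is odd and the inequality is an equality.\<close>

locale subdomain =
  fixes S :: "'a::comm_ring_1 set"
  assumes zero [simp, intro]: "0 \<in> S" and one [simp, intro]: "1 \<in> S"
    and add [simp]: "a \<in> S \<Longrightarrow> b \<in> S \<Longrightarrow> a + b \<in> S"
    and uminus [simp]: "a \<in> S \<Longrightarrow> - a \<in> S"
    and mult [simp]: "a \<in> S \<Longrightarrow> b \<in> S \<Longrightarrow> a * b \<in> S"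
    and no_zero_div: "a \<in> S \<Longrightarrow> b \<in> S \<Longrightarrow> a * b = 0 \<Longrightarrow> a = 0 \<or> b = 0"
begin

lemma diff [simp]: "a \<in> S \<Longrightarrow> b \<in> S \<Longrightarrow> a - b \<in> S"
  using add[of a "-b"] uminus[of b] by simp

lemma power [simp]: "a \<in> S \<Longrightarrow> a ^ n \<in> S"
  by (induction n) auto

lemma prod_list [simp]: "set ps \<subseteq> S \<Longrightarrow> prod_list ps \<in> S"
  by (induction ps) auto

lemma sum [simp]: "(\<And>i. i \<in> I \<Longrightarrow> f i \<in> S) \<Longrightarrow> sum f I \<in> S"
  by (induction I rule: infinite_finite_induct) auto

lemma cancel: "a \<in> S \<Longrightarrow> b \<in> S \<Longrightarrow> c \<in> S \<Longrightarrow> c \<noteq> 0 \<Longrightarrow> c * a = c * b \<Longrightarrow> a = b"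
  using no_zero_div[of c "a - b"] by (auto simp: algebra_simps)

lemma mult_ne: "a \<in> S \<Longrightarrow> b \<in> S \<Longrightarrow> a \<noteq> 0 \<Longrightarrow> b \<noteq> 0 \<Longrightarrow> a * b \<noteq> 0"
  using no_zero_div by blast

lemma power_ne: "a \<in> S \<Longrightarrow> a \<noteq> 0 \<Longrightarrow> a ^ n \<noteq> 0"
proof (induction n)
  case (Suc n)
  then show ?case using mult_ne[of a "a ^ n"] by simp
qed simp

end

text \<open>The rings of interest are subrings of a ring of all functions, which has zero divisors
  and in which every nowhere vanishing function is invertible; hence the cofactor is required to lie
  in \<open>S\<close>.\<close>

definition dvd_in :: "'a::comm_ring_1 set \<Rightarrow> 'a \<Rightarrow> 'a \<Rightarrow> bool" where
  "dvd_in S a b \<longleftrightarrow> (\<exists>c\<in>S. b = a * c)"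

definition unit_in :: "'a::comm_ring_1 set \<Rightarrow> 'a \<Rightarrow> bool" where
  "unit_in S u \<longleftrightarrow> u \<in> S \<and> dvd_in S u 1"

definition prime_in :: "'a::comm_ring_1 set \<Rightarrow> 'a \<Rightarrow> bool" where
  "prime_in S p \<longleftrightarrow> p \<in> S \<and> p \<noteq> 0 \<and> \<not> dvd_in S p 1 \<and>
     (\<forall>a\<in>S. \<forall>b\<in>S. dvd_in S p (a * b) \<longrightarrow> dvd_in S p a \<or> dvd_in S p b)"

text \<open>Asking for prime rather than irreducible factors makes uniqueness of the factorization
  automatic.\<close>

definition factorial_in :: "'a::comm_ring_1 set \<Rightarrow> bool" where
  "factorial_in S \<longleftrightarrow> (\<forall>a\<in>S. a \<noteq> 0 \<longrightarrow>
     (\<exists>u ps. unit_in S u \<and> (\<forall>p\<in>set ps. prime_in S p) \<and> a = u * prod_list ps))"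

lemma prime_inD:
  assumes "prime_in S p"
  shows "p \<in> S" "p \<noteq> 0" "\<not> dvd_in S p 1"
    and "a \<in> S \<Longrightarrow> b \<in> S \<Longrightarrow> dvd_in S p (a * b) \<Longrightarrow> dvd_in S p a \<or> dvd_in S p b"
  using assms unfolding prime_in_def by blast+

context subdomain
begin

lemma dvd_in_refl [intro, simp]: "dvd_in S a a"
  unfolding dvd_in_def by (rule bexI[of _ 1]) auto

lemma dvd_in_mult: "dvd_in S a b \<Longrightarrow> c \<in> S \<Longrightarrow> dvd_in S a (b * c)"
  unfolding dvd_in_def by (metis mult mult.assoc)

lemma dvd_in_trans: "dvd_in S a b \<Longrightarrow> dvd_in S b c \<Longrightarrow> dvd_in S a c"
  unfolding dvd_in_def by (metis mult mult.assoc)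

lemma dvd_in_add: "dvd_in S a b \<Longrightarrow> dvd_in S a c \<Longrightarrow> dvd_in S a (b + c)"
  unfolding dvd_in_def by (metis add distrib_left)

lemma dvd_in_diff: "dvd_in S a b \<Longrightarrow> dvd_in S a c \<Longrightarrow> dvd_in S a (b - c)"
  unfolding dvd_in_def by (metis diff right_diff_distrib)

lemma dvd_in_zero [intro, simp]: "dvd_in S a 0"
  unfolding dvd_in_def by (rule bexI[of _ 0]) auto

lemma unit_in_one [intro]: "unit_in S 1"
  unfolding unit_in_def by auto

lemma unit_in_mult: "unit_in S a \<Longrightarrow> unit_in S b \<Longrightarrow> unit_in S (a * b)"
  unfolding unit_in_def dvd_in_def
  by (metis mult mult.assoc mult.commute mult_1)

lemma unit_in_ne: "unit_in S u \<Longrightarrow> u \<noteq> 0"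
  unfolding unit_in_def dvd_in_def by auto

lemma prime_not_dvd_unit: "prime_in S p \<Longrightarrow> unit_in S u \<Longrightarrow> \<not> dvd_in S p u"
  unfolding unit_in_def using dvd_in_trans prime_inD(3) by blast

lemma prime_dvd_prod_list:
  assumes "prime_in S p" "dvd_in S p (prod_list ps)" "set ps \<subseteq> S"
  shows "\<exists>q\<in>set ps. dvd_in S p q"
  using assms(2,3)
proof (induction ps)
  case Nil
  then show ?case using prime_inD(3)[OF assms(1)] by simp
next
  case (Cons q ps)
  then show ?case using prime_inD(4)[OF assms(1), of q "prod_list ps"] by auto
qed

lemma prime_not_dvd_power: "prime_in S p \<Longrightarrow> a \<in> S \<Longrightarrow> \<not> dvd_in S p a \<Longrightarrow> \<not> dvd_in S p (a ^ n)"
proof (induction n)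
  case (Suc n)
  then show ?case using prime_inD(4)[OF Suc(2,3), of "a ^ n"] by auto
qed (simp add: prime_inD(3))

text \<open>If \<open>q = p * c\<close> is prime, it divides \<open>p\<close> or \<open>c\<close>;
  cancelling makes \<open>c\<close> or \<open>p\<close> a unit, and \<open>p\<close> is not
  one.\<close>

lemma prime_dvd_prime:
  assumes "prime_in S p" "prime_in S q" "dvd_in S p q"
  shows "\<exists>c. unit_in S c \<and> q = p * c"
proof -
  from assms(3) obtain c where c: "c \<in> S" "q = p * c" unfolding dvd_in_def by blast
  have "dvd_in S q (p * c)" using c by auto
  then have "dvd_in S q p \<or> dvd_in S q c"
    using prime_inD(4)[OF assms(2) prime_inD(1)[OF assms(1)] c(1)] by blast
  then show ?thesis
  proof
    assume "dvd_in S q p"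
    then obtain k where k: "k \<in> S" "p = q * k" unfolding dvd_in_def by blast
    have "p * (c * k) = q * k" using c(2) by (simp add: mult.assoc)
    also have "\<dots> = p * 1" by (simp only: k(2)[symmetric] mult_1_right)
    finally have "c * k = 1" using cancel[of "c * k" 1 p] prime_inD[OF assms(1)] c(1) k(1) by auto
    then have "unit_in S c" unfolding unit_in_def dvd_in_def using c(1) k(1) by metis
    with c show ?thesis by blast
  next
    assume "dvd_in S q c"
    then obtain k where k: "k \<in> S" "c = q * k" unfolding dvd_in_def by blast
    have "q * (p * k) = p * c" using k(2) by (simp add: mult.left_commute)
    also have "\<dots> = q * 1" by (simp only: c(2)[symmetric] mult_1_right)
    finally have "p * k = 1" using cancel[of "p * k" 1 q] prime_inD[OF assms(1)] prime_inD[OF assms(2)] k(1)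
      by auto
    then have "dvd_in S p 1" unfolding dvd_in_def using k(1) by metis
    then show ?thesis using prime_inD(3)[OF assms(1)] by blast
  qed
qed

lemma factorization_in: "unit_in S u \<Longrightarrow> \<forall>p\<in>set ps. prime_in S p \<Longrightarrow> u * prod_list ps \<in> S"
  by (intro mult prod_list) (auto simp: unit_in_def dest: prime_inD(1))

text \<open>A prime dividing the product is an associate of one of the listed factors; that factor
  is dropped and the unit absorbed. The shorter list is the induction measure wherever primes are
  cancelled one by one.\<close>

lemma factorization_remove:
  assumes "unit_in S u" "\<forall>q\<in>set ps. prime_in S q" "prime_in S p" "dvd_in S p (u * prod_list ps)"
  shows "\<exists>v qs. unit_in S v \<and> (\<forall>q\<in>set qs. prime_in S q) \<and> length ps = Suc (length qs) \<and>
           u * prod_list ps = p * (v * prod_list qs)"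
proof -
  have sub: "set ps \<subseteq> S" using assms(2) prime_inD(1) by blast
  have "\<not> dvd_in S p u" using assms prime_not_dvd_unit by blast
  then have "dvd_in S p (prod_list ps)"
    using assms(1,4) prime_inD(4)[OF assms(3) _ prod_list[OF sub], of u] unfolding unit_in_def by blast
  then obtain q where q: "q \<in> set ps" "dvd_in S p q"
    using prime_dvd_prod_list[OF assms(3) _ sub] by blast
  then obtain c where c: "unit_in S c" "q = p * c" using prime_dvd_prime assms by blast
  from q(1) obtain xs ys where s: "ps = xs @ q # ys" by (meson split_list)
  show ?thesis
    by (rule exI[of _ "u * c"], rule exI[of _ "xs @ ys"])
      (use assms c s in \<open>auto simp: unit_in_mult algebra_simps\<close>)
qed

lemma exists_prime_factor:
  assumes "factorial_in S" "a \<in> S" "a \<noteq> 0" "\<not> unit_in S a"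
  shows "\<exists>p. prime_in S p \<and> dvd_in S p a"
proof -
  obtain u ps where *: "unit_in S u" "\<forall>p\<in>set ps. prime_in S p" "a = u * prod_list ps"
    using assms unfolding factorial_in_def by blast
  show ?thesis
  proof (cases ps)
    case Nil
    then show ?thesis using * assms by simp
  next
    case (Cons p qs)
    have "prod_list qs \<in> S" using * Cons prime_inD(1) by (intro prod_list) auto
    then have "dvd_in S p a" unfolding dvd_in_def
      using * Cons by (intro bexI[of _ "u * prod_list qs"]) (auto simp: unit_in_def algebra_simps)
    with * Cons show ?thesis by auto
  qed
qed

text \<open>Induction on the number of prime factors of the denominator: a common prime is moved
  into \<open>g\<close>.\<close>

lemma lowest_terms:
  assumes "factorial_in S" "a \<in> S" "b \<in> S" "b \<noteq> 0"
  shows "\<exists>g\<in>S. \<exists>a'\<in>S. \<exists>b'\<in>S. g \<noteq> 0 \<and> a = g * a' \<and> b = g * b' \<and>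
           (\<forall>p. prime_in S p \<longrightarrow> \<not> (dvd_in S p a' \<and> dvd_in S p b'))"
proof -
  have *: "\<exists>g\<in>S. \<exists>a'\<in>S. \<exists>b'\<in>S. g \<noteq> 0 \<and> a = g * a' \<and> b = g * b' \<and>
           (\<forall>p. prime_in S p \<longrightarrow> \<not> (dvd_in S p a' \<and> dvd_in S p b'))"
    if "unit_in S u" "\<forall>p\<in>set ps. prime_in S p" "a \<in> S" "b = u * prod_list ps" for u ps a b
    using that
  proof (induction "length ps" arbitrary: u ps a b)
    case 0
    then have "unit_in S b" by simp
    then have "\<forall>p. prime_in S p \<longrightarrow> \<not> (dvd_in S p a \<and> dvd_in S p b)"
      using prime_not_dvd_unit by blast
    then show ?case using 0 \<open>unit_in S b\<close>
      by (intro bexI[of _ 1] bexI[of _ a] bexI[of _ b]) (auto simp: unit_in_def)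
  next
    case (Suc n)
    have bS: "b \<in> S" using Suc factorization_in by simp
    show ?case
    proof (cases "\<exists>p. prime_in S p \<and> dvd_in S p a \<and> dvd_in S p b")
      case False
      then show ?thesis using bS Suc by (intro bexI[of _ 1] bexI[of _ a] bexI[of _ b]) auto
    next
      case True
      then obtain p where p: "prime_in S p" "dvd_in S p a" "dvd_in S p b" by blast
      then obtain c where c: "c \<in> S" "a = p * c" unfolding dvd_in_def by blast
      obtain v qs where v: "unit_in S v" "\<forall>q\<in>set qs. prime_in S q" "length ps = Suc (length qs)"
        "b = p * (v * prod_list qs)"
        using factorization_remove[OF Suc(3,4) p(1)] p(3) Suc by metis
      have "n = length qs" using v Suc by simp
      from Suc(1)[OF this v(1,2) c(1) refl]
      obtain g a' b' where "g \<in> S" "a' \<in> S" "b' \<in> S" "g \<noteq> 0" "c = g * a'" "v * prod_list qs = g * b'"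
        "\<forall>p. prime_in S p \<longrightarrow> \<not> (dvd_in S p a' \<and> dvd_in S p b')" by blast
      moreover have "p * g \<noteq> 0" "p * g \<in> S"
        using mult_ne[of p g] prime_inD(1,2)[OF p(1)] \<open>g \<in> S\<close> \<open>g \<noteq> 0\<close> by auto
      moreover have "a = p * g * a'" "b = p * g * b'"
        using c(2) v(4) \<open>c = g * a'\<close> \<open>v * prod_list qs = g * b'\<close> by (simp_all add: mult.assoc)
      ultimately show ?thesis by blast
    qed
  qed
  show ?thesis using assms * unfolding factorial_in_def by metis
qed

end

section \<open>Gauss's lemma\<close>

definition polys :: "'a::comm_ring_1 set \<Rightarrow> 'a poly set" where
  "polys S = {p. \<forall>i. coeff p i \<in> S}"

context subdomain
begin

lemma lead_coeff_mult_ne: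
  assumes "p \<in> polys S" "q \<in> polys S" "p \<noteq> 0" "q \<noteq> 0"
  shows "coeff (p * q) (degree p + degree q) \<noteq> 0"
  using assms no_zero_div[of "lead_coeff p" "lead_coeff q"] unfolding coeff_mult_degree_sum polys_def
  by (auto simp del: leading_coeff_neq_0)

lemma degree_mult:
  assumes "p \<in> polys S" "q \<in> polys S" "p \<noteq> 0" "q \<noteq> 0"
  shows "degree (p * q) = degree p + degree q"
  using lead_coeff_mult_ne[OF assms] degree_mult_le[of p q] le_degree
  by (metis le_antisym)

lemma subdomain_polys: "subdomain (polys S)"
proof
  fix a b assume ab: "a \<in> polys S" "b \<in> polys S"
  show "a * b \<in> polys S"
    using ab by (auto simp: polys_def coeff_mult)
  show "a * b = 0 \<Longrightarrow> a = 0 \<or> b = 0"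
    using lead_coeff_mult_ne[OF ab] by auto
qed (auto simp: polys_def coeff_pCons split: nat.split)

interpretation P: subdomain "polys S" by (rule subdomain_polys)

lemma const_in_polys [simp]: "[:a:] \<in> polys S \<longleftrightarrow> a \<in> S"
  by (auto simp: polys_def coeff_pCons split: nat.splits)

lemma coeff_in: "p \<in> polys S \<Longrightarrow> coeff p i \<in> S"
  by (simp add: polys_def)

lemma monom_in: "a \<in> S \<Longrightarrow> monom a n \<in> polys S"
  by (auto simp: polys_def)

lemma const_dvd_iff: "f \<in> polys S \<Longrightarrow> a \<in> S \<Longrightarrow>
    dvd_in (polys S) [:a:] f \<longleftrightarrow> (\<forall>i. dvd_in S a (coeff f i))"
proof
  assume f: "f \<in> polys S" "a \<in> S" and *: "\<forall>i. dvd_in S a (coeff f i)"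
  then obtain c where c: "\<And>i. c i \<in> S" "\<And>i. coeff f i = a * c i"
    unfolding dvd_in_def by metis
  define g where "g = (\<Sum>i\<le>degree f. monom (c i) i)"
  have "f = [:a:] * g"
    by (rule poly_eqI) (auto simp: g_def coeff_sum c(2) coeff_eq_0 simp flip: c(2))
  moreover have "g \<in> polys S" unfolding g_def by (rule P.sum) (simp add: monom_in c)
  ultimately show "dvd_in (polys S) [:a:] f" unfolding dvd_in_def by blast
qed (auto simp: dvd_in_def polys_def)

text \<open>Gauss's lemma: the first coefficients of \<open>f\<close> and \<open>g\<close> not
  divisible by \<open>p\<close>, at positions \<open>i\<close> and \<open>j\<close>, contribute the
  only term of the coefficient of \<open>f * g\<close> at \<open>i + j\<close> that \<open>p\<close>
  does not divide.\<close>

lemma prime_const: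
  assumes p: "prime_in S p"
  shows "prime_in (polys S) [:p:]"
proof -
  note pD = prime_inD[OF p]
  have "dvd_in (polys S) [:p:] f \<or> dvd_in (polys S) [:p:] g"
    if fg: "f \<in> polys S" "g \<in> polys S" "dvd_in (polys S) [:p:] (f * g)" for f g
  proof (rule ccontr)
    assume "\<not> ?thesis"
    then have ex: "\<exists>i. \<not> dvd_in S p (coeff f i)" "\<exists>i. \<not> dvd_in S p (coeff g i)"
      using const_dvd_iff fg pD by blast+
    define i where "i = (LEAST i. \<not> dvd_in S p (coeff f i))"
    define j where "j = (LEAST j. \<not> dvd_in S p (coeff g j))"
    have i: "\<not> dvd_in S p (coeff f i)" "\<And>k. k < i \<Longrightarrow> dvd_in S p (coeff f k)"
      unfolding i_def using LeastI_ex[OF ex(1)] not_less_Least by auto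
    have j: "\<not> dvd_in S p (coeff g j)" "\<And>k. k < j \<Longrightarrow> dvd_in S p (coeff g k)"
      unfolding j_def using LeastI_ex[OF ex(2)] not_less_Least by auto
    let ?t = "\<lambda>k. coeff f k * coeff g (i + j - k)"
    have "dvd_in S p (coeff (f * g) (i + j))"
      using const_dvd_iff fg(3) P.mult[OF fg(1,2)] pD(1) by blast
    moreover have "coeff (f * g) (i + j) = coeff f i * coeff g j + (\<Sum>k\<in>{..i+j} - {i}. ?t k)"
      unfolding coeff_mult by (subst sum.remove[of _ i]) auto
    moreover have "dvd_in S p (\<Sum>k\<in>K. ?t k)" if "K \<subseteq> {..i+j} - {i}" for K
    proof -
      have "finite K" using that finite_subset by blast
      then show ?thesis using that
      proof (induction K)
        case (insert k K)
        have "dvd_in S p (?t k)"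
        proof (cases "k < i")
          case True
          then show ?thesis using i(2) dvd_in_mult coeff_in fg by blast
        next
          case False
          with insert have "i + j - k < j" by auto
          from dvd_in_mult[OF j(2)[OF this] coeff_in[OF fg(1), of k]] show ?thesis
            by (simp add: mult.commute)
        qed
        with insert show ?case by (auto intro: dvd_in_add)
      qed auto
    qed
    ultimately have "dvd_in S p (coeff f i * coeff g j)"
      using dvd_in_diff[of p "coeff (f * g) (i + j)" "\<Sum>k\<in>{..i+j} - {i}. ?t k"] by auto
    then show False using pD(4) coeff_in fg i j by blast
  qed
  moreover have "\<not> dvd_in (polys S) [:p:] 1"
    using const_dvd_iff[of 1 p] pD P.one by (auto dest!: spec[of _ 0])
  ultimately show ?thesis unfolding prime_in_def using pD by auto
qed

section \<open>Primitive polynomials, elimination and Gauss's theorem\<close>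

definition primitive :: "'a poly \<Rightarrow> bool" where
  "primitive f \<longleftrightarrow> f \<in> polys S \<and> (\<forall>p. prime_in S p \<longrightarrow> \<not> dvd_in (polys S) [:p:] f)"

context
  assumes fact: "factorial_in S"
begin

lemma factorize:
  assumes "a \<in> S" "a \<noteq> 0"
  obtains u ps where "unit_in S u" "\<forall>p\<in>set ps. prime_in S p" "a = u * prod_list ps"
  using fact assms unfolding factorial_in_def by blast

lemma unit_const: "unit_in S u \<Longrightarrow> unit_in (polys S) [:u:]"
  unfolding unit_in_def dvd_in_def
  by (auto intro!: bexI[of _ "[:c:]" for c] simp: one_pCons)

text \<open>The primes of \<open>a\<close> are cancelled one by one: as constants they stay prime,
  and they cannot divide the primitive \<open>f\<close>, so they divide the cofactor.\<close>

lemma primitive_dvd_smult: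
  assumes f: "primitive f" and h: "h \<in> polys S" and a: "a \<in> S" "a \<noteq> 0"
    and dvd: "dvd_in (polys S) f (smult a h)"
  shows "dvd_in (polys S) f h"
proof -
  have *: "dvd_in (polys S) f h"
    if "unit_in S u" "\<forall>p\<in>set ps. prime_in S p" "h \<in> polys S"
      "dvd_in (polys S) f (smult (u * prod_list ps) h)" for u ps h
    using that
  proof (induction ps arbitrary: h)
    case Nil
    then obtain c where c: "c \<in> S" "c * u = 1" unfolding unit_in_def dvd_in_def by (metis mult.commute)
    have "dvd_in (polys S) f (smult u h * [:c:])"
      using P.dvd_in_mult[OF Nil(4), of "[:c:]"] c by simp
    then show ?case using c by simp
  next
    case (Cons p ps)
    let ?a = "u * prod_list ps"
    have aS: "?a \<in> S" using Cons factorization_in by simp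
    from Cons(5) obtain w where w: "w \<in> polys S" "smult (u * (p * prod_list ps)) h = f * w"
      unfolding dvd_in_def by auto
    have pp: "prime_in S p" using Cons by simp
    note pD = prime_inD[OF this]
    have ah: "smult ?a h \<in> polys S" using P.mult[of "[:?a:]" h] aS Cons(4) by simp
    have "[:p:] * smult ?a h = f * w" using w(2) by (simp add: algebra_simps)
    then have "dvd_in (polys S) [:p:] (f * w)" unfolding dvd_in_def using ah by metis
    then have "dvd_in (polys S) [:p:] w"
      using prime_inD(4)[OF prime_const[OF pp]] f w pp unfolding primitive_def by blast
    then obtain w' where w': "w' \<in> polys S" "w = [:p:] * w'" unfolding dvd_in_def by blast
    have "[:p:] * smult ?a h = [:p:] * (f * w')"
      using \<open>[:p:] * smult ?a h = f * w\<close> w' by (simp add: algebra_simps)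
    then have "smult ?a h = f * w'"
      using P.cancel[of "smult ?a h" "f * w'" "[:p:]"] ah w' f pD unfolding primitive_def by auto
    then have "dvd_in (polys S) f (smult ?a h)" unfolding dvd_in_def using w' by blast
    with Cons show ?case by auto
  qed
  show ?thesis using factorize[OF a] * h dvd by metis
qed

text \<open>Each prime constant pulled out of \<open>f\<close> also leaves its leading coefficient,
  so the number of prime factors of the leading coefficient bounds the process.\<close>

lemma primitive_part:
  assumes "f \<in> polys S" "f \<noteq> 0"
  shows "\<exists>c\<in>S. \<exists>g. c \<noteq> 0 \<and> primitive g \<and> f = smult c g"
proof -
  have *: "\<exists>c\<in>S. \<exists>g. c \<noteq> 0 \<and> primitive g \<and> f = smult c g"
    if "unit_in S u" "\<forall>p\<in>set ps. prime_in S p" "f \<in> polys S" "lead_coeff f = u * prod_list ps" "f \<noteq> 0"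
    for u ps f using that
  proof (induction "length ps" arbitrary: u ps f rule: less_induct)
    case less
    show ?case
    proof (cases "primitive f")
      case True
      then show ?thesis by (intro bexI[of _ 1]) auto
    next
      case False
      then obtain p where p: "prime_in S p" "dvd_in (polys S) [:p:] f"
        using less unfolding primitive_def by blast
      then obtain g where g: "g \<in> polys S" "f = [:p:] * g" unfolding dvd_in_def by blast
      note pD = prime_inD[OF p(1)]
      have gne: "g \<noteq> 0" using g less by auto
      then have "degree f = degree g" using degree_mult[of "[:p:]" g] g pD by auto
      then have lc: "lead_coeff f = p * lead_coeff g" using g by simp
      then have "dvd_in S p (u * prod_list ps)"
        unfolding dvd_in_def using less(5) coeff_in[OF g(1)] by metis
      then obtain v qs where v: "unit_in S v" "\<forall>q\<in>set qs. prime_in S q" "length ps = Suc (length qs)"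
          "u * prod_list ps = p * (v * prod_list qs)"
        using factorization_remove[OF less(2,3) p(1)] by blast
      have vS: "v * prod_list qs \<in> S" using v factorization_in by simp
      have "lead_coeff g = v * prod_list qs"
        by (rule cancel[OF _ vS pD(1,2)]) (use lc v less(5) coeff_in[OF g(1)] in auto)
      then obtain c g' where "c \<in> S" "c \<noteq> 0" "primitive g'" "g = smult c g'"
        using less(1)[of qs v g] v g gne by auto
      then show ?thesis using g pD
        by (intro bexI[of _ "p * c"] exI[of _ g']) (auto dest: no_zero_div simp: mult.commute)
    qed
  qed
  have "lead_coeff f \<in> S" "lead_coeff f \<noteq> 0" using assms coeff_in by auto
  from factorize[OF this] show ?thesis using * assms by metis
qed

text \<open>Replaces division with remainder over the field of fractions of \<open>S\<close>; the
  factor \<open>a\<close> is a power of the leading coefficient of \<open>d\<close>.\<close>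

lemma pseudo_division:
  assumes d: "d \<in> polys S" "d \<noteq> 0" and f: "f \<in> polys S"
  shows "\<exists>a\<in>S. \<exists>q\<in>polys S. \<exists>r\<in>polys S. a \<noteq> 0 \<and> smult a f = q * d + r \<and> (r = 0 \<or> degree r < degree d)"
  using f
proof (induction "degree f" arbitrary: f rule: less_induct)
  case less
  show ?case
  proof (cases "f = 0 \<or> degree f < degree d")
    case True
    then show ?thesis using less
      by (intro bexI[of _ 1] bexI[of _ 0] bexI[of _ f]) auto
  next
    case False
    let ?m = "monom (lead_coeff f) (degree f - degree d)"
    let ?g = "smult (lead_coeff d) f - ?m * d"
    have lf: "lead_coeff f \<in> S" "lead_coeff f \<noteq> 0" "lead_coeff d \<in> S" "lead_coeff d \<noteq> 0"
      using coeff_in d less False by auto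
    have m: "?m \<in> polys S" "?m \<noteq> 0" using lf monom_in by auto
    have "smult (lead_coeff d) f \<in> polys S"
      using P.mult[of "[:lead_coeff d:]" f] lf less by simp
    then have g: "?g \<in> polys S" using P.diff P.mult m d by blast
    have dpts: "degree (?m * d) = degree f"
      using degree_mult[OF m(1) d(1) m(2) d(2)] lf False by (simp add: degree_monom_eq)
    have "coeff (?m * d) (degree f) = lead_coeff f * lead_coeff d"
      using coeff_mult_degree_sum[of ?m d] dpts degree_mult[OF m(1) d(1) m(2) d(2)] lf
      by (simp add: degree_monom_eq)
    then have c0: "coeff ?g (degree f) = 0" by (simp add: mult.commute)
    have le: "degree ?g \<le> degree f"
      using degree_diff_le_max[of "smult (lead_coeff d) f" "?m * d"] dpts degree_smult_le[of "lead_coeff d" f] by simp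
    show ?thesis
    proof (cases "degree f = 0")
      case True
      then have "?g = 0" using le c0 by (metis le_zero_eq leading_coeff_0_iff)
      then show ?thesis using m lf by (intro bexI[of _ "lead_coeff d"] bexI[of _ ?m] bexI[of _ 0]) auto
    next
      case nz: False
      then have "degree ?g < degree f" using le c0
        by (metis leading_coeff_0_iff degree_0 le_neq_implies_less neq0_conv)
      from less(1)[OF this g] obtain a q r where *: "a \<in> S" "q \<in> polys S" "r \<in> polys S" "a \<noteq> 0"
        "smult a ?g = q * d + r" "r = 0 \<or> degree r < degree d" by blast
      have "smult a (smult (lead_coeff d) f) = smult a ?g + smult a (?m * d)"
        by (simp only: smult_diff_right) simp
      then have "smult (a * lead_coeff d) f = (q + [:a:] * ?m) * d + r"
        using *(5) by (simp add: algebra_simps)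
      moreover have "q + [:a:] * ?m \<in> polys S" using * m P.mult[of "[:a:]" ?m] P.add by auto
      moreover have "a * lead_coeff d \<noteq> 0" "a * lead_coeff d \<in> S" using * lf by (auto dest: no_zero_div)
      ultimately show ?thesis using * by blast
    qed
  qed
qed

text \<open>A nonzero element of least degree in the ideal of \<open>f\<close> and \<open>g\<close>
  is a greatest common divisor over the fractions of \<open>S\<close>, so it divides both up to
  constants.\<close>

lemma common_divisor:
  assumes f: "f \<in> polys S" "f \<noteq> 0" and g: "g \<in> polys S"
  shows "\<exists>d\<in>polys S. \<exists>u\<in>polys S. \<exists>v\<in>polys S. d \<noteq> 0 \<and> d = u * f + v * g \<and>
     (\<exists>a\<in>S. a \<noteq> 0 \<and> dvd_in (polys S) d (smult a f)) \<and> (\<exists>b\<in>S. b \<noteq> 0 \<and> dvd_in (polys S) d (smult b g))"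
proof -
  define I where "I = {u * f + v * g | u v. u \<in> polys S \<and> v \<in> polys S}"
  have "f = 1 * f + 0 * g" "g = 0 * f + 1 * g" by auto
  then have fI: "f \<in> I" and gI: "g \<in> I" unfolding I_def using P.one P.zero by blast+
  have IP: "I \<subseteq> polys S" unfolding I_def using f(1) g by (auto intro!: P.add P.mult)
  have ex: "\<exists>d. d \<in> I \<and> d \<noteq> 0" using fI f by blast
  define d where "d = (ARG_MIN degree d. d \<in> I \<and> d \<noteq> 0)"
  obtain d0 where "d0 \<in> I \<and> d0 \<noteq> 0" using ex by blast
  then have "d \<in> I \<and> d \<noteq> 0" unfolding d_def by (rule arg_min_natI)
  then have d: "d \<in> I" "d \<noteq> 0" by auto
  have dmin: "degree d \<le> degree h" if "h \<in> I" "h \<noteq> 0" for h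
    unfolding d_def by (rule arg_min_nat_le) (use that in blast)
  have div: "\<exists>a\<in>S. a \<noteq> 0 \<and> dvd_in (polys S) d (smult a h)" if hI: "h \<in> I" for h
  proof -
    obtain a q r where *: "a \<in> S" "q \<in> polys S" "r \<in> polys S" "a \<noteq> 0"
        "smult a h = q * d + r" "r = 0 \<or> degree r < degree d"
      using pseudo_division[OF subsetD[OF IP d(1)] d(2) subsetD[OF IP hI]] by blast
    obtain u v u' v' where uv: "u \<in> polys S" "v \<in> polys S" "u' \<in> polys S" "v' \<in> polys S"
      "h = u * f + v * g" "d = u' * f + v' * g"
      using hI d unfolding I_def by blast
    have "r = [:a:] * h - q * d" using * by simp
    also have "\<dots> = ([:a:] * u - q * u') * f + ([:a:] * v - q * v') * g"
      unfolding uv(5,6) by (simp only: algebra_simps)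
    finally have "r = ([:a:] * u - q * u') * f + ([:a:] * v - q * v') * g" .
    moreover have "[:a:] * u - q * u' \<in> polys S" "[:a:] * v - q * v' \<in> polys S"
      using uv(1-4) *(1,2) P.diff P.mult const_in_polys by metis+
    ultimately have "r \<in> I" unfolding I_def by blast
    then have "r = 0" using *(6) dmin[of r] by (meson not_less)
    then show ?thesis using * unfolding dvd_in_def by (metis add.right_neutral mult.commute)
  qed
  show ?thesis using d div[OF fI] div[OF gI] IP unfolding I_def by blast
qed

text \<open>The primitive part of a common divisor divides both polynomials. It cannot be a multiple
  of \<open>f\<close>, as \<open>f\<close> does not divide \<open>g\<close>; by \<open>irr\<close>
  it is constant, and so is the Bezout combination.\<close>

lemma elimination:
  assumes f: "primitive f" "f \<noteq> 0" and g: "g \<in> polys S" "\<not> dvd_in (polys S) f g"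
    and irr: "\<And>d e. d \<in> polys S \<Longrightarrow> e \<in> polys S \<Longrightarrow> f = d * e \<Longrightarrow> degree d = 0 \<or> dvd_in (polys S) f d"
  shows "\<exists>a\<in>S. \<exists>u\<in>polys S. \<exists>v\<in>polys S. a \<noteq> 0 \<and> [:a:] = u * f + v * g"
proof -
  have fP: "f \<in> polys S" using f unfolding primitive_def by blast
  obtain d u v a b where d: "d \<in> polys S" "u \<in> polys S" "v \<in> polys S" "d \<noteq> 0" "d = u * f + v * g"
    "a \<in> S" "a \<noteq> 0" "dvd_in (polys S) d (smult a f)" "b \<in> S" "b \<noteq> 0" "dvd_in (polys S) d (smult b g)"
    using common_divisor[OF fP f(2) g(1)] by blast
  obtain c d' where c: "c \<in> S" "c \<noteq> 0" "primitive d'" "d = smult c d'"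
    using primitive_part d by blast
  have d': "d' \<in> polys S" using c unfolding primitive_def by blast
  have "dvd_in (polys S) d' d" unfolding dvd_in_def using c by (intro bexI[of _ "[:c:]"]) auto
  then have "dvd_in (polys S) d' f" "dvd_in (polys S) d' g"
    using primitive_dvd_smult[OF c(3)] d fP g P.dvd_in_trans by blast+
  then obtain e where "e \<in> polys S" "f = d' * e" unfolding dvd_in_def by blast
  from irr[OF d' this] show ?thesis
  proof
    assume "degree d' = 0"
    then have "degree d = 0" using c by (metis degree_smult_le le_zero_eq)
    then obtain \<delta> where "d = [:\<delta>:]" by (meson degree_eq_zeroE)
    then show ?thesis using d by (intro bexI[of _ \<delta>] bexI[of _ u] bexI[of _ v]) auto
  next
    assume "dvd_in (polys S) f d'"
    then show ?thesis using g \<open>dvd_in (polys S) d' g\<close> P.dvd_in_trans by blast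
  qed
qed

lemma primitive_const_factor:
  assumes "primitive (smult c g)" "c \<in> S" "c \<noteq> 0" "g \<in> polys S"
  shows "unit_in S c"
proof (rule ccontr)
  assume "\<not> unit_in S c"
  then obtain p where p: "prime_in S p" "dvd_in S p c"
    using exists_prime_factor[OF fact] assms by blast
  then have "dvd_in (polys S) [:p:] (smult c g)"
    using assms(4) by (subst const_dvd_iff)
      (use assms prime_inD(1)[OF p(1)] in \<open>auto simp: primitive_def intro: dvd_in_mult coeff_in\<close>)
  with p assms(1) show False unfolding primitive_def by blast
qed

text \<open>Let \<open>f\<close> divide \<open>g * h\<close> but not \<open>g\<close>. Multiplying
  \<open>[:a:] = u * f + v * g\<close> by \<open>h\<close> shows that \<open>f\<close> divides
  \<open>smult a h\<close>, hence \<open>h\<close> because \<open>f\<close> is primitive.\<close>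

lemma indecomposable_prime:
  assumes f: "primitive f" "degree f > 0"
    and irr: "\<And>d e. d \<in> polys S \<Longrightarrow> e \<in> polys S \<Longrightarrow> f = d * e \<Longrightarrow> degree d = 0 \<or> degree e = 0"
  shows "prime_in (polys S) f"
proof -
  have fP: "f \<in> polys S" and f0: "f \<noteq> 0" using f unfolding primitive_def by auto
  have "dvd_in (polys S) f h"
    if gh: "g \<in> polys S" "h \<in> polys S" "dvd_in (polys S) f (g * h)" "\<not> dvd_in (polys S) f g" for g h
  proof -
    have "degree d = 0 \<or> dvd_in (polys S) f d"
      if de: "d \<in> polys S" "e \<in> polys S" "f = d * e" for d e
    proof (rule disjCI)
      assume nd: "\<not> dvd_in (polys S) f d"
      show "degree d = 0"
      proof (rule ccontr)
        assume "degree d \<noteq> 0"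
        then have "degree e = 0" using irr[OF de] by simp
        then obtain c where c: "e = [:c:]" by (meson degree_eq_zeroE)
        then have "c \<in> S" "c \<noteq> 0" "f = smult c d" using de f0 by auto
        then have "unit_in S c" using primitive_const_factor[of c d] f de by simp
        then obtain k where k: "k \<in> S" "c * k = 1" unfolding unit_in_def dvd_in_def by metis
        have "d = f * [:k:]" using \<open>f = smult c d\<close> k by (simp add: mult.commute)
        then have "dvd_in (polys S) f d" unfolding dvd_in_def using k by (intro bexI[of _ "[:k:]"]) auto
        with nd show False by blast
      qed
    qed
    then obtain a u v where a: "a \<in> S" "u \<in> polys S" "v \<in> polys S" "a \<noteq> 0" "[:a:] = u * f + v * g"
      using elimination[OF f(1) f0 gh(1,4)] by blast
    have "smult a h = (u * f + v * g) * h" using a(5) by (metis mult_pCons_left add.right_neutral mult_zero_left pCons_0_0)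
    also have "\<dots> = f * (u * h) + (g * h) * v" by (simp add: algebra_simps)
    finally have "dvd_in (polys S) f (smult a h)"
      using P.dvd_in_add P.dvd_in_mult[OF P.dvd_in_refl] P.dvd_in_mult[OF gh(3)] a gh by auto
    then show ?thesis using primitive_dvd_smult f a gh by blast
  qed
  moreover have "\<not> dvd_in (polys S) f 1"
    unfolding dvd_in_def using degree_mult[OF fP] f f0
    by (metis add_is_0 degree_1 mult_zero_right not_gr_zero zero_neq_one)
  ultimately show ?thesis unfolding prime_in_def using fP f0 by blast
qed

lemma prime_primitive:
  assumes f: "prime_in (polys S) f" "degree f > 0"
  shows "primitive f"
proof -
  note fD = prime_inD[OF f(1)]
  have False if p: "prime_in S p" "dvd_in (polys S) [:p:] f" for p
  proof -
    have "\<exists>c. unit_in (polys S) c \<and> f = [:p:] * c"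
      using P.prime_dvd_prime[OF prime_const[OF p(1)] f(1) p(2)] .
    then obtain c k where c: "c \<in> polys S" "k \<in> polys S" "c * k = 1" "f = [:p:] * c"
      unfolding unit_in_def dvd_in_def by auto
    have "c \<noteq> 0" "k \<noteq> 0" using c by auto
    then have "degree c = 0" using degree_mult[of c k] c by simp
    then show False using f c degree_mult_le[of "[:p:]" c] by simp
  qed
  then show ?thesis unfolding primitive_def using fD by blast
qed

text \<open>The constant \<open>a\<close> acts as a resultant: where it does not vanish, a root of
  \<open>f\<close> is not a root of \<open>g\<close>.\<close>

lemma prime_elimination:
  assumes f: "prime_in (polys S) f" "degree f > 0" and g: "g \<in> polys S" "\<not> dvd_in (polys S) f g"
  shows "\<exists>a\<in>S. \<exists>u\<in>polys S. \<exists>v\<in>polys S. a \<noteq> 0 \<and> [:a:] = u * f + v * g"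
proof (rule elimination)
  note fD = prime_inD[OF f(1)]
  fix d e assume de: "d \<in> polys S" "e \<in> polys S" "f = d * e"
  show "degree d = 0 \<or> dvd_in (polys S) f d"
  proof (rule disjCI)
    assume "\<not> dvd_in (polys S) f d"
    then have "dvd_in (polys S) f e" using fD(4)[OF de(1,2)] de(3) by auto
    then obtain k where k: "k \<in> polys S" "e = f * k" unfolding dvd_in_def by blast
    have "f * (d * k) = d * e" using k(2) by (simp add: mult.left_commute)
    also have "\<dots> = f * 1" by (simp only: de(3)[symmetric] mult_1_right)
    finally have "d * k = 1" using P.cancel[of "d * k" 1 f] k(1) de(1) fD P.one P.mult by blast
    moreover from this have "d \<noteq> 0" "k \<noteq> 0" by auto
    ultimately show "degree d = 0" using degree_mult[of d k] k de by simp
  qed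
qed (use assms prime_primitive prime_inD in auto)

text \<open>The content is split off, its factors staying prime as constants; a primitive polynomial
  of positive degree either splits into factors of smaller degree or is prime by
  \<open>indecomposable_prime\<close>.\<close>

theorem factorial_polys: "factorial_in (polys S)"
proof -
  let ?F = "\<lambda>f. \<exists>u ps. unit_in (polys S) u \<and> (\<forall>p\<in>set ps. prime_in (polys S) p) \<and> f = u * prod_list ps"
  have F_mult: "?F (f * g)" if "?F f" "?F g" for f g
  proof -
    from that obtain u ps v qs where "unit_in (polys S) u" "\<forall>p\<in>set ps. prime_in (polys S) p" "f = u * prod_list ps"
      "unit_in (polys S) v" "\<forall>p\<in>set qs. prime_in (polys S) p" "g = v * prod_list qs" by blast
    then show ?thesis
      by (intro exI[of _ "u * v"] exI[of _ "ps @ qs"]) (auto simp: P.unit_in_mult algebra_simps)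
  qed
  have F_const: "?F [:c:]" if c: "c \<in> S" "c \<noteq> 0" for c
  proof -
    obtain u ps where u: "unit_in S u" "\<forall>p\<in>set ps. prime_in S p" "c = u * prod_list ps"
      using factorize[OF c] .
    have "[:prod_list ps:] = prod_list (map (\<lambda>p. [:p:]) ps)"
    proof (induction ps)
      case (Cons a ps)
      have "[:a * prod_list ps:] = [:a:] * [:prod_list ps:]" by simp
      then show ?case using Cons by simp
    qed (simp add: one_pCons)
    moreover have "[:c:] = [:u:] * [:prod_list ps:]" using u by simp
    ultimately show ?thesis using u unit_const prime_const
      by (intro exI[of _ "[:u:]"] exI[of _ "map (\<lambda>p. [:p:]) ps"]) auto
  qed
  have "?F f" if "f \<in> polys S" "f \<noteq> 0" for f
    using that
  proof (induction "degree f" arbitrary: f rule: less_induct)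
    case less
    obtain c g where c: "c \<in> S" "c \<noteq> 0" "primitive g" "f = smult c g"
      using primitive_part less by blast
    have gP: "g \<in> polys S" "g \<noteq> 0" using c less unfolding primitive_def by auto
    have fcg: "f = [:c:] * g" using c by simp
    have dg: "degree g = degree f" using degree_mult[of "[:c:]" g] fcg c gP by simp
    have "?F g"
    proof (cases "degree g = 0")
      case True
      then obtain a where "g = [:a:]" by (meson degree_eq_zeroE)
      then show ?thesis using F_const[of a] gP by simp
    next
      case False
      show ?thesis
      proof (cases "\<exists>d\<in>polys S. \<exists>e\<in>polys S. g = d * e \<and> degree d \<noteq> 0 \<and> degree e \<noteq> 0")
        case True
        then obtain d e where de: "d \<in> polys S" "e \<in> polys S" "g = d * e" "degree d \<noteq> 0" "degree e \<noteq> 0"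
          by blast
        then have ne: "d \<noteq> 0" "e \<noteq> 0" by auto
        then have "degree g = degree d + degree e" using degree_mult de by blast
        then have "?F d" "?F e" using less(1)[of d] less(1)[of e] de dg ne by auto
        then show ?thesis using F_mult de by blast
      next
        case False
        then have "prime_in (polys S) g"
          using indecomposable_prime[of g] c \<open>degree g \<noteq> 0\<close> by blast
        then show ?thesis by (intro exI[of _ 1] exI[of _ "[g]"]) (auto intro: P.unit_in_one)
      qed
    qed
    then show ?case using F_mult[OF F_const[OF c(1,2)]] fcg by metis
  qed
  then show ?thesis unfolding factorial_in_def by blast
qed

end

end


section \<open>Polynomial functions\<close>

text \<open>Polynomials are taken as functions so that they can be compared with regular functions.
  A point assigns a value to every element of the type; only the coordinates in \<open>V\<close> are
  seen. Since the field is infinite, distinct polynomials give distinct functions.\<close>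

inductive_set PF :: "'v set \<Rightarrow> (('v \<Rightarrow> complex) \<Rightarrow> complex) set" for V where
  const [simp]: "(\<lambda>z. c) \<in> PF V"
| var [simp, intro]: "v \<in> V \<Longrightarrow> (\<lambda>z. z v) \<in> PF V"
| add [simp]: "f \<in> PF V \<Longrightarrow> g \<in> PF V \<Longrightarrow> f + g \<in> PF V"
| mult [simp]: "f \<in> PF V \<Longrightarrow> g \<in> PF V \<Longrightarrow> f * g \<in> PF V"

lemma PF_mono:
  assumes "V \<subseteq> W" and "f \<in> PF V"
  shows "f \<in> PF W"
  using assms(2)
proof induction
  case (var v)
  then show ?case using assms(1) by blast
qed (rule PF.intros; assumption)+

lemma PF_cong: "f \<in> PF V \<Longrightarrow> (\<And>v. v \<in> V \<Longrightarrow> z v = w v) \<Longrightarrow> f z = f w"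
  by (induction rule: PF.induct) auto

lemma PF_zero [simp, intro]: "0 \<in> PF V"
  using PF.const[of 0] by (simp add: zero_fun_def)

lemma PF_one [simp, intro]: "1 \<in> PF V"
  using PF.const[of 1] by (simp add: one_fun_def)

lemma PF_uminus [simp]: "f \<in> PF V \<Longrightarrow> - f \<in> PF V"
proof -
  assume "f \<in> PF V"
  moreover have "- f = (\<lambda>z. -1) * f" by (auto simp: fun_eq_iff)
  ultimately show ?thesis by (metis PF.const PF.mult)
qed

lemma PF_power [simp]: "f \<in> PF V \<Longrightarrow> f ^ n \<in> PF V"
  by (induction n) auto

lemma PF_sum [simp]: "(\<And>i. i \<in> I \<Longrightarrow> f i \<in> PF V) \<Longrightarrow> sum f I \<in> PF V"
  by (induction I rule: infinite_finite_induct) auto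

lemma PF_prod [simp]: "(\<And>i. i \<in> I \<Longrightarrow> f i \<in> PF V) \<Longrightarrow> prod f I \<in> PF V"
  by (induction I rule: infinite_finite_induct) auto

lemma fun_power_apply: "((f :: 'a \<Rightarrow> 'b::comm_ring_1) ^ n) z = f z ^ n"
  by (induction n) auto

lemma fun_sum_apply: "(sum f I :: 'a \<Rightarrow> 'b::comm_ring_1) z = (\<Sum>i\<in>I. f i z)"
  by (induction I rule: infinite_finite_induct) auto

lemma fun_prod_apply: "(prod f I :: 'a \<Rightarrow> 'b::comm_ring_1) z = (\<Prod>i\<in>I. f i z)"
  by (induction I rule: infinite_finite_induct) auto

text \<open>One variable is singled out, with the others in the coefficients, so that the results on
  \<open>polys\<close> apply.\<close>

lemma PF_insert:
  "PF (insert x V) = (\<lambda>p. poly p (\<lambda>z. z x)) ` polys (PF V)"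
proof (intro equalityI subsetI)
  fix f assume "f \<in> PF (insert x V)"
  then show "f \<in> (\<lambda>p. poly p (\<lambda>z. z x)) ` polys (PF V)"
  proof induction
    case (const c)
    show ?case by (rule image_eqI[of _ _ "[:\<lambda>z. c:]"])
        (auto simp: polys_def coeff_pCons fun_eq_iff split: nat.split)
  next
    case (var v)
    show ?case
    proof (cases "v = x")
      case True
      then show ?thesis by (intro image_eqI[of _ _ "[:0, 1:]"])
          (auto simp: polys_def coeff_pCons fun_eq_iff split: nat.split)
    next
      case False
      with var show ?thesis by (intro image_eqI[of _ _ "[:\<lambda>z. z v:]"])
          (auto simp: polys_def coeff_pCons fun_eq_iff split: nat.split)
    qed
  next
    case (add f g)
    then obtain p q where "p \<in> polys (PF V)" "q \<in> polys (PF V)" "f = poly p (\<lambda>z. z x)" "g = poly q (\<lambda>z. z x)"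
      by blast
    then show ?case by (intro image_eqI[of _ _ "p + q"]) (auto simp: polys_def)
  next
    case (mult f g)
    then obtain p q where "p \<in> polys (PF V)" "q \<in> polys (PF V)" "f = poly p (\<lambda>z. z x)" "g = poly q (\<lambda>z. z x)"
      by blast
    then show ?case by (intro image_eqI[of _ _ "p * q"]) (auto simp: polys_def coeff_mult)
  qed
next
  fix f assume "f \<in> (\<lambda>p. poly p (\<lambda>z. z x)) ` polys (PF V)"
  then obtain p where p: "p \<in> polys (PF V)" "f = poly p (\<lambda>z. z x)" by blast
  have "coeff p i \<in> PF (insert x V)" for i
    using p(1) PF_mono[of V "insert x V"] by (auto simp: polys_def)
  then show "f \<in> PF (insert x V)" unfolding p(2) poly_altdef by (intro PF_sum PF.mult PF_power) auto
qed

definition ev :: "('v \<Rightarrow> complex) \<Rightarrow> (('v \<Rightarrow> complex) \<Rightarrow> complex) poly \<Rightarrow> complex poly" where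
  "ev z p = map_poly (\<lambda>f. f z) p"

lemma coeff_ev: "coeff (ev z p) i = coeff p i z"
  unfolding ev_def by (simp add: coeff_map_poly)

text \<open>The coefficients do not see the coordinate \<open>x\<close>, so with the other
  coordinates fixed the function is a polynomial in one variable.\<close>

lemma poly_ev:
  assumes "p \<in> polys (PF V)" "x \<notin> V"
  shows "poly p (\<lambda>z. z x) (z(x := t)) = poly (ev z p) t"
proof -
  have c: "coeff p i (z(x := t)) = coeff p i z" for i
    by (rule PF_cong[of "coeff p i" V]) (use assms in \<open>auto simp: polys_def\<close>)
  have le: "degree (ev z p) \<le> degree p"
    by (rule degree_le) (simp add: coeff_ev coeff_eq_0)
  have "poly (ev z p) t = (\<Sum>i\<le>degree p. coeff (ev z p) i * t ^ i)"
    unfolding poly_altdef by (rule sum.mono_neutral_left) (use le in \<open>auto simp: coeff_eq_0\<close>)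
  then show ?thesis by (simp add: poly_altdef fun_sum_apply fun_power_apply c coeff_ev)
qed

text \<open>The part of the Nullstellensatz that concerns hypersurfaces.\<close>

definition zeros_meet :: "(('v \<Rightarrow> complex) \<Rightarrow> complex) set \<Rightarrow> bool" where
  "zeros_meet S \<longleftrightarrow> (\<forall>p g. prime_in S p \<longrightarrow> g \<in> S \<longrightarrow> \<not> dvd_in S p g \<longrightarrow> (\<exists>z. p z = 0 \<and> g z \<noteq> 0))"

text \<open>Evaluation at the new coordinate is an isomorphism from \<open>polys (PF V)\<close> onto
  the polynomial functions in one more variable; the results on \<open>polys\<close> are carried
  across it.\<close>

lemma PF_extend:
  fixes V :: "'v set"
  assumes S: "subdomain (PF V)" and F: "factorial_in (PF V)" and N: "zeros_meet (PF V)" and x: "x \<notin> V"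
  shows "subdomain (PF (insert x V)) \<and> factorial_in (PF (insert x V)) \<and> zeros_meet (PF (insert x V))
    \<and> (\<forall>u. unit_in (PF (insert x V)) u \<longrightarrow> unit_in (PF V) u)"
proof -
  interpret S: subdomain "PF V" by (rule S)
  interpret P: subdomain "polys (PF V)" by (rule S.subdomain_polys)
  let ?X = "\<lambda>z::'v \<Rightarrow> complex. z x"
  let ?\<phi> = "\<lambda>p. poly p ?X"
  let ?T = "PF (insert x V)"
  have ev0: "ev z p \<noteq> 0" if "coeff p i z \<noteq> 0" for z p i
    using that coeff_ev by (metis coeff_0)
  have root_free: "\<exists>t. poly q t \<noteq> 0" if "q \<noteq> 0" for q :: "complex poly"
    using poly_all_0_iff_0 that by blast
  \<comment> \<open>Injectivity of the evaluation: at a point where some coefficient is nonzero, the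
    specialised polynomial in one variable has a nonzero value, the field being infinite.\<close>
  have ne0: "?\<phi> p \<noteq> 0" if p: "p \<in> polys (PF V)" "p \<noteq> 0" for p
  proof -
    obtain i where "coeff p i \<noteq> 0" using p by (meson leading_coeff_0_iff)
    then obtain z where "coeff p i z \<noteq> 0" by (auto simp: fun_eq_iff)
    then obtain t where "poly (ev z p) t \<noteq> 0" using ev0 root_free by blast
    then have "?\<phi> p (z(x := t)) \<noteq> 0" using poly_ev[OF p(1) x] by simp
    then show ?thesis by (metis zero_fun_apply)
  qed
  have inj: "p = q" if "p \<in> polys (PF V)" "q \<in> polys (PF V)" "?\<phi> p = ?\<phi> q" for p q
    using ne0[of "p - q"] P.diff[OF that(1,2)] that(3) by auto
  have T: "?T = ?\<phi> ` polys (PF V)" by (rule PF_insert)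
  have phi_in: "?\<phi> p \<in> ?T" if "p \<in> polys (PF V)" for p using T that by blast
  have sd: "subdomain ?T"
  proof
    fix a b assume "a \<in> ?T" "b \<in> ?T" and ab: "a * b = 0"
    then obtain p q where pq: "p \<in> polys (PF V)" "q \<in> polys (PF V)" "a = ?\<phi> p" "b = ?\<phi> q"
      unfolding T by blast
    then have "?\<phi> (p * q) = 0" using ab by simp
    then have "p * q = 0" using ne0 P.mult pq by blast
    then show "a = 0 \<or> b = 0" using P.no_zero_div pq by fastforce
  qed auto
  have dvd: "dvd_in ?T (?\<phi> p) (?\<phi> q) \<longleftrightarrow> dvd_in (polys (PF V)) p q"
    if pq: "p \<in> polys (PF V)" "q \<in> polys (PF V)" for p q
  proof
    assume "dvd_in ?T (?\<phi> p) (?\<phi> q)"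
    then obtain c where c: "c \<in> polys (PF V)" "?\<phi> q = ?\<phi> p * ?\<phi> c" unfolding dvd_in_def T by blast
    then have "?\<phi> q = ?\<phi> (p * c)" by simp
    then have "q = p * c" using inj pq c P.mult by blast
    then show "dvd_in (polys (PF V)) p q" unfolding dvd_in_def using c by blast
  next
    assume "dvd_in (polys (PF V)) p q"
    then obtain c where "c \<in> polys (PF V)" "q = p * c" unfolding dvd_in_def by blast
    then show "dvd_in ?T (?\<phi> p) (?\<phi> q)" unfolding dvd_in_def using phi_in by (intro bexI[of _ "?\<phi> c"]) auto
  qed
  have dvd1: "dvd_in ?T (?\<phi> p) 1 \<longleftrightarrow> dvd_in (polys (PF V)) p 1" if "p \<in> polys (PF V)" for p
    using dvd[OF that P.one] by simp
  have unit: "unit_in ?T (?\<phi> p) \<longleftrightarrow> unit_in (polys (PF V)) p" if "p \<in> polys (PF V)" for p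
    unfolding unit_in_def using dvd1 phi_in that by blast
  have prime: "prime_in ?T (?\<phi> p) \<longleftrightarrow> prime_in (polys (PF V)) p" if p: "p \<in> polys (PF V)" for p
  proof -
    have "(\<forall>a\<in>?T. \<forall>b\<in>?T. dvd_in ?T (?\<phi> p) (a * b) \<longrightarrow> dvd_in ?T (?\<phi> p) a \<or> dvd_in ?T (?\<phi> p) b) \<longleftrightarrow>
      (\<forall>a\<in>polys (PF V). \<forall>b\<in>polys (PF V). dvd_in ?T (?\<phi> p) (?\<phi> (a * b)) \<longrightarrow>
          dvd_in ?T (?\<phi> p) (?\<phi> a) \<or> dvd_in ?T (?\<phi> p) (?\<phi> b))"
      unfolding T by simp
    also have "\<dots> \<longleftrightarrow> (\<forall>a\<in>polys (PF V). \<forall>b\<in>polys (PF V). dvd_in (polys (PF V)) p (a * b) \<longrightarrow>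
          dvd_in (polys (PF V)) p a \<or> dvd_in (polys (PF V)) p b)"
      using dvd p P.mult by blast
    finally show ?thesis
      unfolding prime_in_def using dvd1 phi_in p ne0 by auto
  qed
  have fact: "factorial_in ?T"
    unfolding factorial_in_def
  proof (intro ballI impI)
    fix a assume "a \<in> ?T" "a \<noteq> 0"
    then obtain p where p: "p \<in> polys (PF V)" "a = ?\<phi> p" unfolding T by blast
    then have "p \<noteq> 0" using \<open>a \<noteq> 0\<close> by auto
    with p obtain u ps where u: "unit_in (polys (PF V)) u" "\<forall>q\<in>set ps. prime_in (polys (PF V)) q" "p = u * prod_list ps"
      using S.factorial_polys[OF F] unfolding factorial_in_def by blast
    have "?\<phi> (prod_list ps) = prod_list (map ?\<phi> ps)" by (induction ps) auto
    then have "a = ?\<phi> u * prod_list (map ?\<phi> ps)" using p u by simp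
    moreover have "unit_in ?T (?\<phi> u)" using u(1) unit unfolding unit_in_def by blast
    moreover have "\<forall>q\<in>set (map ?\<phi> ps). prime_in ?T q"
      using u(2) prime prime_inD(1) by auto
    ultimately show "\<exists>u ps. unit_in ?T u \<and> (\<forall>p\<in>set ps. prime_in ?T p) \<and> a = u * prod_list ps" by blast
  qed
  have zm: "zeros_meet ?T"
    unfolding zeros_meet_def
  proof (intro allI impI)
    fix P G assume "prime_in ?T P" "G \<in> ?T" "\<not> dvd_in ?T P G"
    moreover from this obtain p g where pg: "p \<in> polys (PF V)" "P = ?\<phi> p" "g \<in> polys (PF V)" "G = ?\<phi> g"
      using prime_inD(1) unfolding T by blast
    ultimately have p: "prime_in (polys (PF V)) p" and ndvd: "\<not> dvd_in (polys (PF V)) p g"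
      using prime dvd by auto
    show "\<exists>z. P z = 0 \<and> G z \<noteq> 0"
    proof (cases "degree p = 0")
      \<comment> \<open>Here \<open>p\<close> is free of \<open>x\<close>. Its zeros meet the
        nonvanishing locus of a coefficient of \<open>g\<close> that it does not divide, and the
        coordinate \<open>x\<close> is then chosen off the roots of \<open>g\<close>.\<close>
      case True
      then obtain a where a: "p = [:a:]" by (meson degree_eq_zeroE)
      then have aS: "a \<in> PF V" using pg by simp
      have "prime_in (PF V) a"
        unfolding prime_in_def
      proof (intro conjI ballI impI)
        show "a \<in> PF V" by (rule aS)
        show "a \<noteq> 0" using prime_inD(2)[OF p] a by auto
        have c: "dvd_in (polys (PF V)) p [:b:] \<longleftrightarrow> dvd_in (PF V) a b" if "b \<in> PF V" for b
          using S.const_dvd_iff[of "[:b:]" a] a aS that by (auto simp: coeff_pCons split: nat.splits)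
        show "\<not> dvd_in (PF V) a 1" using c[of 1] prime_inD(3)[OF p] by (simp add: one_pCons)
        fix b d assume "b \<in> PF V" "d \<in> PF V" "dvd_in (PF V) a (b * d)"
        then show "dvd_in (PF V) a b \<or> dvd_in (PF V) a d"
          using c[of b] c[of d] c[of "b * d"] prime_inD(4)[OF p, of "[:b:]" "[:d:]"]
          by (simp add: mult.commute)
      qed
      moreover obtain i where "\<not> dvd_in (PF V) a (coeff g i)"
        using ndvd S.const_dvd_iff pg(3) aS a by blast
      ultimately obtain z where z: "a z = 0" "coeff g i z \<noteq> 0"
        using N S.coeff_in[OF pg(3)] unfolding zeros_meet_def by blast
      then obtain t where t: "poly (ev z g) t \<noteq> 0" using ev0 root_free by blast
      have "P (z(x := t)) = 0" using pg(2) poly_ev[OF pg(1) x, of z t] a z by (simp add: ev_def map_poly_pCons)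
      moreover have "G (z(x := t)) \<noteq> 0" using pg(4) poly_ev[OF pg(3) x, of z t] t by simp
      ultimately show ?thesis by blast
    next
      \<comment> \<open>Eliminate \<open>x\<close> from \<open>p\<close> and \<open>g\<close>; where the eliminant and the leading coefficient of \<open>p\<close> do not
        vanish, a root of \<open>p\<close> is not a root of \<open>g\<close>.\<close>
      case False
      then obtain a u v where a: "a \<in> PF V" "a \<noteq> 0" "u \<in> polys (PF V)" "v \<in> polys (PF V)" "[:a:] = u * p + v * g"
        using S.prime_elimination[OF F p _ pg(3) ndvd] by blast
      have "a * lead_coeff p \<noteq> 0"
        using S.mult_ne[OF a(1) S.coeff_in[OF pg(1)] a(2)] False by (metis degree_0 leading_coeff_0_iff)
      then obtain z where z: "a z \<noteq> 0" "lead_coeff p z \<noteq> 0" by (auto simp: fun_eq_iff)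
      then have "degree (ev z p) \<noteq> 0"
        using False le_degree[of "ev z p" "degree p"] by (auto simp: coeff_ev)
      then have "\<not> constant (poly (ev z p))" by (simp add: constant_degree)
      then obtain t where t: "poly (ev z p) t = 0" using fundamental_theorem_of_algebra by blast
      let ?y = "z(x := t)"
      have P0: "?\<phi> p ?y = 0" using poly_ev[OF pg(1) x, of z t] t by simp
      have "?\<phi> [:a:] ?y = a ?y" by simp
      also have "a ?y = a z" using x by (intro PF_cong[OF a(1), of ?y z]) auto
      finally have "?\<phi> (u * p + v * g) ?y \<noteq> 0" using z a(5) by simp
      then have "?\<phi> g ?y \<noteq> 0" using P0 by auto
      with P0 show ?thesis using pg by blast
    qed
  qed
  \<comment> \<open>A unit of a polynomial ring over a domain has degree zero, so it does not
    involve \<open>x\<close>; in the end only constants remain.\<close>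
  have "unit_in (PF V) u" if u: "unit_in ?T u" for u
  proof -
    obtain p where p: "p \<in> polys (PF V)" "u = ?\<phi> p" using u unfolding T unit_in_def by blast
    then obtain q where q: "q \<in> polys (PF V)" "p * q = 1"
      using unit u unfolding unit_in_def dvd_in_def by metis
    have pq0: "p \<noteq> 0" "q \<noteq> 0" using q by auto
    have "degree p = 0" "degree q = 0" using S.degree_mult[OF p(1) q(1) pq0] q(2) by auto
    then obtain a b where ab: "p = [:a:]" "q = [:b:]" by (meson degree_eq_zeroE)
    then have "a \<in> PF V" "b \<in> PF V" "a * b = 1" using p q by (auto simp: one_pCons mult.commute)
    then have "unit_in (PF V) a" unfolding unit_in_def dvd_in_def by metis
    then show ?thesis using p(2) ab(1) by simp
  qed
  with sd fact zm show ?thesis by blast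
qed

lemma PF_empty: "PF {} = range (\<lambda>c z. c)"
proof (intro equalityI subsetI)
  fix f :: "('a \<Rightarrow> complex) \<Rightarrow> complex" assume "f \<in> PF {}"
  then show "f \<in> range (\<lambda>c z. c)" by induction (auto simp: plus_fun_def times_fun_def)
qed auto

theorem PF_factorial:
  fixes V :: "'v set"
  assumes "finite V"
  shows "subdomain (PF V) \<and> factorial_in (PF V) \<and> zeros_meet (PF V) \<and>
     (\<forall>u. unit_in (PF V) u \<longrightarrow> (\<exists>c. u = (\<lambda>z. c)))"
  using assms
proof (induction V)
  case empty
  have sd: "subdomain (PF ({} :: 'v set))"
    by standard (auto simp: PF_empty fun_eq_iff)
  have un: "unit_in (PF ({} :: 'v set)) a" if "a \<in> PF {}" "a \<noteq> 0" for a
  proof -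
    obtain c where c: "a = (\<lambda>z. c)" using \<open>a \<in> PF {}\<close> unfolding PF_empty by blast
    with \<open>a \<noteq> 0\<close> have "1 = a * (\<lambda>z. inverse c)" by (auto simp: fun_eq_iff)
    then show ?thesis unfolding unit_in_def dvd_in_def using that(1) PF.const by blast
  qed
  \<comment> \<open>Every nonzero constant is a unit, so there are no primes and
    \<open>zeros_meet\<close> holds vacuously.\<close>
  have np: "\<not> prime_in (PF ({} :: 'v set)) p" for p
    using un unfolding prime_in_def unit_in_def by blast
  have "factorial_in (PF ({} :: 'v set))"
    unfolding factorial_in_def
  proof (intro ballI impI)
    fix a :: "('v \<Rightarrow> complex) \<Rightarrow> complex" assume "a \<in> PF {}" "a \<noteq> 0"
    then show "\<exists>u ps. unit_in (PF {}) u \<and> (\<forall>p\<in>set ps. prime_in (PF {}) p) \<and> a = u * prod_list ps"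
      using un by (intro exI[of _ a] exI[of _ "[]"]) auto
  qed
  moreover have "zeros_meet (PF ({} :: 'v set))" unfolding zeros_meet_def using np by blast
  ultimately show ?case using sd by (auto simp: unit_in_def PF_empty)
next
  case (insert x V)
  then show ?case using PF_extend[of V x] by blast
qed


section \<open>Line bundles on affine space\<close>

definition zopen :: "'v set \<Rightarrow> ('v \<Rightarrow> complex) set \<Rightarrow> bool" where
  "zopen V U \<longleftrightarrow> (\<forall>z\<in>U. \<exists>q\<in>PF V. q z \<noteq> 0 \<and> (\<forall>y. q y \<noteq> 0 \<longrightarrow> y \<in> U))"

text \<open>The nonvanishing locus of the denominator serves at the same time as the neighbourhood
  of \<open>z\<close>; a local fraction is brought to this form by multiplying both parts by a
  polynomial that confines the neighbourhood.\<close>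

definition zreg :: "'v set \<Rightarrow> ('v \<Rightarrow> complex) set \<Rightarrow> (('v \<Rightarrow> complex) \<Rightarrow> complex) \<Rightarrow> bool" where
  "zreg V U f \<longleftrightarrow> (\<forall>z\<in>U. \<exists>p\<in>PF V. \<exists>q\<in>PF V. q z \<noteq> 0 \<and> (\<forall>y. q y \<noteq> 0 \<longrightarrow> y \<in> U \<and> f y = p y / q y))"

lemma zregE:
  assumes "zreg V U f" "z \<in> U"
  obtains p q where "p \<in> PF V" "q \<in> PF V" "q z \<noteq> 0" "\<And>y. q y \<noteq> 0 \<Longrightarrow> y \<in> U \<and> f y = p y / q y"
  using assms unfolding zreg_def by blast

lemma zopenE:
  assumes "zopen V U" "z \<in> U"
  obtains q where "q \<in> PF V" "q z \<noteq> 0" "\<And>y. q y \<noteq> 0 \<Longrightarrow> y \<in> U"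
  using assms unfolding zopen_def by blast

lemma zopen_Int:
  assumes "zopen V U" "zopen V W"
  shows "zopen V (U \<inter> W)"
  unfolding zopen_def
proof
  fix z assume z: "z \<in> U \<inter> W"
  obtain p where p: "p \<in> PF V" "p z \<noteq> 0" "\<And>y. p y \<noteq> 0 \<Longrightarrow> y \<in> U" using zopenE[OF assms(1)] z by blast
  obtain q where q: "q \<in> PF V" "q z \<noteq> 0" "\<And>y. q y \<noteq> 0 \<Longrightarrow> y \<in> W" using zopenE[OF assms(2)] z by blast
  show "\<exists>q\<in>PF V. q z \<noteq> 0 \<and> (\<forall>y. q y \<noteq> 0 \<longrightarrow> y \<in> U \<inter> W)"
    by (rule bexI[of _ "p * q"]) (use p q in auto)
qed

lemma zopen_D: "f \<in> PF V \<Longrightarrow> zopen V {z. f z \<noteq> 0}"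
  unfolding zopen_def by blast

lemma zreg_frac:
  assumes "a \<in> PF V" "b \<in> PF V" "zopen V U" "\<And>z. z \<in> U \<Longrightarrow> b z \<noteq> 0 \<and> f z = a z / b z"
  shows "zreg V U f"
  unfolding zreg_def
proof
  fix z assume z: "z \<in> U"
  obtain r where r: "r \<in> PF V" "r z \<noteq> 0" "\<And>y. r y \<noteq> 0 \<Longrightarrow> y \<in> U" using zopenE[OF assms(3) z] by blast
  show "\<exists>p\<in>PF V. \<exists>q\<in>PF V. q z \<noteq> 0 \<and> (\<forall>y. q y \<noteq> 0 \<longrightarrow> y \<in> U \<and> f y = p y / q y)"
    by (rule bexI[of _ "a * r"], rule bexI[of _ "b * r"]) (use r assms z in auto)
qed

context
  fixes V :: "'v set"
  assumes finV: "finite V"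
begin

interpretation S: subdomain "PF V" using PF_factorial[OF finV] by blast

lemma factV: "factorial_in (PF V)" using PF_factorial[OF finV] by blast

section \<open>Irreducibility and fractions in lowest terms\<close>

lemma prime_meets:
  assumes "prime_in (PF V) p" "g \<in> PF V" "\<not> dvd_in (PF V) p g"
  shows "\<exists>z. p z = 0 \<and> g z \<noteq> 0"
  using PF_factorial[OF finV] assms unfolding zeros_meet_def by blast

lemma unit_constant: "unit_in (PF V) u \<Longrightarrow> \<exists>c. c \<noteq> 0 \<and> u = (\<lambda>z. c)"
  using PF_factorial[OF finV] S.unit_in_ne[of u] by (fastforce simp: zero_fun_def)

lemma dvd_in_zero_at: "dvd_in (PF V) p g \<Longrightarrow> p z = 0 \<Longrightarrow> g z = 0"
  unfolding dvd_in_def by auto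

lemma PF_ne_mult: "f \<in> PF V \<Longrightarrow> g \<in> PF V \<Longrightarrow> f \<noteq> 0 \<Longrightarrow> g \<noteq> 0 \<Longrightarrow> \<exists>z. f z \<noteq> 0 \<and> g z \<noteq> 0"
proof -
  assume "f \<in> PF V" "g \<in> PF V" "f \<noteq> 0" "g \<noteq> 0"
  then have "f * g \<noteq> 0" by (rule S.mult_ne)
  then show ?thesis by (auto simp: fun_eq_iff)
qed

text \<open>The nonvanishing locus of a nonzero polynomial is dense: it would meet the locus where
  \<open>f - g\<close> is nonzero.\<close>

lemma PF_eqI:
  assumes "f \<in> PF V" "g \<in> PF V" "q \<in> PF V" "q \<noteq> 0" "\<And>z. q z \<noteq> 0 \<Longrightarrow> f z = g z"
  shows "f = g"
proof (rule ccontr)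
  assume "f \<noteq> g"
  then have "f - g \<noteq> 0" by simp
  then obtain z where "q z \<noteq> 0" "(f - g) z \<noteq> 0"
    using PF_ne_mult[of q "f - g"] assms S.diff by metis
  then show False using assms(5) by simp
qed

lemma zopen_meet:
  assumes "zopen V U" "zopen V W" "U \<noteq> {}" "W \<noteq> {}"
  shows "U \<inter> W \<noteq> {}"
proof -
  obtain p q where pq: "p \<in> PF V" "q \<in> PF V" "p \<noteq> 0" "q \<noteq> 0" "\<And>y. p y \<noteq> 0 \<Longrightarrow> y \<in> U" "\<And>y. q y \<noteq> 0 \<Longrightarrow> y \<in> W"
    using assms zopenE by (metis ex_in_conv zero_fun_apply)
  then show ?thesis using PF_ne_mult[of p q] by blast
qed

lemma prime_factor_at:
  assumes "a \<in> PF V" "a \<noteq> 0" "a z = 0"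
  shows "\<exists>p. prime_in (PF V) p \<and> dvd_in (PF V) p a \<and> p z = 0"
proof -
  obtain u ps where u: "unit_in (PF V) u" "\<forall>p\<in>set ps. prime_in (PF V) p" "a = u * prod_list ps"
    using factV assms unfolding factorial_in_def by blast
  have sub: "set ps \<subseteq> PF V" using u prime_inD(1) by blast
  have uV: "u \<in> PF V" using u(1) unfolding unit_in_def by blast
  have "u z \<noteq> 0" using unit_constant[OF u(1)] by auto
  then have "prod_list ps z = 0" using u(3) assms(3) by simp
  then have "\<exists>p\<in>set ps. p z = 0" by (induction ps) auto
  then obtain p where p: "p \<in> set ps" "p z = 0" by blast
  then obtain xs ys where s: "ps = xs @ p # ys" by (meson split_list)
  have "prod_list xs \<in> PF V" "prod_list ys \<in> PF V" using sub s by auto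
  then have "dvd_in (PF V) p a" unfolding dvd_in_def
    by (intro bexI[of _ "u * (prod_list xs * prod_list ys)"])
      (use u(3) s uV in \<open>auto simp: algebra_simps\<close>)
  with u p show ?thesis by blast
qed

text \<open>The hypersurface \<open>p = 0\<close> is irreducible: its open subsets given by
  \<open>q\<close> and by \<open>f\<close> are both nonempty, so they meet.\<close>

lemma prime_avoid:
  assumes p: "prime_in (PF V) p" and z: "p z = 0" and q: "q \<in> PF V" "q z \<noteq> 0"
    and f: "f \<in> PF V" "\<not> dvd_in (PF V) p f"
  shows "\<exists>y. p y = 0 \<and> q y \<noteq> 0 \<and> f y \<noteq> 0"
proof -
  have "\<not> dvd_in (PF V) p q" using dvd_in_zero_at z q by blast
  then have "\<not> dvd_in (PF V) p (q * f)" using prime_inD(4)[OF p q(1) f(1)] f by blast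
  then show ?thesis using prime_meets[OF p, of "q * f"] q f by auto
qed

text \<open>Here \<open>a / b = p / q\<close> with \<open>a / b\<close> in lowest terms. A prime
  factor of \<open>b\<close> that vanishes at \<open>z\<close> divides \<open>a * q\<close>, hence
  \<open>q\<close>.\<close>

lemma coprime_zero:
  assumes a: "a \<in> PF V" "q \<in> PF V" "b \<in> PF V" "p \<in> PF V" "b \<noteq> 0" "a * q = b * p"
    and co: "\<And>r. prime_in (PF V) r \<Longrightarrow> \<not> (dvd_in (PF V) r a \<and> dvd_in (PF V) r b)"
    and z: "b z = 0"
  shows "q z = 0"
proof -
  obtain r where r: "prime_in (PF V) r" "dvd_in (PF V) r b" "r z = 0"
    using prime_factor_at[OF a(3,5) z] by blast
  have "dvd_in (PF V) r (a * q)" using S.dvd_in_mult[OF r(2) a(4)] a(6) by simp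
  then have "dvd_in (PF V) r q" using prime_inD(4)[OF r(1) a(1,2)] co[OF r(1)] r(2) by blast
  then show ?thesis using dvd_in_zero_at r(3) by blast
qed

text \<open>The fraction valid near one point, in lowest terms, agrees with every other local
  fraction by density, and \<open>coprime_zero\<close> shows that its denominator vanishes nowhere
  on \<open>U\<close>.\<close>

lemma zreg_global_frac:
  assumes f: "zreg V U f" and ne: "U \<noteq> {}"
  shows "\<exists>a\<in>PF V. \<exists>b\<in>PF V. b \<noteq> 0 \<and> (\<forall>z\<in>U. b z \<noteq> 0 \<and> f z = a z / b z)"
proof -
  obtain z0 where z0: "z0 \<in> U" using ne by blast
  obtain p0 q0 where pq0: "p0 \<in> PF V" "q0 \<in> PF V" "q0 z0 \<noteq> 0" "\<And>y. q0 y \<noteq> 0 \<Longrightarrow> y \<in> U \<and> f y = p0 y / q0 y"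
    using zregE[OF f z0] by blast
  then have q0: "q0 \<noteq> 0" by auto
  obtain g a b where g: "g \<in> PF V" "a \<in> PF V" "b \<in> PF V" "g \<noteq> 0" "p0 = g * a" "q0 = g * b"
    "\<forall>r. prime_in (PF V) r \<longrightarrow> \<not> (dvd_in (PF V) r a \<and> dvd_in (PF V) r b)"
    using S.lowest_terms[OF factV pq0(1,2) q0] by blast
  have b0: "b \<noteq> 0" using g q0 by auto
  have "b z \<noteq> 0 \<and> f z = a z / b z" if z: "z \<in> U" for z
  proof -
    obtain p q where pq: "p \<in> PF V" "q \<in> PF V" "q z \<noteq> 0" "\<And>y. q y \<noteq> 0 \<Longrightarrow> y \<in> U \<and> f y = p y / q y"
      using zregE[OF f z] by blast
    have q: "q \<noteq> 0" using pq(3) by auto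
    have "a * q = b * p"
    proof (rule PF_eqI)
      show "q0 * q \<in> PF V" "q0 * q \<noteq> 0" using S.mult_ne pq0 pq q0 q by auto
      fix y assume y: "(q0 * q) y \<noteq> 0"
      then have "f y = p0 y / q0 y" "f y = p y / q y" using pq0(4)[of y] pq(4)[of y] by auto
      then have "p0 y / q0 y = p y / q y" by simp
      then show "(a * q) y = (b * p) y" using y g(5,6) by (auto simp: field_simps)
    qed (use g pq in auto)
    moreover from this have "a z * q z = b z * p z" by (metis times_fun_apply)
    moreover from calculation have bz: "b z \<noteq> 0"
      using coprime_zero[of a q b p z] g pq(1-3) b0 by auto
    moreover have "f z = p z / q z" using pq(3) pq(4)[of z] by blast
    ultimately show ?thesis using pq(3) by (simp add: frac_eq_eq ac_simps)
  qed
  then show ?thesis using g b0 by blast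
qed

text \<open>A prime factor of the denominator would have a zero, by \<open>prime_meets\<close> with
  the function 1; so the denominator is a unit, which is a constant.\<close>

lemma zreg_UNIV: "zreg V UNIV f \<Longrightarrow> f \<in> PF V"
proof -
  assume f: "zreg V UNIV f"
  obtain a b where ab: "a \<in> PF V" "b \<in> PF V" "b \<noteq> 0" "\<And>z. b z \<noteq> 0" "\<And>z. f z = a z / b z"
    using zreg_global_frac[OF f] by auto
  have "unit_in (PF V) b"
  proof (rule ccontr)
    assume "\<not> unit_in (PF V) b"
    then obtain p where p: "prime_in (PF V) p" "dvd_in (PF V) p b"
      using S.exists_prime_factor[OF factV ab(2,3)] by blast
    then obtain z where "p z = 0" using prime_meets[OF p(1), of 1] prime_inD(3)[OF p(1)] by auto
    then show False using dvd_in_zero_at p ab(4) by blast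
  qed
  then obtain c where "c \<noteq> 0" "b = (\<lambda>z. c)" using unit_constant by blast
  then have "f = a * (\<lambda>z. inverse c)" using ab by (auto simp: fun_eq_iff divide_inverse)
  then show ?thesis using ab PF.mult PF.const by metis
qed

text \<open>Divisibility by the coordinate \<open>v\<close> is the same as vanishing after the
  substitution \<open>v := 0\<close>, and that substitution maps into a domain.\<close>

lemma coord_prime:
  assumes v: "v \<in> V"
  shows "prime_in (PF V) (\<lambda>z. z v)"
proof -
  let ?X = "\<lambda>z::'v \<Rightarrow> complex. z v"
  let ?r = "\<lambda>f z. f (z(v := 0))"
  have r: "?r f \<in> PF V" if "f \<in> PF V" for f
    using that
  proof induction
    case (add f g)
    then show ?case using PF.add[of "?r f" V "?r g"] by (simp only: plus_fun_def)
  next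
    case (mult f g)
    then show ?case using PF.mult[of "?r f" V "?r g"] by (simp only: times_fun_def)
  next
    case (var w)
    then show ?case by (cases "w = v") auto
  qed auto
  have dvd: "dvd_in (PF V) ?X f \<longleftrightarrow> ?r f = 0" if f: "f \<in> PF V" for f
  proof
    assume r0: "?r f = 0"
    have "f \<in> PF (insert v (V - {v}))" using f v by (simp add: insert_absorb)
    then obtain p where p: "p \<in> polys (PF (V - {v}))" "f = poly p ?X" unfolding PF_insert by blast
    obtain c q where pc: "p = pCons c q" by (cases p)
    have cV: "c \<in> PF (V - {v})" "q \<in> polys (PF (V - {v}))"
      using p pc by (auto simp: polys_def coeff_pCons split: nat.splits)
    have "c z = 0" for z
    proof -
      have "c z = c (z(v := 0))" by (rule PF_cong[OF cV(1)]) auto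
      also have "\<dots> = ?r f z" using p pc by simp
      finally show ?thesis using r0 by (metis zero_fun_apply)
    qed
    then have "f = ?X * poly q ?X" using p pc by (auto simp: fun_eq_iff)
    moreover have "poly q ?X \<in> PF V"
      using imageI[OF cV(2), of "\<lambda>p. poly p ?X"] v by (simp add: PF_insert[symmetric] insert_absorb)
    ultimately show "dvd_in (PF V) ?X f" unfolding dvd_in_def by blast
  qed (auto simp: dvd_in_def fun_eq_iff)
  have "?X \<noteq> 0"
  proof
    assume "?X = 0"
    from fun_cong[OF this, of "\<lambda>_. 1"] show False by simp
  qed
  moreover have "\<not> dvd_in (PF V) ?X 1" using dvd[of 1] by (auto simp: fun_eq_iff)
  moreover have "dvd_in (PF V) ?X f \<or> dvd_in (PF V) ?X g"
    if fg: "f \<in> PF V" "g \<in> PF V" "dvd_in (PF V) ?X (f * g)" for f g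
  proof -
    have "?r (f * g) = ?r f * ?r g" by (auto simp: fun_eq_iff)
    then have "?r f * ?r g = 0" using dvd fg by (metis PF.mult)
    then show ?thesis using S.no_zero_div[OF r r] fg dvd by blast
  qed
  ultimately show ?thesis unfolding prime_in_def using v by blast
qed

text \<open>A prime factor of \<open>f\<close> can vanish only where one of the coordinates in
  \<open>A\<close> does. Hence it divides their product, and being prime it is one of them up to a
  constant.\<close>

lemma nonvanishing_monomial:
  assumes A: "A \<subseteq> V" and f: "f \<in> PF V" "f \<noteq> 0" and nv: "\<And>z. (\<forall>v\<in>A. z v \<noteq> 0) \<Longrightarrow> f z \<noteq> 0"
  shows "\<exists>c n. c \<noteq> 0 \<and> f = (\<lambda>z. c * (\<Prod>v\<in>A. z v ^ n v))"
proof -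
  have finA: "finite A" using A finV finite_subset by blast
  obtain u ps where u: "unit_in (PF V) u" "\<forall>p\<in>set ps. prime_in (PF V) p" "f = u * prod_list ps"
    using factV f unfolding factorial_in_def by blast
  have sub: "set ps \<subseteq> PF V" using u prime_inD(1) by blast
  have mono: "\<exists>c n. c \<noteq> 0 \<and> p = (\<lambda>z. c * (\<Prod>v\<in>A. z v ^ n v))" if p: "p \<in> set ps" for p
  proof -
    have pp: "prime_in (PF V) p" using u p by blast
    define m where "m = (\<lambda>z::'v \<Rightarrow> complex. \<Prod>v\<in>A. z v)"
    have m_eq: "m = (\<Prod>v\<in>A. (\<lambda>z. z v))" by (auto simp: m_def fun_eq_iff fun_prod_apply)
    have mV: "m \<in> PF V" unfolding m_eq using A by (intro PF_prod) auto
    have "dvd_in (PF V) p m"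
    proof (rule ccontr)
      assume "\<not> dvd_in (PF V) p m"
      then obtain z where z: "p z = 0" "m z \<noteq> 0" using prime_meets[OF pp mV] by blast
      then have "f z \<noteq> 0" using nv finA unfolding m_def by auto
      moreover have "prod_list ps z = 0" using p z(1) by (induction ps) auto
      ultimately show False using u by simp
    qed
    have "\<exists>v\<in>B. dvd_in (PF V) p (\<lambda>z. z v)"
      if "finite B" "B \<subseteq> V" "dvd_in (PF V) p (\<Prod>v\<in>B. (\<lambda>z. z v))" for B
      using that
    proof (induction B)
      case empty
      then show ?case using prime_inD(3)[OF pp] by (simp add: one_fun_def)
    next
      case (insert v B)
      have "(\<lambda>z. z v) \<in> PF V" "(\<Prod>v\<in>B. (\<lambda>z. z v)) \<in> PF V"
        using insert(4) by (auto intro!: PF_prod)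
      moreover have "dvd_in (PF V) p ((\<lambda>z. z v) * (\<Prod>v\<in>B. (\<lambda>z. z v)))"
        using insert(5) unfolding prod.insert[OF insert(1,2)] .
      ultimately show ?case using prime_inD(4)[OF pp] insert by blast
    qed
    from this[OF finA A] \<open>dvd_in (PF V) p m\<close> obtain v where v: "v \<in> A" "dvd_in (PF V) p (\<lambda>z. z v)"
      unfolding m_eq by blast
    obtain k where k: "unit_in (PF V) k" "(\<lambda>z. z v) = p * k"
      using S.prime_dvd_prime[OF pp coord_prime v(2)] v A by blast
    then obtain c where c: "c \<noteq> 0" "k = (\<lambda>z. c)" using unit_constant by blast
    have "p = (\<lambda>z. inverse c * z v)"
    proof
      fix z
      have "z v = p z * c" using k(2) c by (metis times_fun_apply)
      then show "p z = inverse c * z v" using c by simp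
    qed
    also have "\<dots> = (\<lambda>z. inverse c * (\<Prod>w\<in>A. z w ^ (if w = v then 1 else 0)))"
      using v(1) finA by (auto simp: fun_eq_iff prod.delta if_distrib[of "\<lambda>n. _ ^ n"] cong: if_cong)
    finally show ?thesis using c(1) by (metis inverse_nonzero_iff_nonzero)
  qed
  have "\<exists>c n. c \<noteq> 0 \<and> prod_list qs = (\<lambda>z. c * (\<Prod>v\<in>A. z v ^ n v))" if "set qs \<subseteq> set ps" for qs
    using that
  proof (induction qs)
    case Nil
    show ?case by (rule exI[of _ 1], rule exI[of _ "\<lambda>_. 0"]) (auto simp: fun_eq_iff)
  next
    case (Cons q qs)
    then obtain c n where "c \<noteq> 0" "prod_list qs = (\<lambda>z. c * (\<Prod>v\<in>A. z v ^ n v))" by auto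
    moreover obtain c' n' where "c' \<noteq> 0" "q = (\<lambda>z. c' * (\<Prod>v\<in>A. z v ^ n' v))"
      using mono Cons by (meson list.set_intros(1) subsetD)
    ultimately show ?case
      by (intro exI[of _ "c' * c"] exI[of _ "\<lambda>v. n' v + n v"])
        (auto simp: fun_eq_iff power_add prod.distrib)
  qed
  then obtain c n where "c \<noteq> 0" "prod_list ps = (\<lambda>z. c * (\<Prod>v\<in>A. z v ^ n v))" by blast
  moreover obtain k where "k \<noteq> 0" "u = (\<lambda>z. k)" using unit_constant u by blast
  ultimately show ?thesis using u(3)
    by (intro exI[of _ "k * c"] exI[of _ n]) (auto simp: fun_eq_iff)
qed

text \<open>Overlaps of charts are complements of coordinate hyperplanes, so this determines the
  ratio of two frames on an overlap.\<close>

lemma zreg_unit_monomial: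
  assumes A: "A \<subseteq> V" and f: "zreg V {z. \<forall>v\<in>A. z v \<noteq> 0} f" and nv: "\<And>z. (\<forall>v\<in>A. z v \<noteq> 0) \<Longrightarrow> f z \<noteq> 0"
  shows "\<exists>c n. c \<noteq> 0 \<and> (\<forall>z. (\<forall>v\<in>A. z v \<noteq> 0) \<longrightarrow> f z = c * (\<Prod>v\<in>A. z v powi n v))"
proof -
  have "(\<lambda>_. 1) \<in> {z::'v \<Rightarrow> complex. \<forall>v\<in>A. z v \<noteq> 0}" by auto
  then have ne: "{z::'v \<Rightarrow> complex. \<forall>v\<in>A. z v \<noteq> 0} \<noteq> {}" by (metis empty_iff)
  obtain a b where ab0: "a \<in> PF V" "b \<in> PF V" "b \<noteq> 0"
    "\<forall>z\<in>{z. \<forall>v\<in>A. z v \<noteq> 0}. b z \<noteq> 0 \<and> f z = a z / b z"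
    using zreg_global_frac[OF f ne] by blast
  then have ab: "a \<in> PF V" "b \<in> PF V" "b \<noteq> 0"
    "\<And>z. (\<forall>v\<in>A. z v \<noteq> 0) \<Longrightarrow> b z \<noteq> 0 \<and> f z = a z / b z" by auto
  have a: "a z \<noteq> 0" if "\<forall>v\<in>A. z v \<noteq> 0" for z using ab(4)[OF that] nv[OF that] by auto
  from this[of "\<lambda>_. 1"] have "a \<noteq> 0" by auto
  obtain c n where c: "c \<noteq> 0" "a = (\<lambda>z. c * (\<Prod>v\<in>A. z v ^ n v))"
    using nonvanishing_monomial[OF A ab(1) \<open>a \<noteq> 0\<close>] a by blast
  obtain d m where d: "d \<noteq> 0" "b = (\<lambda>z. d * (\<Prod>v\<in>A. z v ^ m v))"
    using nonvanishing_monomial[OF A ab(2,3)] ab(4) by blast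
  have "f z = c / d * (\<Prod>v\<in>A. z v powi (int (n v) - int (m v)))" if z: "\<forall>v\<in>A. z v \<noteq> 0" for z
  proof -
    have "(\<Prod>v\<in>A. z v powi (int (n v) - int (m v))) = (\<Prod>v\<in>A. z v ^ n v) / (\<Prod>v\<in>A. z v ^ m v)"
      unfolding prod_dividef[symmetric] using z by (intro prod.cong) (auto simp: power_int_diff)
    then show ?thesis using ab(4)[OF z] c d by simp
  qed
  then show ?thesis using c d by (intro exI[of _ "c / d"] exI[of _ "\<lambda>v. int (n v) - int (m v)"]) auto
qed

section \<open>Fractions without zero or pole along a prime\<close>

definition zero_ord :: "(('v \<Rightarrow> complex) \<Rightarrow> complex) \<Rightarrow> (('v \<Rightarrow> complex) \<Rightarrow> complex) \<Rightarrow> (('v \<Rightarrow> complex) \<Rightarrow> complex) \<Rightarrow> bool" where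
  "zero_ord p a b \<longleftrightarrow> (\<exists>k. \<exists>a'\<in>PF V. \<exists>b'\<in>PF V. a = p ^ k * a' \<and> b = p ^ k * b' \<and>
      \<not> dvd_in (PF V) p a' \<and> \<not> dvd_in (PF V) p b')"

lemma zero_ordI:
  "a' \<in> PF V \<Longrightarrow> b' \<in> PF V \<Longrightarrow> a = p ^ k * a' \<Longrightarrow> b = p ^ k * b' \<Longrightarrow>
    \<not> dvd_in (PF V) p a' \<Longrightarrow> \<not> dvd_in (PF V) p b' \<Longrightarrow> zero_ord p a b"
  unfolding zero_ord_def by blast

lemma extract_power:
  assumes p: "prime_in (PF V) p" and a: "a \<in> PF V" "a \<noteq> 0"
  shows "\<exists>k. \<exists>a'\<in>PF V. a = p ^ k * a' \<and> \<not> dvd_in (PF V) p a'"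
proof -
  note pD = prime_inD[OF p]
  have "\<exists>k. \<exists>a'\<in>PF V. a = p ^ k * a' \<and> \<not> dvd_in (PF V) p a'"
    if "unit_in (PF V) u" "\<forall>q\<in>set ps. prime_in (PF V) q" "a = u * prod_list ps" for u ps a
    using that
  proof (induction "length ps" arbitrary: u ps a rule: less_induct)
    case less
    have aV: "a \<in> PF V" using S.factorization_in less by blast
    show ?case
    proof (cases "dvd_in (PF V) p a")
      case False
      then show ?thesis using aV by (intro exI[of _ 0] bexI[of _ a]) auto
    next
      case True
      then obtain v qs where v: "unit_in (PF V) v" "\<forall>q\<in>set qs. prime_in (PF V) q" "length ps = Suc (length qs)"
        "a = p * (v * prod_list qs)"
        using S.factorization_remove[OF less(2,3) p] less(4) by metis
      then obtain k a' where "a' \<in> PF V" "v * prod_list qs = p ^ k * a'" "\<not> dvd_in (PF V) p a'"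
        using less(1)[of qs v] by auto
      then show ?thesis using v(4) by (intro exI[of _ "Suc k"] bexI[of _ a']) (auto simp: mult.assoc)
    qed
  qed
  then show ?thesis using factV a unfolding factorial_in_def by blast
qed

lemma zero_ord_mult:
  assumes p: "prime_in (PF V) p" and z: "zero_ord p a b"
    and cd: "c \<in> PF V" "d \<in> PF V" "\<not> dvd_in (PF V) p c" "\<not> dvd_in (PF V) p d"
  shows "zero_ord p (a * c) (b * d)"
proof -
  obtain k a' b' where *: "a' \<in> PF V" "b' \<in> PF V" "a = p ^ k * a'" "b = p ^ k * b'"
      "\<not> dvd_in (PF V) p a'" "\<not> dvd_in (PF V) p b'"
    using z unfolding zero_ord_def by blast
  then have "\<not> dvd_in (PF V) p (a' * c)" "\<not> dvd_in (PF V) p (b' * d)"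
    using prime_inD(4)[OF p] cd by blast+
  moreover have "a * c = p ^ k * (a' * c)" "b * d = p ^ k * (b' * d)" using * by (auto simp: mult.assoc)
  ultimately show ?thesis using * cd by (intro zero_ordI[of "a' * c" "b' * d" _ _ k]) auto
qed

text \<open>A factorization may list an associate \<open>p * u\<close> in place of \<open>p\<close>;
  the order along the hypersurface is the same.\<close>

lemma zero_ord_assoc:
  assumes p: "prime_in (PF V) p" and u: "unit_in (PF V) u" and z: "zero_ord (p * u) a b"
  shows "zero_ord p a b"
proof -
  obtain k a' b' where *: "a' \<in> PF V" "b' \<in> PF V" "a = (p * u) ^ k * a'" "b = (p * u) ^ k * b'"
      "\<not> dvd_in (PF V) (p * u) a'" "\<not> dvd_in (PF V) (p * u) b'"
    using z unfolding zero_ord_def by blast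
  have uV: "u \<in> PF V" using u unfolding unit_in_def by blast
  have ndu: "\<not> dvd_in (PF V) p u" using S.prime_not_dvd_unit[OF p u] .
  have "dvd_in (PF V) (p * u) x" if px: "dvd_in (PF V) p x" for x
  proof -
    obtain w where w: "w \<in> PF V" "1 = u * w" using u unfolding unit_in_def dvd_in_def by blast
    obtain y where y: "y \<in> PF V" "x = p * y" using px unfolding dvd_in_def by blast
    have "p * u * (w * y) = p * (u * w) * y" by (simp only: mult.assoc)
    also have "\<dots> = x" by (simp only: w(2)[symmetric] y(2)[symmetric] mult_1_right)
    finally have "x = p * u * (w * y)" ..
    moreover have "w * y \<in> PF V" using w y by (intro PF.mult)
    ultimately show ?thesis unfolding dvd_in_def by blast
  qed
  then have "\<not> dvd_in (PF V) p a'" "\<not> dvd_in (PF V) p b'" using * by blast+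
  then have "\<not> dvd_in (PF V) p (u ^ k * a')" "\<not> dvd_in (PF V) p (u ^ k * b')"
    using prime_inD(4)[OF p S.power[OF uV] *(1), of k] prime_inD(4)[OF p S.power[OF uV] *(2), of k]
      S.prime_not_dvd_power[OF p uV ndu, of k] by blast+
  moreover have "a = p ^ k * (u ^ k * a')" "b = p ^ k * (u ^ k * b')"
    using * by (auto simp: power_mult_distrib mult.assoc)
  ultimately show ?thesis using uV * by (intro zero_ordI[of "u ^ k * a'" "u ^ k * b'" _ _ k]) auto
qed

text \<open>The equation says that \<open>a1 / b1\<close> is \<open>c / d\<close> times
  \<open>a2 / b2\<close>, and \<open>c / d\<close> has order zero along \<open>p\<close>. After
  cancelling the common power, the exponents of \<open>p\<close> on the two sides show that it
  divides \<open>a2\<close> and \<open>b2\<close> equally often.\<close>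

lemma zero_ord_transfer:
  assumes p: "prime_in (PF V) p"
    and S: "a1 \<in> PF V" "b1 \<in> PF V" "a2 \<in> PF V" "b2 \<in> PF V" "c \<in> PF V" "d \<in> PF V"
    and ne: "a2 \<noteq> 0" "b2 \<noteq> 0"
    and cd: "\<not> dvd_in (PF V) p c" "\<not> dvd_in (PF V) p d"
    and eq: "a1 * b2 * d = c * a2 * b1"
    and z: "zero_ord p a1 b1"
  shows "zero_ord p a2 b2"
proof -
  note pD = prime_inD[OF p]
  obtain k a' b' where k: "a' \<in> PF V" "b' \<in> PF V" "a1 = p ^ k * a'" "b1 = p ^ k * b'"
      "\<not> dvd_in (PF V) p a'" "\<not> dvd_in (PF V) p b'"
    using z unfolding zero_ord_def by blast
  obtain r \<alpha> where r: "\<alpha> \<in> PF V" "a2 = p ^ r * \<alpha>" "\<not> dvd_in (PF V) p \<alpha>"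
    using extract_power[OF p S(3) ne(1)] by blast
  obtain s \<beta> where s: "\<beta> \<in> PF V" "b2 = p ^ s * \<beta>" "\<not> dvd_in (PF V) p \<beta>"
    using extract_power[OF p S(4) ne(2)] by blast
  define x y where x_def: "x = a' * \<beta> * d" and y_def: "y = c * \<alpha> * b'"
  have xy: "x \<in> PF V" "y \<in> PF V" using k r s S by (auto simp: x_def y_def)
  have nx: "\<not> dvd_in (PF V) p x"
    using pD(4)[of "a' * \<beta>" d] pD(4)[of a' \<beta>] k s S cd by (auto simp: x_def)
  have ny: "\<not> dvd_in (PF V) p y"
    using pD(4)[of "c * \<alpha>" b'] pD(4)[of c \<alpha>] k r S cd by (auto simp: y_def)
  have pk: "p ^ k \<in> PF V" "p ^ k \<noteq> 0" using S.power_ne pD by auto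
  have "p ^ k * (p ^ s * x) = p ^ k * (p ^ r * y)"
    using eq unfolding k(3,4) r(2) s(2) by (simp add: algebra_simps x_def y_def)
  then have e: "p ^ s * x = p ^ r * y"
    by (rule S.cancel[OF _ _ pk, rotated 2]) (use xy pD(1) in auto)
  have "r = s"
  proof (rule linorder_cases[of r s])
    assume "r < s"
    then obtain m where m: "s = r + Suc m" using less_iff_Suc_add by (metis add_Suc_right)
    have "p ^ r * (p ^ Suc m * x) = p ^ r * y" using e unfolding m power_add by (simp add: mult.assoc)
    then have "p ^ Suc m * x = y"
      using S.cancel[of "p ^ Suc m * x" y "p ^ r"] xy pD(1) S.power_ne[OF pD(1,2)] by (metis PF.mult PF_power)
    then have "y = p * (p ^ m * x)" by (simp add: mult.assoc)
    moreover have "p ^ m * x \<in> PF V" using xy pD(1) by (intro PF.mult PF_power)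
    ultimately have "dvd_in (PF V) p y" unfolding dvd_in_def by blast
    with ny show ?thesis by blast
  next
    assume "s < r"
    then obtain m where m: "r = s + Suc m" using less_iff_Suc_add by (metis add_Suc_right)
    have "p ^ s * (p ^ Suc m * y) = p ^ s * x" using e unfolding m power_add by (simp add: mult.assoc)
    then have "p ^ Suc m * y = x"
      using S.cancel[of "p ^ Suc m * y" x "p ^ s"] xy pD(1) S.power_ne[OF pD(1,2)] by (metis PF.mult PF_power)
    then have "x = p * (p ^ m * y)" by (simp add: mult.assoc)
    moreover have "p ^ m * y \<in> PF V" using xy pD(1) by (intro PF.mult PF_power)
    ultimately have "dvd_in (PF V) p x" unfolding dvd_in_def by blast
    with nx show ?thesis by blast
  qed
  then show ?thesis using r s by (intro zero_ordI[of \<alpha> \<beta> _ _ r]) auto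
qed

text \<open>A rational section is a family of fractions \<open>a i / b i\<close>. Multiplying it by powers of the finitely
  many primes missing a fixed nonempty open set of the cover removes all its zeros and poles.\<close>

theorem line_bundle_trivial:
  fixes U :: "'i \<Rightarrow> ('v \<Rightarrow> complex) set" and g :: "'i \<Rightarrow> 'i \<Rightarrow> ('v \<Rightarrow> complex) \<Rightarrow> complex"
  assumes op: "\<And>i. i \<in> I \<Longrightarrow> zopen V (U i)"
    and cov: "\<And>z. \<exists>i\<in>I. z \<in> U i"
    and reg: "\<And>i j. i \<in> I \<Longrightarrow> j \<in> I \<Longrightarrow> zreg V (U i \<inter> U j) (g i j)"
    and nz: "\<And>i j z. i \<in> I \<Longrightarrow> j \<in> I \<Longrightarrow> z \<in> U i \<inter> U j \<Longrightarrow> g i j z \<noteq> 0"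
    and coc: "\<And>i j k z. i \<in> I \<Longrightarrow> j \<in> I \<Longrightarrow> k \<in> I \<Longrightarrow> z \<in> U i \<inter> U j \<inter> U k \<Longrightarrow> g i j z * g j k z = g i k z"
  shows "\<exists>\<tau>. \<forall>i\<in>I. zreg V (U i) (\<tau> i) \<and> (\<forall>z\<in>U i. \<tau> i z \<noteq> 0) \<and>
           (\<forall>j\<in>I. \<forall>z\<in>U i \<inter> U j. \<tau> i z = g i j z * \<tau> j z)"
proof -
  \<comment> \<open>Only nonempty members of the cover are compared: any two of them meet, and a
    nonempty overlap is what yields a global fraction for the transition function.\<close>
  define J where "J = {i\<in>I. U i \<noteq> {}}"
  have JI: "i \<in> I" "U i \<noteq> {}" if "i \<in> J" for i using that unfolding J_def by auto
  have meet: "U i \<inter> U j \<noteq> {}" if "i \<in> J" "j \<in> J" for i j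
    by (rule zopen_meet[OF op[OF JI(1)[OF that(1)]] op[OF JI(1)[OF that(2)]] JI(2)[OF that(1)] JI(2)[OF that(2)]])
  obtain i0 z0 where i0: "i0 \<in> J" "z0 \<in> U i0" using cov[of undefined] unfolding J_def by blast
  obtain q0 where q0: "q0 \<in> PF V" "q0 z0 \<noteq> 0" "\<And>y. q0 y \<noteq> 0 \<Longrightarrow> y \<in> U i0"
    using zopenE[OF op[OF JI(1)[OF i0(1)]] i0(2)] by blast
  have q0n: "q0 \<noteq> 0" using q0(2) by auto
  have frac: "\<exists>a b. a \<in> PF V \<and> b \<in> PF V \<and> a \<noteq> 0 \<and> b \<noteq> 0 \<and>
      (\<forall>z\<in>U i \<inter> U j. a z \<noteq> 0 \<and> b z \<noteq> 0 \<and> g i j z = a z / b z)" if ij: "i \<in> J" "j \<in> J" for i j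
  proof -
    have "zreg V (U i \<inter> U j) (g i j)" by (rule reg[OF JI(1)[OF ij(1)] JI(1)[OF ij(2)]])
    from zreg_global_frac[OF this meet[OF ij]] obtain a b where ab: "a \<in> PF V" "b \<in> PF V" "b \<noteq> 0"
      "\<forall>z\<in>U i \<inter> U j. b z \<noteq> 0 \<and> g i j z = a z / b z" by blast
    have az: "a z \<noteq> 0" if "z \<in> U i \<inter> U j" for z using ab(4) nz[OF JI(1)[OF ij(1)] JI(1)[OF ij(2)] that] that by fastforce
    moreover obtain z where "z \<in> U i \<inter> U j" using meet[OF ij] by blast
    ultimately have "a z \<noteq> 0" by blast
    then have "a \<noteq> 0" by auto
    with ab az show ?thesis by blast
  qed
  \<comment> \<open>A rational section: \<open>a i / b i = g i j * (a j / b j)\<close>,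
    cross-multiplied with \<open>g i j = p / q\<close>.\<close>
  define RS where "RS a b \<longleftrightarrow> (\<forall>i\<in>J. a i \<in> PF V \<and> b i \<in> PF V \<and> a i \<noteq> 0 \<and> b i \<noteq> 0) \<and>
     (\<forall>i\<in>J. \<forall>j\<in>J. \<exists>p\<in>PF V. \<exists>q\<in>PF V. (\<forall>z\<in>U i \<inter> U j. p z \<noteq> 0 \<and> q z \<noteq> 0 \<and> g i j z = p z / q z) \<and>
        a i * b j * q = p * a j * b i)" for a b
  \<comment> \<open>The section has neither zero nor pole along \<open>p = 0\<close> on any member
    of the cover that meets this hypersurface.\<close>
  define good where "good a b p \<longleftrightarrow> (\<forall>i\<in>J. (\<exists>z\<in>U i. p z = 0) \<longrightarrow> zero_ord p (a i) (b i))" for a b p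
  have RSD: "a i \<in> PF V" "b i \<in> PF V" "a i \<noteq> 0" "b i \<noteq> 0" if "RS a b" "i \<in> J" for a b i
    using that unfolding RS_def by auto
  have RSE: "\<exists>p\<in>PF V. \<exists>q\<in>PF V. (\<forall>z\<in>U i \<inter> U j. p z \<noteq> 0 \<and> q z \<noteq> 0 \<and> g i j z = p z / q z) \<and>
        a i * b j * q = p * a j * b i" if "RS a b" "i \<in> J" "j \<in> J" for a b i j
    using that unfolding RS_def by blast
  \<comment> \<open>The rational section equal to 1 on \<open>U i0\<close>, that is,
    \<open>g i i0\<close> on \<open>U i\<close>. A hypersurface whose prime does not divide
    \<open>q0\<close> meets \<open>U i0\<close>, where this section is invertible.\<close>
  have start: "\<exists>a b. RS a b \<and> (\<forall>p. prime_in (PF V) p \<and> \<not> dvd_in (PF V) p q0 \<longrightarrow> good a b p)"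
  proof -
    have "\<forall>i\<in>J. \<exists>a b. a \<in> PF V \<and> b \<in> PF V \<and> a \<noteq> 0 \<and> b \<noteq> 0 \<and>
      (\<forall>z\<in>U i \<inter> U i0. a z \<noteq> 0 \<and> b z \<noteq> 0 \<and> g i i0 z = a z / b z)" using frac i0(1) by blast
    then obtain a b where ab: "\<And>i. i \<in> J \<Longrightarrow> a i \<in> PF V \<and> b i \<in> PF V \<and> a i \<noteq> 0 \<and> b i \<noteq> 0"
      "\<And>i z. i \<in> J \<Longrightarrow> z \<in> U i \<Longrightarrow> z \<in> U i0 \<Longrightarrow> a i z \<noteq> 0 \<and> b i z \<noteq> 0 \<and> g i i0 z = a i z / b i z"
      by (metis IntI)
    have "\<exists>p\<in>PF V. \<exists>q\<in>PF V. (\<forall>z\<in>U i \<inter> U j. p z \<noteq> 0 \<and> q z \<noteq> 0 \<and> g i j z = p z / q z) \<and>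
        a i * b j * q = p * a j * b i" if ij: "i \<in> J" "j \<in> J" for i j
    proof -
      obtain p q where pq: "p \<in> PF V" "q \<in> PF V" "p \<noteq> 0" "q \<noteq> 0"
        "\<And>z. z \<in> U i \<inter> U j \<Longrightarrow> p z \<noteq> 0 \<and> q z \<noteq> 0 \<and> g i j z = p z / q z" using frac[OF ij] by blast
      have o: "zopen V (U i \<inter> U j)" "zopen V (U i0)"
        using zopen_Int op[OF JI(1)[OF ij(1)]] op[OF JI(1)[OF ij(2)]] op[OF JI(1)[OF i0(1)]] by auto
      then have "U i \<inter> U j \<inter> U i0 \<noteq> {}"
        by (rule zopen_meet) (use meet[OF ij] i0 in auto)
      then obtain y where y: "y \<in> U i \<inter> U j \<inter> U i0" by blast
      obtain r where r: "r \<in> PF V" "r y \<noteq> 0" "\<And>z. r z \<noteq> 0 \<Longrightarrow> z \<in> U i \<inter> U j \<inter> U i0"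
        using zopenE[OF zopen_Int[OF o] y] by blast
      have "a i * b j * q = p * a j * b i"
      proof (rule PF_eqI[OF _ _ r(1)])
        show "r \<noteq> 0" using r(2) by auto
        fix z assume "r z \<noteq> 0"
        then have z: "z \<in> U i" "z \<in> U j" "z \<in> U i0" using r(3) by blast+
        have "g i j z * g j i0 z = g i i0 z" using coc[of i j i0 z] JI ij i0 z by blast
        then show "(a i * b j * q) z = (p * a j * b i) z"
          using ab(2)[OF ij(1) z(1,3)] ab(2)[OF ij(2) z(2,3)] pq(5)[of z] z by (simp add: field_simps)
      qed (use ab(1) ij pq in auto)
      then show ?thesis using pq by blast
    qed
    then have "RS a b" unfolding RS_def using ab(1) by blast
    moreover have "good a b p" if p: "prime_in (PF V) p" "\<not> dvd_in (PF V) p q0" for p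
      unfolding good_def
    proof (intro ballI impI)
      fix i assume i: "i \<in> J" "\<exists>z\<in>U i. p z = 0"
      then obtain z where z: "z \<in> U i" "p z = 0" by blast
      obtain q where q: "q \<in> PF V" "q z \<noteq> 0" "\<And>y. q y \<noteq> 0 \<Longrightarrow> y \<in> U i"
        using zopenE[OF op[OF JI(1)[OF i(1)]] z(1)] by blast
      obtain y where y: "p y = 0" "q y \<noteq> 0" "q0 y \<noteq> 0"
        using prime_avoid[OF p(1) z(2) q(1,2) q0(1) p(2)] by blast
      then have "a i y \<noteq> 0" "b i y \<noteq> 0" using ab(2)[OF i(1)] q(3) q0(3) by blast+
      then have "\<not> dvd_in (PF V) p (a i)" "\<not> dvd_in (PF V) p (b i)" using dvd_in_zero_at y(1) by blast+
      then show "zero_ord p (a i) (b i)" using ab(1)[OF i(1)]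
        by (intro zero_ordI[of "a i" "b i" _ _ 0]) auto
    qed
    ultimately show ?thesis by blast
  qed
  \<comment> \<open>The section is corrected along the primes of the list one after the other,
    without spoiling its order along the remaining primes.\<close>
  have step: "\<exists>a' b'. RS a' b' \<and> (\<forall>p. prime_in (PF V) p \<longrightarrow> good a' b' p)"
    if "\<forall>q\<in>set qs. prime_in (PF V) q" "RS a b"
      "\<And>p. prime_in (PF V) p \<Longrightarrow> \<forall>q\<in>set qs. \<not> dvd_in (PF V) p q \<Longrightarrow> good a b p" for qs a b
    using that
  proof (induction qs arbitrary: a b)
    case Nil
    then show ?case by auto
  next
    case (Cons q qs)
    note RS = Cons(3)
    have q: "prime_in (PF V) q" using Cons by simp
    note qD = prime_inD[OF q]
    obtain z1 where z1: "q z1 = 0" using prime_meets[OF q, of 1] qD(3) by auto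
    obtain i1 where i1: "i1 \<in> I" "z1 \<in> U i1" using cov by blast
    then have i1J: "i1 \<in> J" unfolding J_def by blast
    obtain k a' where k: "a' \<in> PF V" "a i1 = q ^ k * a'" "\<not> dvd_in (PF V) q a'"
      using extract_power[OF q] RSD[OF RS i1J] by blast
    obtain m b' where m: "b' \<in> PF V" "b i1 = q ^ m * b'" "\<not> dvd_in (PF V) q b'"
      using extract_power[OF q] RSD[OF RS i1J] by blast
    \<comment> \<open>Multiplication by \<open>q ^ (m - k)\<close>, with a possibly negative
      exponent, gives order zero along \<open>q\<close> on \<open>U i1\<close>.\<close>
    define A where "A i = a i * q ^ m" for i
    define B where "B i = b i * q ^ k" for i
    have qn: "q ^ n \<in> PF V" "q ^ n \<noteq> 0" for n using S.power_ne[OF qD(1,2)] qD(1) by auto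
    have AB: "A i \<in> PF V" "B i \<in> PF V" "A i \<noteq> 0" "B i \<noteq> 0" if "i \<in> J" for i
      unfolding A_def B_def using RSD[OF RS that] qn S.mult_ne by auto
    have tr: "\<exists>p\<in>PF V. \<exists>q\<in>PF V. (\<forall>z\<in>U i \<inter> U j. p z \<noteq> 0 \<and> q z \<noteq> 0 \<and> g i j z = p z / q z) \<and>
        A i * B j * q = p * A j * B i" if ij: "i \<in> J" "j \<in> J" for i j
    proof -
      obtain P Q where PQ: "P \<in> PF V" "Q \<in> PF V" "\<forall>z\<in>U i \<inter> U j. P z \<noteq> 0 \<and> Q z \<noteq> 0 \<and> g i j z = P z / Q z"
        "a i * b j * Q = P * a j * b i" using RSE[OF RS ij] by blast
      have "A i * B j * Q = (a i * b j * Q) * (q ^ m * q ^ k)" unfolding A_def B_def by (simp only: ac_simps)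
      also have "\<dots> = P * A j * B i" unfolding PQ(4) A_def B_def by (simp only: ac_simps)
      finally show ?thesis using PQ by blast
    qed
    have RS': "RS A B" unfolding RS_def using AB tr by blast
    \<comment> \<open>The same holds on every \<open>U i\<close> that meets \<open>q = 0\<close>: by
      irreducibility the hypersurface has a point common to \<open>U i\<close> and
      \<open>U i1\<close>, where the transition function is invertible.\<close>
    have good_q: "good A B q"
      unfolding good_def
    proof (intro ballI impI)
      fix i assume i: "i \<in> J" "\<exists>z\<in>U i. q z = 0"
      then obtain z where z: "z \<in> U i" "q z = 0" by blast
      obtain r where r: "r \<in> PF V" "r z \<noteq> 0" "\<And>y. r y \<noteq> 0 \<Longrightarrow> y \<in> U i"
        using zopenE[OF op[OF JI(1)[OF i(1)]] z(1)] by blast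
      obtain r1 where r1: "r1 \<in> PF V" "r1 z1 \<noteq> 0" "\<And>y. r1 y \<noteq> 0 \<Longrightarrow> y \<in> U i1"
        using zopenE[OF op[OF i1(1)] i1(2)] by blast
      have "\<not> dvd_in (PF V) q r1" using dvd_in_zero_at z1 r1(2) by blast
      then obtain y where y: "q y = 0" "r y \<noteq> 0" "r1 y \<noteq> 0"
        using prime_avoid[OF q z(2) r(1,2) r1(1)] by blast
      obtain P Q where PQ: "P \<in> PF V" "Q \<in> PF V" "\<forall>z\<in>U i1 \<inter> U i. P z \<noteq> 0 \<and> Q z \<noteq> 0 \<and> g i1 i z = P z / Q z"
        "A i1 * B i * Q = P * A i * B i1" using tr[OF i1J i(1)] by blast
      have "P y \<noteq> 0" "Q y \<noteq> 0" using PQ(3) r(3) r1(3) y by blast+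
      then have nd: "\<not> dvd_in (PF V) q P" "\<not> dvd_in (PF V) q Q" using dvd_in_zero_at y(1) by blast+
      have "zero_ord q (A i1) (B i1)"
        unfolding A_def B_def k(2) m(2)
        by (rule zero_ordI[OF k(1) m(1) _ _ k(3) m(3), where k = "k + m"]) (simp_all only: power_add ac_simps)
      then show "zero_ord q (A i) (B i)"
        by (rule zero_ord_transfer[OF q AB(1,2)[OF i1J] AB(1,2)[OF i(1)] PQ(1,2) AB(3,4)[OF i(1)] nd PQ(4)])
    qed
    show ?case
    proof (rule Cons(1)[OF _ RS'])
      show "\<forall>q\<in>set qs. prime_in (PF V) q" using Cons by simp
      fix p assume p: "prime_in (PF V) p" "\<forall>q\<in>set qs. \<not> dvd_in (PF V) p q"
      show "good A B p"
      proof (cases "dvd_in (PF V) p q")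
        case True
        then obtain c where c: "unit_in (PF V) c" "q = p * c" using S.prime_dvd_prime p(1) q by blast
        show ?thesis
          unfolding good_def
        proof (intro ballI impI)
          fix i assume i: "i \<in> J" "\<exists>z\<in>U i. p z = 0"
          then have "\<exists>z\<in>U i. q z = 0" using c(2) by auto
          then have "zero_ord (p * c) (A i) (B i)" using good_q i(1) c(2) unfolding good_def by blast
          then show "zero_ord p (A i) (B i)" by (rule zero_ord_assoc[OF p(1) c(1)])
        qed
      next
        case False
        then have g: "good a b p" using Cons(4)[OF p(1)] p(2) by simp
        have "\<not> dvd_in (PF V) p (q ^ n)" for n using S.prime_not_dvd_power[OF p(1) qD(1) False] .
        then have "zero_ord p (A i) (B i)" if "zero_ord p (a i) (b i)" for i
          unfolding A_def B_def by (intro zero_ord_mult[OF p(1) that] qn(1)) auto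
        then show ?thesis using g unfolding good_def by blast
      qed
    qed
  qed
  obtain a b where RS: "RS a b" and good: "\<And>p. prime_in (PF V) p \<Longrightarrow> good a b p"
  proof -
    obtain u qs where u: "unit_in (PF V) u" "\<forall>q\<in>set qs. prime_in (PF V) q" "q0 = u * prod_list qs"
      using factV q0(1) q0n unfolding factorial_in_def by blast
    obtain a b where ab: "RS a b" "\<And>p. prime_in (PF V) p \<Longrightarrow> \<not> dvd_in (PF V) p q0 \<Longrightarrow> good a b p"
      using start by blast
    have sub: "set qs \<subseteq> PF V" using u prime_inD(1) by blast
    have "\<not> dvd_in (PF V) p q0" if p: "prime_in (PF V) p" "\<forall>q\<in>set qs. \<not> dvd_in (PF V) p q" for p
    proof
      assume "dvd_in (PF V) p q0"
      then have "dvd_in (PF V) p u \<or> dvd_in (PF V) p (prod_list qs)"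
        using prime_inD(4)[OF p(1) _ S.prod_list[OF sub], of u] u unfolding unit_in_def by auto
      then show False
        using S.prime_not_dvd_unit[OF p(1) u(1)] S.prime_dvd_prod_list[OF p(1) _ sub] p(2) by blast
    qed
    then show thesis using step[OF u(2) ab(1)] ab(2) that by blast
  qed
  \<comment> \<open>If the order is zero along all primes that vanish somewhere on
    \<open>U i\<close>, then in lowest terms numerator and denominator have no zeros on
    \<open>U i\<close>.\<close>
  have low: "\<exists>c d. c \<in> PF V \<and> d \<in> PF V \<and> (\<forall>z\<in>U i. c z \<noteq> 0 \<and> d z \<noteq> 0) \<and>
      (\<exists>h\<in>PF V. h \<noteq> 0 \<and> a i = h * c \<and> b i = h * d)" if i: "i \<in> J" for i
  proof -
    note abi = RSD[OF RS i]
    obtain h c d where h: "h \<in> PF V" "c \<in> PF V" "d \<in> PF V" "h \<noteq> 0" "a i = h * c" "b i = h * d"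
      "\<And>p. prime_in (PF V) p \<Longrightarrow> \<not> (dvd_in (PF V) p c \<and> dvd_in (PF V) p d)"
      using S.lowest_terms[OF factV abi(1,2,4)] by blast
    have cd0: "c \<noteq> 0" "d \<noteq> 0" using h abi by auto
    have nd: "\<not> dvd_in (PF V) p c \<and> \<not> dvd_in (PF V) p d"
      if p: "prime_in (PF V) p" "\<exists>z\<in>U i. p z = 0" for p
    proof -
      obtain k \<alpha> \<beta> where k: "\<alpha> \<in> PF V" "\<beta> \<in> PF V" "a i = p ^ k * \<alpha>" "b i = p ^ k * \<beta>"
        "\<not> dvd_in (PF V) p \<alpha>" "\<not> dvd_in (PF V) p \<beta>"
        using good[OF p(1)] p(2) i unfolding good_def zero_ord_def by blast
      note pD = prime_inD[OF p(1)]
      have pk: "h * p ^ k \<in> PF V" "h * p ^ k \<noteq> 0" using S.mult_ne S.power_ne pD h by auto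
      have "h * p ^ k * (c * \<beta>) = a i * b i" using h(5) k(4) by (simp only: ac_simps)
      also have "\<dots> = h * p ^ k * (d * \<alpha>)" using h(6) k(3) by (simp only: ac_simps)
      finally have e: "c * \<beta> = d * \<alpha>" using S.cancel[OF _ _ pk] h k by (metis PF.mult)
      have "dvd_in (PF V) p d" if "dvd_in (PF V) p c"
        using S.dvd_in_mult[OF that k(2)] e pD(4)[OF h(3) k(1)] k(5) by auto
      moreover have "dvd_in (PF V) p c" if "dvd_in (PF V) p d"
        using S.dvd_in_mult[OF that k(1)] e pD(4)[OF h(2) k(2)] k(6) by auto
      ultimately show ?thesis using h(7)[OF p(1)] by blast
    qed
    have "c z \<noteq> 0 \<and> d z \<noteq> 0" if z: "z \<in> U i" for z
      using prime_factor_at[OF h(2) cd0(1), of z] prime_factor_at[OF h(3) cd0(2), of z] nd z by blast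
    then show ?thesis using h by blast
  qed
  then have "\<exists>c d. \<forall>i\<in>J. c i \<in> PF V \<and> d i \<in> PF V \<and> (\<forall>z\<in>U i. c i z \<noteq> 0 \<and> d i z \<noteq> 0) \<and>
      (\<exists>h\<in>PF V. h \<noteq> 0 \<and> a i = h * c i \<and> b i = h * d i)"
    by metis
  then obtain c d where cd: "\<And>i. i \<in> J \<Longrightarrow> c i \<in> PF V \<and> d i \<in> PF V \<and> (\<exists>h\<in>PF V. h \<noteq> 0 \<and> a i = h * c i \<and> b i = h * d i)"
      "\<And>i z. i \<in> J \<Longrightarrow> z \<in> U i \<Longrightarrow> c i z \<noteq> 0 \<and> d i z \<noteq> 0" by blast
  define \<tau> where "\<tau> i z = c i z / d i z" for i z
  have "zreg V (U i) (\<tau> i)" if i: "i \<in> I" for i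
  proof (cases "i \<in> J")
    case True
    then show ?thesis using zreg_frac[of "c i" V "d i" "U i" "\<tau> i"] cd op[OF i] unfolding \<tau>_def by blast
  next
    case False
    then show ?thesis using i unfolding J_def zreg_def by auto
  qed
  moreover have "\<tau> i z \<noteq> 0" if "i \<in> I" "z \<in> U i" for i z
    using cd(2)[of i z] that unfolding \<tau>_def J_def by auto
  moreover have "\<tau> i z = g i j z * \<tau> j z" if z: "i \<in> I" "j \<in> I" "z \<in> U i \<inter> U j" for i j z
  proof -
    have ij: "i \<in> J" "j \<in> J" using z unfolding J_def by auto
    obtain P Q where PQ: "P \<in> PF V" "Q \<in> PF V" "\<forall>z\<in>U i \<inter> U j. P z \<noteq> 0 \<and> Q z \<noteq> 0 \<and> g i j z = P z / Q z"
        "a i * b j * Q = P * a j * b i" using RSE[OF RS ij] by blast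
    obtain h h' where h: "h \<in> PF V" "h \<noteq> 0" "a i = h * c i" "b i = h * d i"
      "h' \<in> PF V" "h' \<noteq> 0" "a j = h' * c j" "b j = h' * d j" using cd(1) ij by meson
    have hh: "h * h' \<in> PF V" "h * h' \<noteq> 0" using S.mult_ne h by auto
    have "h * h' * (c i * d j * Q) = h * h' * (P * c j * d i)"
      using PQ(4) unfolding h(3,4,7,8) by (simp only: ac_simps)
    then have "c i * d j * Q = P * c j * d i"
      using S.cancel[OF _ _ hh] cd(1)[OF ij(1)] cd(1)[OF ij(2)] PQ by (metis PF.mult)
    then have "c i z * d j z * Q z = P z * c j z * d i z" by (metis times_fun_apply)
    then show ?thesis using cd(2)[OF ij(1), of z] cd(2)[OF ij(2), of z] PQ(3) z(3)
      unfolding \<tau>_def by (auto simp: field_simps)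
  qed
  ultimately show ?thesis by blast
qed

end


section \<open>Smooth simplicial complexes of lattice vectors\<close>

definition ip :: "nat \<Rightarrow> (nat \<Rightarrow> int) \<Rightarrow> (nat \<Rightarrow> int) \<Rightarrow> int" where
  "ip l m v = (\<Sum>j=1..l. m j * v j)"

lemma ip_add_left: "ip l (m + m') v = ip l m v + ip l m' v"
  by (simp add: ip_def sum.distrib distrib_right)

lemma ip_add_right: "ip l m (v + v') = ip l m v + ip l m v'"
  by (simp add: ip_def sum.distrib distrib_left)

lemma ip_diff_left: "ip l (m - m') v = ip l m v - ip l m' v"
  by (simp add: ip_def sum_subtractf left_diff_distrib)

lemma ip_zero_right [simp]: "ip l m 0 = 0"
  by (simp add: ip_def)

lemma ip_uminus_left: "ip l (- m) v = - ip l m v"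
  by (simp add: ip_def sum_negf)

lemma ip_smult_left: "ip l (\<lambda>j. k * m j) v = k * ip l m v"
  by (simp add: ip_def sum_distrib_left mult.assoc)

lemma ip_smult_right: "ip l m (\<lambda>j. k * v j) = k * ip l m v"
  by (simp add: ip_def sum_distrib_left algebra_simps)

lemma int_sum_apply: "(sum f I :: nat \<Rightarrow> int) j = (\<Sum>i\<in>I. f i j)"
  by (induction I rule: infinite_finite_induct) auto

lemma ip_sum_left: "ip l (\<Sum>i\<in>I. f i) v = (\<Sum>i\<in>I. ip l (f i) v)"
proof (induction I rule: infinite_finite_induct)
  case (insert x F)
  show ?case unfolding sum.insert[OF insert(1,2)] ip_add_left insert(3) ..
qed (simp_all add: ip_def)

lemma ip_sum_right: "ip l m (\<Sum>i\<in>I. f i) = (\<Sum>i\<in>I. ip l m (f i))"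
proof (induction I rule: infinite_finite_induct)
  case (insert x F)
  show ?case unfolding sum.insert[OF insert(1,2)] ip_add_right insert(3) ..
qed (simp_all add: ip_def)

lemma lattice_vecs_closed [simp]:
  "0 \<in> lattice_vecs l"
  "v \<in> lattice_vecs l \<Longrightarrow> w \<in> lattice_vecs l \<Longrightarrow> v + w \<in> lattice_vecs l"
  "v \<in> lattice_vecs l \<Longrightarrow> w \<in> lattice_vecs l \<Longrightarrow> v - w \<in> lattice_vecs l"
  "v \<in> lattice_vecs l \<Longrightarrow> - v \<in> lattice_vecs l"
  "v \<in> lattice_vecs l \<Longrightarrow> (\<lambda>j. k * v j) \<in> lattice_vecs l"
  by (auto simp: lattice_vecs_def)

lemma lattice_vecs_sum: "(\<And>i. i \<in> I \<Longrightarrow> f i \<in> lattice_vecs l) \<Longrightarrow> sum f I \<in> lattice_vecs l"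
  by (induction I rule: infinite_finite_induct) auto

text \<open>A lattice basis is certified by its dual basis: the last clause makes the vectors
  \<open>d b\<close> generate the dual lattice, and duality then makes \<open>B\<close> a
  basis.\<close>

definition dual_basis :: "nat \<Rightarrow> (nat \<Rightarrow> int) set \<Rightarrow> ((nat \<Rightarrow> int) \<Rightarrow> nat \<Rightarrow> int) \<Rightarrow> bool" where
  "dual_basis l B d \<longleftrightarrow> finite B \<and> B \<subseteq> lattice_vecs l \<and> (\<forall>b\<in>B. d b \<in> lattice_vecs l) \<and>
     (\<forall>b\<in>B. \<forall>b'\<in>B. ip l (d b) b' = (if b = b' then 1 else 0)) \<and>
     (\<forall>m\<in>lattice_vecs l. m = (\<Sum>b\<in>B. (\<lambda>j. ip l m b * d b j)))"

lemma dual_basisD: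
  assumes "dual_basis l B d"
  shows "finite B" "B \<subseteq> lattice_vecs l" "b \<in> B \<Longrightarrow> d b \<in> lattice_vecs l"
    "b \<in> B \<Longrightarrow> b' \<in> B \<Longrightarrow> ip l (d b) b' = (if b = b' then 1 else 0)"
    "m \<in> lattice_vecs l \<Longrightarrow> m = (\<Sum>b\<in>B. (\<lambda>j. ip l m b * d b j))"
  using assms unfolding dual_basis_def by blast+

definition is_basis :: "nat \<Rightarrow> (nat \<Rightarrow> int) set \<Rightarrow> bool" where
  "is_basis l B \<longleftrightarrow> (\<exists>d. dual_basis l B d)"

definition comb :: "(nat \<Rightarrow> int) set \<Rightarrow> ((nat \<Rightarrow> int) \<Rightarrow> real) \<Rightarrow> nat \<Rightarrow> real" where
  "comb A c = (\<lambda>j. \<Sum>v\<in>A. c v * of_int (v j))"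

lemma comb_mono: "finite A \<Longrightarrow> A' \<subseteq> A \<Longrightarrow> (\<And>v. v \<in> A - A' \<Longrightarrow> c v = 0) \<Longrightarrow> comb A' c = comb A c"
  unfolding comb_def by (intro ext sum.mono_neutral_left) auto

text \<open>Coefficients extended by zero allow representations in different cones to be compared by
  equality of functions.\<close>

lemma cone_of_iff:
  "x \<in> cone_of A \<longleftrightarrow> (\<exists>c. (\<forall>v. 0 \<le> c v) \<and> (\<forall>v. v \<notin> A \<longrightarrow> c v = 0) \<and> x = comb A c)"
proof
  assume "x \<in> cone_of A"
  then obtain c where c: "\<forall>v\<in>A. (0::real) \<le> c v" "x = (\<lambda>j. \<Sum>v\<in>A. c v * of_int (v j))"
    unfolding cone_of_def by blast
  then show "\<exists>c. (\<forall>v. 0 \<le> c v) \<and> (\<forall>v. v \<notin> A \<longrightarrow> c v = 0) \<and> x = comb A c"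
    by (intro exI[of _ "\<lambda>v. if v \<in> A then c v else 0"]) (auto simp: comb_def)
qed (auto simp: cone_of_def comb_def)

lemma pairing_comb: "pairing l m (comb A c) = (\<Sum>v\<in>A. c v * of_int (ip l m v))"
proof -
  have "pairing l m (comb A c) = (\<Sum>j=1..l. \<Sum>v\<in>A. of_int (m j) * (c v * of_int (v j)))"
    by (simp add: pairing_def comb_def sum_distrib_left)
  also have "\<dots> = (\<Sum>v\<in>A. \<Sum>j=1..l. of_int (m j) * (c v * of_int (v j)))" by (rule sum.swap)
  finally show ?thesis by (simp add: ip_def sum_distrib_left algebra_simps)
qed

lemma comb_single: "finite A \<Longrightarrow> v \<in> A \<Longrightarrow> comb A (\<lambda>w. if w = v then t else 0) = (\<lambda>j. t * of_int (v j))"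
  unfolding comb_def by (auto simp: if_distrib[of "\<lambda>x. x * _"] cong: if_cong)

lemma gen_in_cone: "finite A \<Longrightarrow> v \<in> A \<Longrightarrow> (\<lambda>j. of_int (v j)) \<in> cone_of A"
  unfolding cone_of_iff by (intro exI[of _ "\<lambda>w. if w = v then 1 else 0"]) (simp add: comb_single)

lemma cone_of_mono: "finite A \<Longrightarrow> A' \<subseteq> A \<Longrightarrow> cone_of A' \<subseteq> cone_of A"
proof
  fix x assume *: "finite A" "A' \<subseteq> A" "x \<in> cone_of A'"
  then obtain c where "\<forall>v. 0 \<le> c v" "\<forall>v. v \<notin> A' \<longrightarrow> c v = 0" "x = comb A' c" unfolding cone_of_iff by blast
  then show "x \<in> cone_of A" unfolding cone_of_iff using comb_mono[of A A' c] * by blast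
qed

lemma dual_monoid_cone: "finite A \<Longrightarrow> dual_monoid l (cone_of A) = {m \<in> lattice_vecs l. \<forall>a\<in>A. 0 \<le> ip l m a}"
proof (intro equalityI subsetI)
  fix m assume A: "finite A" and m: "m \<in> dual_monoid l (cone_of A)"
  have "0 \<le> ip l m a" if a: "a \<in> A" for a
  proof -
    have "0 \<le> pairing l m (\<lambda>j. of_int (a j))" using m gen_in_cone[OF A a] unfolding dual_monoid_def by blast
    also have "\<dots> = of_int (ip l m a)" by (simp add: pairing_def ip_def)
    finally show ?thesis by simp
  qed
  then show "m \<in> {m \<in> lattice_vecs l. \<forall>a\<in>A. 0 \<le> ip l m a}" using m unfolding dual_monoid_def by blast
next
  fix m assume A: "finite A" and m: "m \<in> {m \<in> lattice_vecs l. \<forall>a\<in>A. 0 \<le> ip l m a}"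
  have "0 \<le> pairing l m x" if "x \<in> cone_of A" for x
    using that m unfolding cone_of_iff by (auto simp: pairing_comb intro!: sum_nonneg)
  then show "m \<in> dual_monoid l (cone_of A)" unfolding dual_monoid_def using m by blast
qed

lemma face_cone:
  assumes A: "finite A" and m: "m \<in> dual_monoid l (cone_of A)"
  shows "{x \<in> cone_of A. pairing l m x = 0} = cone_of {a\<in>A. ip l m a = 0}"
proof (intro equalityI subsetI)
  fix x assume "x \<in> {x \<in> cone_of A. pairing l m x = 0}"
  then obtain c where c: "\<forall>v. 0 \<le> c v" "\<forall>v. v \<notin> A \<longrightarrow> c v = 0" "x = comb A c" "pairing l m x = 0"
    unfolding cone_of_iff by blast
  have "\<forall>v\<in>A. c v * of_int (ip l m v) = 0"
    using c(4) A c(1) m unfolding c(3) pairing_comb dual_monoid_cone[OF A]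
    by (subst (asm) sum_nonneg_eq_0_iff) auto
  then have "c v = 0" if "v \<notin> {a\<in>A. ip l m a = 0}" for v using c(2) that by auto
  moreover from this have "x = comb {a\<in>A. ip l m a = 0} c"
    unfolding c(3) by (intro comb_mono[symmetric]) (use A in auto)
  ultimately show "x \<in> cone_of {a\<in>A. ip l m a = 0}" unfolding cone_of_iff using c(1) by blast
next
  fix x assume x: "x \<in> cone_of {a\<in>A. ip l m a = 0}"
  then have "x \<in> cone_of A" using cone_of_mono[OF A, of "{a\<in>A. ip l m a = 0}"] by blast
  moreover have "pairing l m x = 0" using x unfolding cone_of_iff by (auto simp: pairing_comb)
  ultimately show "x \<in> {x \<in> cone_of A. pairing l m x = 0}" by blast
qed

lemma cone_faces_basis:
  assumes B: "dual_basis l B d" and A: "A \<subseteq> B"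
  shows "cone_faces l (cone_of A) = cone_of ` Pow A"
proof (intro equalityI subsetI)
  have finA: "finite A" using A dual_basisD(1)[OF B] finite_subset by blast
  {
    fix x assume "x \<in> cone_faces l (cone_of A)"
    then show "x \<in> cone_of ` Pow A" unfolding cone_faces_def using face_cone[OF finA] by auto
  next
    fix x assume "x \<in> cone_of ` Pow A"
    then obtain A' where A': "A' \<subseteq> A" "x = cone_of A'" by blast
    \<comment> \<open>The sum of the dual vectors of the discarded generators is 0 on
      \<open>A'\<close> and 1 on the rest of \<open>A\<close>.\<close>
    define m where "m = (\<Sum>a\<in>A - A'. d a)"
    have ipm: "ip l m a = (if a \<in> A' then 0 else 1)" if "a \<in> A" for a
    proof -
      have "ip l m a = (\<Sum>b\<in>A-A'. if b = a then 1 else 0)"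
        unfolding m_def ip_sum_left
        by (rule sum.cong) (use dual_basisD(4)[OF B] A that in \<open>auto simp: subset_iff\<close>)
      then show ?thesis using that finA by (simp add: sum.delta)
    qed
    have "m \<in> lattice_vecs l" unfolding m_def
      by (rule lattice_vecs_sum) (use dual_basisD(3)[OF B] A in auto)
    then have m: "m \<in> dual_monoid l (cone_of A)" unfolding dual_monoid_cone[OF finA] using ipm by simp
    have "{a\<in>A. ip l m a = 0} = A'" using ipm A' by (auto split: if_splits)
    then have "x = {x \<in> cone_of A. pairing l m x = 0}" using face_cone[OF finA m] A' by simp
    then show "x \<in> cone_faces l (cone_of A)" unfolding cone_faces_def using m by blast
  }
qed

lemma primitive_gens_basis:
  assumes B: "dual_basis l B d" and A: "A \<subseteq> B"
  shows "primitive_gens l (cone_of A) = A"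
proof (intro equalityI subsetI)
  have finA: "finite A" using A dual_basisD(1)[OF B] finite_subset by blast
  {
    fix a assume a: "a \<in> A"
    have d1: "ip l (d a) a = 1" using dual_basisD(4)[OF B] a A by auto
    have "k = 1" if w: "a = (\<lambda>j. int k * w j)" for w and k :: nat
    proof -
      have "1 = int k * ip l (d a) w" using d1 ip_smult_right[of l "d a" "int k" w] w by metis
      then show ?thesis using zmult_eq_1_iff[of "int k" "ip l (d a) w"] by auto
    qed
    moreover have "a \<noteq> 0" using d1 by auto
    moreover have "a \<in> lattice_vecs l" using a A dual_basisD(2)[OF B] by blast
    ultimately have "primitive_vec l a" unfolding primitive_vec_def by blast
    moreover have "cone_of {a} \<in> cone_faces l (cone_of A)" unfolding cone_faces_basis[OF assms] using a by blast
    ultimately show "a \<in> primitive_gens l (cone_of A)" unfolding primitive_gens_def by blast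
  next
    fix v assume "v \<in> primitive_gens l (cone_of A)"
    then have v: "primitive_vec l v" "cone_of {v} \<in> cone_of ` Pow A"
      unfolding primitive_gens_def cone_faces_basis[OF assms] by auto
    then obtain A' where A': "A' \<subseteq> A" "cone_of {v} = cone_of A'" by blast
    have "v \<noteq> 0" "v \<in> lattice_vecs l" using v unfolding primitive_vec_def by auto
    have "A' \<noteq> {}"
    proof
      assume "A' = {}"
      then have "(\<lambda>j. real_of_int (v j)) \<in> cone_of {}" using gen_in_cone[of "{v}" v] A'(2) by simp
      then have "(\<lambda>j. real_of_int (v j)) = (\<lambda>j. 0)" unfolding cone_of_iff by (auto simp: comb_def)
      then have "v = 0" by (auto simp: fun_eq_iff)
      with \<open>v \<noteq> 0\<close> show False by blast
    qed
    then obtain a where a: "a \<in> A'" by blast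
    have "finite A'" using A' finA finite_subset by blast
    then have "(\<lambda>j. real_of_int (a j)) \<in> cone_of {v}" using gen_in_cone[of A' a] a A' by auto
    then obtain c where c: "0 \<le> c v" "(\<lambda>j. real_of_int (a j)) = comb {v} c" unfolding cone_of_iff by blast
    define t where "t = c v"
    have t: "real_of_int (a j) = t * of_int (v j)" for j
      using fun_cong[OF c(2), of j] by (simp add: comb_def t_def)
    \<comment> \<open>Pairing with the dual vector of \<open>a\<close> gives
      \<open>t * q = 1\<close>, so \<open>v = q * a\<close> with \<open>q\<close> a positive
      integer, and primitivity forces \<open>q = 1\<close>.\<close>
    define q where "q = ip l (d a) v"
    have "real_of_int (ip l (d a) a) = t * of_int q"
      unfolding q_def ip_def by (simp add: t sum_distrib_left algebra_simps)
    moreover have "ip l (d a) a = 1" using dual_basisD(4)[OF B] a A A' by auto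
    ultimately have tq: "t * of_int q = 1" by simp
    then have tpos: "t > 0" using c(1) unfolding t_def by (metis less_eq_real_def mult_zero_left zero_neq_one)
    have qpos: "q > 0" using tq tpos by (metis of_int_0_less_iff zero_less_mult_pos zero_less_one)
    have "v j = q * a j" for j
    proof -
      have "real_of_int (q * a j) = (t * of_int q) * of_int (v j)" using t[of j] by simp
      then have "real_of_int (q * a j) = of_int (v j)" using tq by simp
      then show ?thesis by linarith
    qed
    then have "v = (\<lambda>j. int (nat q) * a j)" using qpos by auto
    moreover have "a \<in> lattice_vecs l" using a A A' dual_basisD(2)[OF B] by blast
    ultimately have "nat q = 1" using v(1) unfolding primitive_vec_def by blast
    then have "v = a" using \<open>v = (\<lambda>j. int (nat q) * a j)\<close> by simp
    then show "v \<in> A" using a A' by blast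
  }
qed

text \<open>A smooth fan is encoded by the sets of primitive generators of its cones. Uniqueness of the
  nonnegative coefficients expresses that two cones meet in the cone of their common generators.\<close>

locale smooth_complex =
  fixes l :: nat and K :: "(nat \<Rightarrow> int) set set"
  assumes extend: "A \<in> K \<Longrightarrow> \<exists>B\<in>K. A \<subseteq> B \<and> is_basis l B"
    and down: "A \<in> K \<Longrightarrow> A' \<subseteq> A \<Longrightarrow> A' \<in> K"
    and uniq: "A \<in> K \<Longrightarrow> A' \<in> K \<Longrightarrow> (\<And>v. 0 \<le> c v) \<Longrightarrow> (\<And>v. 0 \<le> c' v) \<Longrightarrow>
      (\<And>v. v \<notin> A \<Longrightarrow> c v = 0) \<Longrightarrow> (\<And>v. v \<notin> A' \<Longrightarrow> c' v = 0) \<Longrightarrow> comb A c = comb A' c' \<Longrightarrow> c = c'"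
begin

lemma fin: "A \<in> K \<Longrightarrow> finite A"
  using extend dual_basisD(1) finite_subset unfolding is_basis_def by metis

lemma lattice: "A \<in> K \<Longrightarrow> A \<subseteq> lattice_vecs l"
  using extend dual_basisD(2) subset_trans unfolding is_basis_def by metis

lemma cone_Int:
  assumes A: "A \<in> K" "A' \<in> K"
  shows "cone_of A \<inter> cone_of A' = cone_of (A \<inter> A')"
proof (intro equalityI subsetI)
  fix x assume "x \<in> cone_of A \<inter> cone_of A'"
  then obtain c c' where c: "\<And>v. 0 \<le> c v" "\<And>v. v \<notin> A \<Longrightarrow> c v = 0" "x = comb A c"
    "\<And>v. 0 \<le> c' v" "\<And>v. v \<notin> A' \<Longrightarrow> c' v = 0" "x = comb A' c'"
    unfolding cone_of_iff Int_iff by blast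
  have "c = c'" by (rule uniq[OF A]) (use c in auto)
  then have z: "c v = 0" if "v \<notin> A \<inter> A'" for v using c that by blast
  then have "x = comb (A \<inter> A') c" unfolding c(3) by (intro comb_mono[symmetric]) (use fin A in auto)
  then show "x \<in> cone_of (A \<inter> A')" unfolding cone_of_iff using c(1) z by blast
next
  fix x assume "x \<in> cone_of (A \<inter> A')"
  then show "x \<in> cone_of A \<inter> cone_of A'"
    using cone_of_mono[of A "A \<inter> A'"] cone_of_mono[of A' "A \<inter> A'"] fin A by auto
qed

lemma gen_in_cone_iff:
  assumes "A \<in> K" "A' \<in> K" "v \<in> A" "(\<lambda>j. of_int (v j)) \<in> cone_of A'"
  shows "v \<in> A'"
proof -
  let ?c = "\<lambda>w. if w = v then 1 else 0 :: real"
  obtain c where c: "\<And>v. 0 \<le> c v" "\<And>v. v \<notin> A' \<Longrightarrow> c v = 0" "(\<lambda>j. of_int (v j)) = comb A' c"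
    using assms(4) unfolding cone_of_iff by blast
  have "?c = c"
    by (rule uniq[OF assms(1,2)]) (use c comb_single[OF fin[OF assms(1)] assms(3), of 1] assms(3) in auto)
  then have "c v = 1" by auto
  then show ?thesis using c(2) by (metis zero_neq_one)
qed

lemma cone_subset_iff: "A \<in> K \<Longrightarrow> A' \<in> K \<Longrightarrow> cone_of A \<subseteq> cone_of A' \<longleftrightarrow> A \<subseteq> A'"
  using gen_in_cone_iff gen_in_cone[OF fin] cone_of_mono[OF fin] by (meson subset_iff)

lemma gens: "A \<in> K \<Longrightarrow> primitive_gens l (cone_of A) = A"
  using extend primitive_gens_basis unfolding is_basis_def by metis

end

section \<open>Star subdivision of generator sets\<close>

definition star :: "(nat \<Rightarrow> int) set set \<Rightarrow> (nat \<Rightarrow> int) set \<Rightarrow> (nat \<Rightarrow> int) set set" where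
  "star K \<Gamma> = {A \<in> K. \<not> \<Gamma> \<subseteq> A} \<union> {A'. \<exists>A\<in>K. \<Gamma> \<subseteq> A \<and> A' \<subseteq> insert (\<Sum>v\<in>\<Gamma>. v) A \<and> \<not> \<Gamma> \<subseteq> A'}"

text \<open>The new vector can replace any single member of \<open>\<Gamma>\<close>, since it
  contains each of them with coefficient 1.\<close>

lemma basis_exchange:
  assumes B: "dual_basis l B d" and G: "\<Gamma> \<subseteq> B" "\<gamma> \<in> \<Gamma>"
  shows "is_basis l (insert (\<Sum>v\<in>\<Gamma>. v) (B - {\<gamma>}))"
proof -
  define s where "s = (\<Sum>v\<in>\<Gamma>. v)"
  note D = dual_basisD[OF B]
  have finG: "finite \<Gamma>" using G D(1) finite_subset by blast
  have ips: "ip l (d b) s = (if b \<in> \<Gamma> then 1 else 0)" if b: "b \<in> B" for b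
  proof -
    have "ip l (d b) s = (\<Sum>v\<in>\<Gamma>. if b = v then 1 else 0)"
      unfolding s_def ip_sum_right by (rule sum.cong) (use D(4) b G in auto)
    then show ?thesis using finG by simp
  qed
  have gB: "\<gamma> \<in> B" using G by blast
  have sB: "s \<notin> B - {\<gamma>}"
    using ips[OF gB] D(4)[OF gB, of s] G by (auto split: if_splits)
  \<comment> \<open>Every \<open>d b\<close> with \<open>b\<close> in \<open>\<Gamma>\<close> takes
    the value 1 on \<open>s\<close>; subtracting \<open>d \<gamma>\<close> makes it 0 there without
    changing its values on \<open>B - {\<gamma>}\<close>.\<close>
  define d' where "d' b = (if b = s then d \<gamma> else if b \<in> \<Gamma> then d b - d \<gamma> else d b)" for b
  have "dual_basis l (insert s (B - {\<gamma>})) d'"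
    unfolding dual_basis_def
  proof (intro conjI ballI)
    show "finite (insert s (B - {\<gamma>}))" using D(1) by simp
    have "s \<in> lattice_vecs l" unfolding s_def by (rule lattice_vecs_sum) (use D(2) G in blast)
    then show "insert s (B - {\<gamma>}) \<subseteq> lattice_vecs l" using D(2) by blast
    show "d' b \<in> lattice_vecs l" if "b \<in> insert s (B - {\<gamma>})" for b
      using that D(3) gB unfolding d'_def by auto
    show "ip l (d' b) b' = (if b = b' then 1 else 0)"
      if "b \<in> insert s (B - {\<gamma>})" "b' \<in> insert s (B - {\<gamma>})" for b b'
      using that sB ips[OF gB] ips[of b] D(4)[OF gB, of b'] D(4)[of b b'] G(2) unfolding d'_def
      by (auto simp: ip_diff_left)
    fix m assume m: "m \<in> lattice_vecs l"
    show "m = (\<Sum>b\<in>insert s (B - {\<gamma>}). (\<lambda>j. ip l m b * d' b j))"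
    proof
      fix j
      have "m j = (\<Sum>b\<in>B. ip l m b * d b j)"
        by (subst D(5)[OF m]) (simp add: int_sum_apply)
      then have 1: "m j = ip l m \<gamma> * d \<gamma> j + (\<Sum>b\<in>B - {\<gamma>}. ip l m b * d b j)"
        using sum.remove[OF D(1) gB] by metis
      have 2: "ip l m s = ip l m \<gamma> + (\<Sum>b\<in>\<Gamma> - {\<gamma>}. ip l m b)"
        unfolding s_def ip_sum_right using sum.remove[OF finG G(2)] by metis
      have 3: "(\<Sum>b\<in>B - {\<gamma>}. if b \<in> \<Gamma> then ip l m b else 0) = (\<Sum>b\<in>\<Gamma> - {\<gamma>}. ip l m b)"
        by (rule sum.mono_neutral_cong_right) (use D(1) G in auto)
      have "(\<Sum>b\<in>insert s (B - {\<gamma>}). ip l m b * d' b j) =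
          ip l m s * d \<gamma> j + (\<Sum>b\<in>B - {\<gamma>}. ip l m b * d' b j)"
        using D(1) sB by (subst sum.insert) (auto simp: d'_def)
      also have "(\<Sum>b\<in>B - {\<gamma>}. ip l m b * d' b j) =
          (\<Sum>b\<in>B - {\<gamma>}. ip l m b * d b j - (if b \<in> \<Gamma> then ip l m b else 0) * d \<gamma> j)"
        by (rule sum.cong) (use sB in \<open>auto simp: d'_def algebra_simps\<close>)
      also have "\<dots> = (\<Sum>b\<in>B - {\<gamma>}. ip l m b * d b j) - (\<Sum>b\<in>\<Gamma> - {\<gamma>}. ip l m b) * d \<gamma> j"
        by (simp add: sum_subtractf sum_distrib_right[symmetric] 3)
      finally show "m j = (\<Sum>b\<in>insert s (B - {\<gamma>}). (\<lambda>j. ip l m b * d' b j)) j"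
        using 1 2 by (simp add: int_sum_apply algebra_simps)
    qed
  qed
  then show ?thesis unfolding is_basis_def s_def by blast
qed

context smooth_complex
begin

context
  fixes \<Gamma> s
  assumes G: "\<Gamma> \<in> K" "2 \<le> card \<Gamma>" and s_eq: "s = (\<Sum>v\<in>\<Gamma>. v)"
begin

lemma finG: "finite \<Gamma>" using G fin by blast

lemma sum_real: "real_of_int (s j) = (\<Sum>v\<in>\<Gamma>. of_int (v j))"
  unfolding s_eq by (simp add: int_sum_apply)

text \<open>Otherwise \<open>s\<close> would have two representations, by the generators of
  \<open>\<Gamma>\<close> and by itself; uniqueness would shrink \<open>\<Gamma>\<close> to at most
  one vector.\<close>

lemma new_ray_notin:
  assumes A: "A \<in> K"
  shows "s \<notin> A"
proof
  assume s: "s \<in> A"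
  let ?c = "\<lambda>v. if v \<in> \<Gamma> then 1 else 0 :: real" and ?c' = "\<lambda>v. if v = s then 1 else 0 :: real"
  have "comb \<Gamma> ?c = comb A ?c'"
    unfolding comb_single[OF fin[OF A] s] by (simp add: comb_def sum_real)
  then have "?c = ?c'" by (intro uniq[OF G(1) A]) (use s in auto)
  then have "\<Gamma> \<subseteq> {s}" by (metis insertI1 subsetI zero_neq_one)
  then have "card \<Gamma> \<le> 1" using card_mono[of "{s}" \<Gamma>] by simp
  then show False using G by simp
qed

lemma star_cases:
  assumes "A' \<in> star K \<Gamma>"
  shows "\<exists>A\<in>K. A' \<subseteq> insert s A \<and> \<not> \<Gamma> \<subseteq> A' \<and> (s \<in> A' \<longrightarrow> \<Gamma> \<subseteq> A)"
  using assms new_ray_notin unfolding star_def s_eq by blast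

text \<open>The coefficient of the new ray is recovered as the minimum of the coefficients of \<open>\<Gamma>\<close> after
  expanding the ray.\<close>

lemma star_rep:
  assumes A: "A \<in> K" "A' \<subseteq> insert s A" "\<not> \<Gamma> \<subseteq> A'" "s \<in> A' \<longrightarrow> \<Gamma> \<subseteq> A"
    and c0: "\<And>v. 0 \<le> c v" and c1: "\<forall>v. v \<notin> A' \<longrightarrow> c v = 0"
    and h_def: "h = (\<lambda>v. (if v = s then 0 else c v) + (if v \<in> \<Gamma> then c s else 0))"
  shows "0 \<le> h v" "v \<notin> A \<Longrightarrow> h v = 0" "comb A h = comb A' c" "\<exists>\<gamma>\<in>\<Gamma>. h \<gamma> = c s" "v \<in> \<Gamma> \<Longrightarrow> c s \<le> h v"
proof -
  have c: "\<And>v. 0 \<le> c v" "\<And>v. v \<notin> A' \<Longrightarrow> c v = 0" using c0 c1 by auto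
  note sA = new_ray_notin[OF A(1)]
  have sG: "s \<notin> \<Gamma>" using new_ray_notin[OF G(1)] .
  show "0 \<le> h v" using c(1) unfolding h_def by (simp add: add_nonneg_nonneg)
  show "v \<notin> A \<Longrightarrow> h v = 0"
    using A(2,4) c(2)[of v] c(2)[of s] unfolding h_def by (cases "v = s"; cases "s \<in> A'") auto
  show "v \<in> \<Gamma> \<Longrightarrow> c s \<le> h v" using c(1) sG unfolding h_def by auto
  obtain \<gamma> where "\<gamma> \<in> \<Gamma>" "\<gamma> \<notin> A'" using A(3) by blast
  then show "\<exists>\<gamma>\<in>\<Gamma>. h \<gamma> = c s" using c(2)[of \<gamma>] sG unfolding h_def by (intro bexI[of _ \<gamma>]) auto
  show "comb A h = comb A' c"
  proof
    fix j
    have finA: "finite A" using fin A by blast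
    have "comb A' c j = comb (insert s A) c j"
      by (rule fun_cong[OF comb_mono]) (use finA A(2) c(2) in auto)
    also have "\<dots> = c s * of_int (s j) + (\<Sum>v\<in>A. c v * of_int (v j))"
      using finA sA by (simp add: comb_def)
    also have "c s * of_int (s j) = (\<Sum>v\<in>A. (if v \<in> \<Gamma> then c s else 0) * of_int (v j))"
    proof (cases "s \<in> A'")
      case True
      then have "\<Gamma> \<subseteq> A" using A(4) by blast
      then have "(\<Sum>v\<in>A. (if v \<in> \<Gamma> then c s else 0) * real_of_int (v j)) = (\<Sum>v\<in>\<Gamma>. c s * of_int (v j))"
        by (intro sum.mono_neutral_cong_right) (use finA in auto)
      then show ?thesis by (simp add: sum_real sum_distrib_left)
    next
      case False
      then have "c s = 0" using c(2) by blast
      then have "(if v \<in> \<Gamma> then c s else 0) = 0" for v by simp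
      then show ?thesis using \<open>c s = 0\<close> by (simp only: mult_zero_left sum.neutral_const)
    qed
    also have "\<dots> + (\<Sum>v\<in>A. c v * of_int (v j)) = comb A h j"
      unfolding comb_def sum.distrib[symmetric]
      by (rule sum.cong) (use sA in \<open>auto simp: h_def algebra_simps\<close>)
    finally show "comb A h j = comb A' c j" ..
  qed
qed

lemma star_smooth: "smooth_complex l (star K \<Gamma>)"
proof
  have s': "(\<Sum>v\<in>\<Gamma>. v) = s" using s_eq by simp
  have new: "insert s (B - {\<gamma>}) \<in> star K \<Gamma> \<and> is_basis l (insert s (B - {\<gamma>}))"
    if B: "B \<in> K" "is_basis l B" "\<Gamma> \<subseteq> B" "\<gamma> \<in> \<Gamma>" for B \<gamma>
  proof
    have "\<gamma> \<noteq> s" using new_ray_notin[OF G(1)] B(4) by blast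
    then have "\<not> \<Gamma> \<subseteq> insert s (B - {\<gamma>})" using B(4) by blast
    then show "insert s (B - {\<gamma>}) \<in> star K \<Gamma>" unfolding star_def s' using B(1,3) by blast
    show "is_basis l (insert s (B - {\<gamma>}))"
      using B(2) basis_exchange[OF _ B(3,4)] unfolding is_basis_def[of l B] s' by blast
  qed
  {
    fix A' assume A': "A' \<in> star K \<Gamma>"
    obtain A where A: "A \<in> K" "A' \<subseteq> insert s A" "\<not> \<Gamma> \<subseteq> A'" "s \<in> A' \<longrightarrow> \<Gamma> \<subseteq> A"
      using star_cases[OF A'] by blast
    obtain B where B: "B \<in> K" "A \<subseteq> B" "is_basis l B" using extend[OF A(1)] by blast
    \<comment> \<open>Some member of \<open>\<Gamma>\<close> is missing from \<open>A'\<close>;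
      exchanging it for \<open>s\<close> in \<open>B\<close> keeps \<open>A'\<close> inside the new
      basis.\<close>
    obtain \<gamma> where g: "\<gamma> \<in> \<Gamma>" "\<gamma> \<notin> A'" using A(3) by blast
    show "\<exists>B\<in>star K \<Gamma>. A' \<subseteq> B \<and> is_basis l B"
    proof (cases "\<Gamma> \<subseteq> B")
      case True
      then have "A' \<subseteq> insert s (B - {\<gamma>})" using A B g by blast
      then show ?thesis using new[OF B(1,3) True g(1)] by blast
    next
      case False
      then have "B \<in> star K \<Gamma>" using B(1) unfolding star_def by blast
      moreover have "A' \<subseteq> B" using A B False by blast
      ultimately show ?thesis using B(3) by blast
    qed
  next
    fix A A' assume *: "A \<in> star K \<Gamma>" "A' \<subseteq> A"
    from *(1) consider "A \<in> K" "\<not> \<Gamma> \<subseteq> A"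
      | A0 where "A0 \<in> K" "\<Gamma> \<subseteq> A0" "A \<subseteq> insert s A0" "\<not> \<Gamma> \<subseteq> A"
      unfolding star_def s' by blast
    then show "A' \<in> star K \<Gamma>"
    proof cases
      case 1
      then have "A' \<in> K" "\<not> \<Gamma> \<subseteq> A'" using down *(2) by blast+
      then show ?thesis unfolding star_def by blast
    next
      case 2
      then have "A' \<subseteq> insert s A0" "\<not> \<Gamma> \<subseteq> A'" using *(2) by blast+
      with 2 show ?thesis unfolding star_def s' by blast
    qed
  next
    fix A1 A2 and c1 c2 :: "(nat \<Rightarrow> int) \<Rightarrow> real"
    assume A1: "A1 \<in> star K \<Gamma>" and A2: "A2 \<in> star K \<Gamma>"
      and c: "\<And>v. 0 \<le> c1 v" "\<And>v. 0 \<le> c2 v" "\<And>v. v \<notin> A1 \<Longrightarrow> c1 v = 0" "\<And>v. v \<notin> A2 \<Longrightarrow> c2 v = 0"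
      and eq: "comb A1 c1 = comb A2 c2"
    obtain B1 where B1: "B1 \<in> K" "A1 \<subseteq> insert s B1" "\<not> \<Gamma> \<subseteq> A1" "s \<in> A1 \<longrightarrow> \<Gamma> \<subseteq> B1"
      using star_cases[OF A1] by blast
    obtain B2 where B2: "B2 \<in> K" "A2 \<subseteq> insert s B2" "\<not> \<Gamma> \<subseteq> A2" "s \<in> A2 \<longrightarrow> \<Gamma> \<subseteq> B2"
      using star_cases[OF A2] by blast
    define h1 where "h1 = (\<lambda>v. (if v = s then 0 else c1 v) + (if v \<in> \<Gamma> then c1 s else 0))"
    define h2 where "h2 = (\<lambda>v. (if v = s then 0 else c2 v) + (if v \<in> \<Gamma> then c2 s else 0))"
    have z: "\<forall>v. v \<notin> A1 \<longrightarrow> c1 v = 0" "\<forall>v. v \<notin> A2 \<longrightarrow> c2 v = 0" using c(3,4) by auto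
    note r1 = star_rep[OF B1 c(1) z(1) h1_def] and r2 = star_rep[OF B2 c(2) z(2) h2_def]
    have h: "h1 = h2"
      by (rule uniq[OF B1(1) B2(1)]) (use r1(1-3) r2(1-3) eq in auto)
    obtain g1 g2 where g: "g1 \<in> \<Gamma>" "h1 g1 = c1 s" "g2 \<in> \<Gamma>" "h2 g2 = c2 s" using r1(4) r2(4) by blast
    \<comment> \<open>Both coefficients of \<open>s\<close> are the minimum over
      \<open>\<Gamma>\<close> of the same function \<open>h1 = h2\<close>, so they coincide.\<close>
    have "c1 s \<le> c2 s" using r1(5)[OF g(3)] g h by simp
    moreover have "c2 s \<le> c1 s" using r2(5)[OF g(1)] g h by simp
    ultimately have cs: "c1 s = c2 s" by simp
    show "c1 = c2"
    proof
      fix v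
      show "c1 v = c2 v" using fun_cong[OF h, of v] cs unfolding h1_def h2_def by (cases "v = s"; cases "v \<in> \<Gamma>") auto
    qed
  }
qed

lemma star_subdivision_eq: "star_subdivision l (cone_of ` K) (cone_of \<Gamma>) = cone_of ` star K \<Gamma>"
proof -
  have s': "(\<Sum>v\<in>\<Gamma>. v) = s" using s_eq by simp
  have 1: "{\<sigma> \<in> cone_of ` K. \<not> cone_of \<Gamma> \<subseteq> \<sigma>} = cone_of ` {A \<in> K. \<not> \<Gamma> \<subseteq> A}"
    using cone_subset_iff[OF G(1)] by blast
  have 2: "{cone_of A' | A' \<sigma>. \<sigma> \<in> cone_of ` K \<and> cone_of \<Gamma> \<subseteq> \<sigma> \<and>
        A' \<subseteq> insert s (primitive_gens l \<sigma>) \<and> \<not> \<Gamma> \<subseteq> A'} =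
      cone_of ` {A'. \<exists>A\<in>K. \<Gamma> \<subseteq> A \<and> A' \<subseteq> insert s A \<and> \<not> \<Gamma> \<subseteq> A'}"
  proof (intro equalityI subsetI)
    fix x assume "x \<in> {cone_of A' | A' \<sigma>. \<sigma> \<in> cone_of ` K \<and> cone_of \<Gamma> \<subseteq> \<sigma> \<and>
        A' \<subseteq> insert s (primitive_gens l \<sigma>) \<and> \<not> \<Gamma> \<subseteq> A'}"
    then obtain A' A where A: "x = cone_of A'" "A \<in> K" "cone_of \<Gamma> \<subseteq> cone_of A"
      "A' \<subseteq> insert s (primitive_gens l (cone_of A))" "\<not> \<Gamma> \<subseteq> A'" by blast
    then have "\<Gamma> \<subseteq> A" "A' \<subseteq> insert s A" using cone_subset_iff[OF G(1)] gens by auto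
    then show "x \<in> cone_of ` {A'. \<exists>A\<in>K. \<Gamma> \<subseteq> A \<and> A' \<subseteq> insert s A \<and> \<not> \<Gamma> \<subseteq> A'}" using A by blast
  next
    fix x assume "x \<in> cone_of ` {A'. \<exists>A\<in>K. \<Gamma> \<subseteq> A \<and> A' \<subseteq> insert s A \<and> \<not> \<Gamma> \<subseteq> A'}"
    then obtain A' A where A: "x = cone_of A'" "A \<in> K" "\<Gamma> \<subseteq> A" "A' \<subseteq> insert s A" "\<not> \<Gamma> \<subseteq> A'" by blast
    then have "cone_of \<Gamma> \<subseteq> cone_of A" "A' \<subseteq> insert s (primitive_gens l (cone_of A))"
      using cone_subset_iff[OF G(1)] gens by auto
    then show "x \<in> {cone_of A' | A' \<sigma>. \<sigma> \<in> cone_of ` K \<and> cone_of \<Gamma> \<subseteq> \<sigma> \<and>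
        A' \<subseteq> insert s (primitive_gens l \<sigma>) \<and> \<not> \<Gamma> \<subseteq> A'}" using A by blast
  qed
  show ?thesis
    unfolding star_subdivision_def star_def gens[OF G(1)] s' 1 2 image_Un ..
qed

end

end

section \<open>The fan of the iterated blow-up\<close>

text \<open>For positive \<open>i\<close> this is the ray created by the \<open>i\<close>-th
  blow-up, counted from 1; index 0 gives \<open>e l\<close>, so that the first centre has the same
  shape as the later ones.\<close>

definition chain_ray :: "nat \<Rightarrow> nat \<Rightarrow> nat \<Rightarrow> int" where
  "chain_ray l i = (\<lambda>k. int i * (\<Sum>j=1..l-1. e j k)) + e l"

text \<open>Equal to \<open>e_1 + 2 (e_2 + ... + e_l)\<close>, the sum of the generators of the last
  centre.\<close>

definition final_ray :: "nat \<Rightarrow> nat \<Rightarrow> int" where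
  "final_ray l = chain_ray l 1 + (\<Sum>j=2..l. e j)"

definition step_gens :: "nat \<Rightarrow> nat \<Rightarrow> (nat \<Rightarrow> int) set" where
  "step_gens l i = insert (chain_ray l i) (e ` {1..l-1})"

primrec blowup_complex :: "nat \<Rightarrow> nat \<Rightarrow> (nat \<Rightarrow> int) set set" where
  "blowup_complex l 0 = Pow (e ` {1..l})"
| "blowup_complex l (Suc i) = star (blowup_complex l i) (step_gens l i)"

definition final_complex :: "nat \<Rightarrow> nat \<Rightarrow> (nat \<Rightarrow> int) set set" where
  "final_complex l n = star (blowup_complex l n) (insert (chain_ray l 1) (e ` {2..l}))"

lemma e_eq_iff [simp]: "e i = e j \<longleftrightarrow> i = j"
  by (metis e_def zero_neq_one)

lemma inj_e: "inj_on e S"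
  by (simp add: inj_on_def)

lemma e_lattice: "1 \<le> i \<Longrightarrow> i \<le> l \<Longrightarrow> e i \<in> lattice_vecs l"
  by (auto simp: e_def lattice_vecs_def)

lemma ip_e: "1 \<le> i \<Longrightarrow> i \<le> l \<Longrightarrow> ip l m (e i) = m i"
  unfolding ip_def e_def by (simp add: if_distrib[of "\<lambda>x. _ * x"] cong: if_cong)

lemma dual_basis_std: "dual_basis l (e ` {1..l}) (\<lambda>b. b)"
  unfolding dual_basis_def
proof (intro conjI ballI)
  show "ip l b b' = (if b = b' then 1 else 0)" if "b \<in> e ` {1..l}" "b' \<in> e ` {1..l}" for b b'
    using that by (auto simp: ip_e) (auto simp: e_def)
  fix m assume m: "m \<in> lattice_vecs l"
  show "m = (\<Sum>b\<in>e ` {1..l}. (\<lambda>j. ip l m b * b j))"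
  proof
    fix j
    have "(\<Sum>b\<in>e ` {1..l}. (\<lambda>j. ip l m b * b j)) j = (\<Sum>i=1..l. ip l m (e i) * e i j)"
      by (simp add: int_sum_apply sum.reindex[OF inj_e])
    also have "\<dots> = (\<Sum>i=1..l. if i = j then m i else 0)"
      by (rule sum.cong) (auto simp: ip_e, auto simp: e_def)
    also have "\<dots> = m j" using m by (auto simp: lattice_vecs_def)
    finally show "m j = (\<Sum>b\<in>e ` {1..l}. (\<lambda>j. ip l m b * b j)) j" ..
  qed
qed (auto simp: e_lattice)

lemma basis_comb_inj:
  assumes B: "dual_basis l B d" and eq: "comb B c = comb B c'" and b: "b \<in> B"
  shows "c b = c' b"
proof -
  have *: "pairing l (d b) (comb B c) = c b" for c
  proof -
    have "pairing l (d b) (comb B c) = (\<Sum>v\<in>B. if v = b then c v else 0)"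
      unfolding pairing_comb by (rule sum.cong) (use dual_basisD(4)[OF B b] in auto)
    then show ?thesis using b dual_basisD(1)[OF B] by simp
  qed
  show ?thesis using *[of c] *[of c'] eq by simp
qed

lemma smooth_std: "smooth_complex l (Pow (e ` {1..l}))"
proof
  fix A A' and c c' :: "(nat \<Rightarrow> int) \<Rightarrow> real"
  assume A: "A \<in> Pow (e ` {1..l})" "A' \<in> Pow (e ` {1..l})"
    and c: "\<And>v. v \<notin> A \<Longrightarrow> c v = 0" "\<And>v. v \<notin> A' \<Longrightarrow> c' v = 0" "comb A c = comb A' c'"
  have "comb A c = comb (e ` {1..l}) c" "comb A' c' = comb (e ` {1..l}) c'"
    by (rule comb_mono; use A c in auto)+
  then have "c b = c' b" if "b \<in> e ` {1..l}" for b
    using basis_comb_inj[OF dual_basis_std] c(3) that by metis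
  moreover have "c b = c' b" if "b \<notin> e ` {1..l}" for b using that A c by (metis PowD subsetD)
  ultimately show "c = c'" by blast
qed (use dual_basis_std in \<open>auto simp: is_basis_def\<close>)

lemma affine_space_fan_eq: "affine_space_fan l = cone_of ` blowup_complex l 0"
  unfolding affine_space_fan_def blowup_complex.simps by (rule cone_faces_basis[OF dual_basis_std]) auto

lemma chain_ray_0: "chain_ray l 0 = e l"
  by (simp add: chain_ray_def fun_eq_iff)

lemma chain_ray_last: "1 \<le> l \<Longrightarrow> chain_ray l i l = 1"
  unfolding chain_ray_def by (auto simp: e_def)

lemma chain_ray_low: "1 \<le> k \<Longrightarrow> k < l \<Longrightarrow> chain_ray l i k = int i"
proof -
  assume k: "1 \<le> k" "k < l"
  have "(\<Sum>j=1..l-1. e j k) = (\<Sum>j=1..l-1. if j = k then 1 else 0)"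
    by (rule sum.cong) (auto simp: e_def)
  also have "\<dots> = 1" using k by simp
  finally show ?thesis unfolding chain_ray_def using k by (simp add: e_def)
qed

lemma chain_ray_notin: "1 \<le> l \<Longrightarrow> chain_ray l i \<notin> e ` {1..l-1}"
proof
  assume "1 \<le> l" "chain_ray l i \<in> e ` {1..l-1}"
  then obtain j where "1 \<le> j" "j \<le> l - 1" "chain_ray l i = e j" by auto
  then have "chain_ray l i l = e j l" by simp
  then show False using chain_ray_last[OF \<open>1 \<le> l\<close>, of i] \<open>j \<le> l - 1\<close> \<open>1 \<le> l\<close> by (auto simp: e_def split: if_splits)
qed

lemma sum_e_image: "(\<Sum>v\<in>e ` S. v) = (\<Sum>j\<in>S. e j)"
  by (simp add: sum.reindex[OF inj_e])

lemma step_sum: "1 \<le> l \<Longrightarrow> (\<Sum>v\<in>step_gens l i. v) = chain_ray l (Suc i)"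
proof -
  assume l: "1 \<le> l"
  have "(\<Sum>v\<in>step_gens l i. v) = chain_ray l i + (\<Sum>j=1..l-1. e j)"
    unfolding step_gens_def using chain_ray_notin[OF l, of i] sum_e_image[of "{1..l-1}"] by (simp add: sum.insert)
  also have "\<dots> = chain_ray l (Suc i)" unfolding chain_ray_def by (auto simp: fun_eq_iff int_sum_apply algebra_simps)
  finally show ?thesis .
qed

lemma blowup_cone_eq: "blowup_cone l i = cone_of (step_gens l i)"
  unfolding blowup_cone_def step_gens_def chain_ray_def ..

lemma card_step: "2 \<le> l \<Longrightarrow> 2 \<le> card (step_gens l i)"
  unfolding step_gens_def using chain_ray_notin[of l i] by (simp add: card_insert_if card_image[OF inj_e])

lemma chain_ray_ne_e: "2 \<le> l \<Longrightarrow> 1 \<le> i \<Longrightarrow> 1 \<le> j \<Longrightarrow> chain_ray l i \<noteq> e j"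
proof
  assume *: "2 \<le> l" "1 \<le> i" "1 \<le> j" "chain_ray l i = e j"
  show False
    using fun_cong[OF *(4), of l] fun_cong[OF *(4), of 1] chain_ray_last[of l i] chain_ray_low[of 1 l i] *
    by (auto simp: e_def split: if_splits)
qed

text \<open>Each centre arises from the previous one by exchanging \<open>chain_ray l i\<close> for
  the new ray, so it is a cone of the star subdivision just made.\<close>

lemma step_gens_in: "2 \<le> l \<Longrightarrow> step_gens l i \<in> blowup_complex l i"
proof (induction i)
  case 0
  have "e l \<in> e ` {1..l}" "e ` {1..l-1} \<subseteq> e ` {1..l}" using 0 by auto
  then show ?case unfolding step_gens_def chain_ray_0 by simp
next
  case (Suc i)
  have nv: "chain_ray l i \<noteq> chain_ray l (Suc i)" using chain_ray_low[of 1 l i] chain_ray_low[of 1 l "Suc i"] Suc(2) by auto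
  then have "chain_ray l i \<notin> step_gens l (Suc i)" unfolding step_gens_def using chain_ray_notin[of l i] Suc(2) by auto
  then have "\<not> step_gens l i \<subseteq> step_gens l (Suc i)" unfolding step_gens_def by auto
  moreover have "step_gens l (Suc i) \<subseteq> insert (\<Sum>v\<in>step_gens l i. v) (step_gens l i)"
    using step_sum[of l i] Suc(2) unfolding step_gens_def by auto
  ultimately show ?case using Suc unfolding blowup_complex.simps star_def by blast
qed

lemma blowup_complex_smooth: "2 \<le> l \<Longrightarrow> smooth_complex l (blowup_complex l i)"
proof (induction i)
  case 0
  then show ?case using smooth_std by simp
next
  case (Suc i)
  then interpret smooth_complex l "blowup_complex l i" by blast
  show ?case using star_smooth[OF step_gens_in card_step refl] Suc(2) by simp
qed

lemma Z_fan_eq: "2 \<le> l \<Longrightarrow> Z_fan l i = cone_of ` blowup_complex l i"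
proof (induction i)
  case 0
  then show ?case using affine_space_fan_eq by simp
next
  case (Suc i)
  interpret smooth_complex l "blowup_complex l i" using blowup_complex_smooth Suc by blast
  show ?case using star_subdivision_eq[OF step_gens_in card_step refl] Suc blowup_cone_eq by simp
qed

lemma blowup_complex_keep: "A \<in> blowup_complex l i \<Longrightarrow> (\<And>k. i \<le> k \<Longrightarrow> k < n \<Longrightarrow> \<not> step_gens l k \<subseteq> A) \<Longrightarrow> i \<le> n \<Longrightarrow> A \<in> blowup_complex l n"
proof (induction n)
  case (Suc n)
  show ?case
  proof (cases "i = Suc n")
    case False
    then have "A \<in> blowup_complex l n" using Suc by auto
    then show ?thesis using Suc False unfolding blowup_complex.simps star_def by auto
  qed (use Suc in simp)
qed simp

text \<open>In the centre of step \<open>i\<close> the generator \<open>e 1\<close> is exchanged for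
  the new ray. The later steps of the chain leave the result alone, as their centres contain
  \<open>e 1\<close>. For \<open>i = 0\<close> it is the centre of the final blow-up.\<close>

lemma chain_gens_in:
  assumes l: "2 \<le> l" and i: "i < n"
  shows "insert (chain_ray l i) (insert (chain_ray l (Suc i)) (e ` {2..l-1})) \<in> blowup_complex l n"
proof (rule blowup_complex_keep[of _ _ "Suc i"])
  let ?A = "insert (chain_ray l i) (insert (chain_ray l (Suc i)) (e ` {2..l-1}))"
  have "e 1 \<noteq> chain_ray l k" for k
    using chain_ray_ne_e[OF l, of k 1] chain_ray_0[of l] l by (cases k) (auto dest: sym)
  then have e1: "e 1 \<notin> ?A" by auto
  have e1s: "e 1 \<in> step_gens l k" for k unfolding step_gens_def using l by auto
  show "\<not> step_gens l k \<subseteq> ?A" for k using e1 e1s by blast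
  have "?A \<subseteq> insert (\<Sum>v\<in>step_gens l i. v) (step_gens l i)"
    using step_sum[of l i] l unfolding step_gens_def by auto
  then show "?A \<in> blowup_complex l (Suc i)" using step_gens_in[OF l, of i] e1 e1s[of i] unfolding blowup_complex.simps star_def by blast
qed (use i in auto)

definition rays :: "nat \<Rightarrow> nat \<Rightarrow> (nat \<Rightarrow> int) set" where
  "rays l n = e ` {1..l} \<union> chain_ray l ` {1..n} \<union> {final_ray l}"

lemma blowup_complex_rays: "2 \<le> l \<Longrightarrow> A \<in> blowup_complex l i \<Longrightarrow> A \<subseteq> e ` {1..l} \<union> chain_ray l ` {1..i}"
proof (induction i arbitrary: A)
  case (Suc i)
  have ss: "(\<Sum>v\<in>step_gens l i. v) = chain_ray l (Suc i)" using step_sum Suc(2) by simp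
  have "\<exists>A0\<in>blowup_complex l i. A \<subseteq> insert (chain_ray l (Suc i)) A0"
    using Suc(3) unfolding blowup_complex.simps star_def ss by blast
  then obtain A0 where "A0 \<in> blowup_complex l i" "A \<subseteq> insert (chain_ray l (Suc i)) A0" by blast
  moreover have "A0 \<subseteq> e ` {1..l} \<union> chain_ray l ` {1..i}" using Suc calculation by blast
  moreover have "chain_ray l ` {1..i} \<subseteq> chain_ray l ` {1..Suc i}" "chain_ray l (Suc i) \<in> chain_ray l ` {1..Suc i}" by auto
  ultimately show ?case by blast
qed auto

lemma final_sum:
  assumes l: "2 \<le> l"
  shows "(\<Sum>v\<in>insert (chain_ray l 1) (e ` {2..l}). v) = final_ray l"
proof -
  have "chain_ray l 1 \<notin> e ` {2..l}" using chain_ray_ne_e[OF l] by fastforce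
  then show ?thesis unfolding final_ray_def using sum_e_image[of "{2..l}"] by (simp add: sum.insert)
qed

lemma sum_e_chain_ray: "1 \<le> l \<Longrightarrow> (\<Sum>j=1..l. e j) = chain_ray l 1"
proof -
  assume "1 \<le> l"
  then have "{1..l} = insert l {1..l-1}" by auto
  then show ?thesis unfolding chain_ray_def using \<open>1 \<le> l\<close> by (auto simp: fun_eq_iff int_sum_apply)
qed

text \<open>The last three claims single out the maximal cones whose vertices yield the inequalities
  between heights used in the decomposition.\<close>

theorem fan_description:
  assumes l: "2 \<le> l" and n: "1 \<le> n"
  shows "Z_tilde_fan l n = cone_of ` final_complex l n" "smooth_complex l (final_complex l n)"
    "A \<in> final_complex l n \<Longrightarrow> A \<subseteq> rays l n"
    "1 \<le> i \<Longrightarrow> i < n \<Longrightarrow> insert (chain_ray l i) (insert (chain_ray l (Suc i)) (e ` {2..l-1})) \<in> final_complex l n"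
    "insert (chain_ray l n) (e ` {1..l-1}) \<in> final_complex l n"
    "insert (final_ray l) (e ` {2..l}) \<in> final_complex l n"
proof -
  interpret smooth_complex l "blowup_complex l n" using blowup_complex_smooth l by blast
  let ?G = "insert (chain_ray l 1) (e ` {2..l})"
  have "{2..l} = insert l {2..l-1}" using l by auto
  then have G_eq: "?G = insert (chain_ray l 0) (insert (chain_ray l (Suc 0)) (e ` {2..l-1}))" unfolding chain_ray_0 by auto
  then have G: "?G \<in> blowup_complex l n" using chain_gens_in[OF l, of 0 n] n by simp
  have nin: "chain_ray l 1 \<notin> e ` {2..l}" using chain_ray_ne_e[OF l] by fastforce
  then have card: "2 \<le> card ?G" using l by (simp add: card_insert_if card_image[OF inj_e])
  have el: "e l \<in> ?G" using l by auto
  have elv: "e l \<noteq> chain_ray l i" if "1 \<le> i" for i using chain_ray_ne_e[OF l that, of l] l by (simp add: eq_commute)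
  show "Z_tilde_fan l n = cone_of ` final_complex l n"
    unfolding Z_tilde_fan_def final_complex_def using Z_fan_eq[OF l] star_subdivision_eq[OF G card refl] sum_e_chain_ray l by simp
  show "smooth_complex l (final_complex l n)" unfolding final_complex_def by (rule star_smooth[OF G card refl])
  show "A \<subseteq> rays l n" if A: "A \<in> final_complex l n"
  proof -
    have "\<exists>A0\<in>blowup_complex l n. A \<subseteq> insert (final_ray l) A0"
      using A unfolding final_complex_def star_def final_sum[OF l] by blast
    then show ?thesis using blowup_complex_rays[OF l] unfolding rays_def by blast
  qed
  show "insert (chain_ray l i) (insert (chain_ray l (Suc i)) (e ` {2..l-1})) \<in> final_complex l n" if i: "1 \<le> i" "i < n"
  proof -
    \<comment> \<open>Lacking \<open>e l\<close>, the cone does not contain the final centre and is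
      kept.\<close>
    have "e l \<notin> insert (chain_ray l i) (insert (chain_ray l (Suc i)) (e ` {2..l-1}))"
      using elv[of i] elv[of "Suc i"] i l by auto
    then show ?thesis unfolding final_complex_def star_def using chain_gens_in[OF l i(2)] el by blast
  qed
  show "insert (chain_ray l n) (e ` {1..l-1}) \<in> final_complex l n"
  proof -
    have "e l \<notin> insert (chain_ray l n) (e ` {1..l-1})" using elv[OF n] l by auto
    then show ?thesis unfolding final_complex_def star_def using step_gens_in[OF l, of n] el unfolding step_gens_def by blast
  qed
  show "insert (final_ray l) (e ` {2..l}) \<in> final_complex l n"
  proof -
    have "final_ray l l = 2" unfolding final_ray_def using l chain_ray_last[of l 1]
      by (simp add: int_sum_apply e_def)
    then have "final_ray l \<noteq> chain_ray l 1" using chain_ray_last[of l 1] l by auto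
    then have "\<not> ?G \<subseteq> insert (final_ray l) (e ` {2..l})" using nin by auto
    then show ?thesis unfolding final_complex_def star_def final_sum[OF l] using G by blast
  qed
qed


section \<open>Decomposing lattice points\<close>

text \<open>Greedy choice: each index in turn takes as much of \<open>r\<close> as its bound
  allows.\<close>

lemma split_sum:
  fixes M :: "'a \<Rightarrow> int"
  assumes "finite J" "\<And>j. j \<in> J \<Longrightarrow> 0 \<le> M j" "0 \<le> r" "r \<le> sum M J"
  shows "\<exists>m. (\<forall>j\<in>J. 0 \<le> m j \<and> m j \<le> M j) \<and> sum m J = r"
  using assms
proof (induction J arbitrary: r)
  case (insert x J)
  define a where "a = min r (M x)"
  have "0 \<le> r - a" "r - a \<le> sum M J" using insert sum_nonneg[of J M] unfolding a_def by (auto simp: min_def)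
  then obtain m where m: "\<forall>j\<in>J. 0 \<le> m j \<and> m j \<le> M j" "sum m J = r - a"
    using insert(3)[of "r - a"] insert(4) by auto
  have "sum (m(x := a)) (insert x J) = a + sum m J"
    using insert(1,2) by (simp add: sum.insert) (rule sum.cong; auto)
  then show ?case using m insert(2,4,5,6) unfolding a_def
    by (intro exI[of _ "m(x := a)"]) (auto simp: min_def a_def)
qed auto

lemma exI3: "P x y z \<Longrightarrow> \<exists>x y z. P x y z"
  by blast

text \<open>Here \<open>A\<close>, \<open>S\<close>, \<open>U\<close> are the values of \<open>m\<^sub>1\<close>, \<open>m\<^sub>1 + \<dots> + m\<^bsub>l-1\<^esub>\<close> and \<open>m\<^sub>1 + \<dots> + m\<^sub>l\<close>.\<close>

lemma split_wide:
  fixes A S U D b c :: int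
  assumes "0 \<le> A" "A \<le> S" "S \<le> U" "2 * D \<le> S" "2 * b \<le> U" "2 * c \<le> 2 * U - A"
    "0 \<le> D" "b \<le> c" "c \<le> 2 * b - D"
  shows "\<exists>A' S' U'. 0 \<le> A' \<and> A' \<le> A \<and> 0 \<le> S' - A' \<and> S' - A' \<le> S - A \<and> D \<le> S' \<and> D \<le> S - S' \<and>
     S' \<le> U' \<and> S - S' \<le> U - U' \<and> b \<le> U' \<and> b \<le> U - U' \<and> c \<le> 2 * U' - A' \<and> c \<le> 2 * (U - U') - (A - A')"
\<comment> \<open>The exceptional parity: the halves \<open>\<alpha>\<close> and
  \<open>\<upsilon>\<close> give \<open>2 * \<upsilon> - \<alpha> = c - 1\<close>, one unit short of
  the last inequality.\<close>
proof (cases "\<exists>\<alpha> \<upsilon>. A = 2 * \<alpha> \<and> U = 2 * \<upsilon> + 1 \<and> U = c + \<alpha>")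
  case False
  obtain \<alpha> where hA: "A = 2 * \<alpha> \<or> A = 2 * \<alpha> + 1" by (metis evenE oddE)
  obtain \<sigma> where hS: "S = 2 * \<sigma> \<or> S = 2 * \<sigma> + 1" by (metis evenE oddE)
  obtain \<upsilon> where hU: "U = 2 * \<upsilon> \<or> U = 2 * \<upsilon> + 1" by (metis evenE oddE)
  \<comment> \<open>Outside the exceptional case the bound is strict, which pays for rounding
    \<open>U\<close> down.\<close>
  have le: "c + \<alpha> + 1 \<le> U" if "A = 2 * \<alpha>" "U = 2 * \<upsilon> + 1"
  proof -
    have "U \<noteq> c + \<alpha>" using False that by blast
    moreover have "c + \<alpha> \<le> U" using assms(6) that(1) by linarith
    ultimately show ?thesis by simp
  qed
  consider "A = 2 * \<alpha> + 1" | "A = 2 * \<alpha>" "U = 2 * \<upsilon>" | "A = 2 * \<alpha>" "U = 2 * \<upsilon> + 1"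
    using hA hU by blast
  then show ?thesis
  proof cases
    case 1
    show ?thesis
      by (rule exI3[of _ \<alpha> \<sigma> \<upsilon>], insert hU hS 1 assms, elim disjE; intro conjI; (linarith | presburger))
  next
    case 2
    show ?thesis
      by (rule exI3[of _ \<alpha> \<sigma> \<upsilon>], insert hS 2 assms, elim disjE; intro conjI; (linarith | presburger))
  next
    case 3
    show ?thesis
      by (rule exI3[of _ \<alpha> \<sigma> \<upsilon>], insert hS 3 le[OF 3] assms, elim disjE; intro conjI; (linarith | presburger))
  qed
next
  case True
  then obtain \<alpha> \<upsilon> where *: "A = 2 * \<alpha>" "U = 2 * \<upsilon> + 1" "U = c + \<alpha>" by blast
  \<comment> \<open>With \<open>\<alpha> = 0\<close> the odd number \<open>U\<close> would equal
    \<open>c\<close>, while \<open>2 * b \<le> U\<close> and \<open>c \<le> 2 * b - D\<close> force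
    \<open>c = 2 * b\<close>.\<close>
  have a1: "1 \<le> \<alpha>" using * assms by presburger
  obtain \<sigma> where s: "S = 2 * \<sigma> \<or> S = 2 * \<sigma> + 1" by (metis evenE oddE)
  show ?thesis
  proof (cases "S = A")
    case True
    \<comment> \<open>For \<open>S = A\<close> the value \<open>S'\<close> has to move down together
      with \<open>A'\<close>. There is room for this, since \<open>D = \<alpha>\<close> would force
      \<open>2 * b = U\<close>, which is odd.\<close>
    then have "D + 1 \<le> \<alpha>" using * assms by presburger
    then show ?thesis
      by (intro exI3[of _ "\<alpha> - 1" "\<alpha> - 1" \<upsilon>], insert True * assms a1, intro conjI; (linarith | presburger))
  next
    case False
    then have "A + 1 \<le> S" using assms(2) by simp
    then show ?thesis
      by (intro exI3[of _ "\<alpha> - 1" \<sigma> \<upsilon>], insert * assms a1 s, elim disjE; intro conjI; (linarith | presburger))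
  qed
qed

text \<open>\<open>b\<close> is concave with slopes \<open>d\<close>: a difference of values is at
  most the number of steps times the first slope and at least that number times the last one. The
  case \<open>j = 0\<close> is set apart because \<open>d (j - 1)\<close> is then not a slope of the
  range.\<close>

lemma decreasing_chain:
  fixes b :: "nat \<Rightarrow> int"
  assumes dec: "\<And>i. i < n \<Longrightarrow> d (Suc i) \<le> d i" and d: "\<And>i. i < n \<Longrightarrow> b (Suc i) - b i = d i"
    and ij: "i \<le> j" "j \<le> n"
  shows "b j - b i \<le> int (j - i) * d i" "int (j - i) * (if j = 0 then 0 else d (j - 1)) \<le> b j - b i"
proof -
  have mono: "d q \<le> d p" if "p \<le> q" "q \<le> n" for p q
    using that
  proof (induction q)
    case (Suc q)
    then show ?case using dec[of q] by (cases "p = Suc q") auto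
  qed simp
  show "b j - b i \<le> int (j - i) * d i" using ij
  proof (induction j)
    case (Suc j)
    show ?case
    proof (cases "i = Suc j")
      case False
      then have "b j - b i \<le> int (j - i) * d i" "d j \<le> d i" using Suc mono by auto
      moreover have "Suc j - i = Suc (j - i)" using False Suc(2) by simp
      then have "int (Suc j - i) * d i = int (j - i) * d i + d i" by (simp add: algebra_simps)
      moreover have "b (Suc j) - b j = d j" using d[of j] Suc(3) by simp
      ultimately show ?thesis by linarith
    qed simp
  qed simp
  have "int (j - k) * (if j = 0 then 0 else d (j - 1)) \<le> b j - b k" if "k \<le> j" for k
    using that
  proof (induction "j - k" arbitrary: k)
    case (Suc m)
    then have k: "k < j" "m = j - Suc k" by auto
    have "int (j - Suc k) * (if j = 0 then 0 else d (j - 1)) \<le> b j - b (Suc k)" using Suc(1)[OF k(2)] k by auto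
    moreover have "d (j - 1) \<le> d k" using mono[of k "j - 1"] k ij by auto
    moreover have "j - k = Suc (j - Suc k)" using k by simp
    then have "int (j - k) * d (j - 1) = int (j - Suc k) * d (j - 1) + d (j - 1)" by (simp add: algebra_simps)
    moreover have "b (Suc k) - b k = d k" using d[of k] k ij by simp
    moreover have "(if j = 0 then 0 else d (j - 1)) = d (j - 1)" using k by simp
    ultimately show ?case by (simp only:)
  qed simp
  then show "int (j - i) * (if j = 0 then 0 else d (j - 1)) \<le> b j - b i" using ij(1) .
qed

text \<open>The floor and the ceiling of \<open>S / 2\<close> lie on a common edge of the polygon \<open>i * S + T \<ge> b i\<close>.\<close>

lemma split_narrow:
  fixes b :: "nat \<Rightarrow> int" and S T D :: int
  assumes dec: "\<And>i. i < n \<Longrightarrow> d (Suc i) \<le> d i" and d: "\<And>i. i < n \<Longrightarrow> b (Suc i) - b i = d i" "d n = 0"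
    and b: "\<And>i. i \<le> n \<Longrightarrow> 2 * b i \<le> int i * S + T" and S: "0 \<le> S" "S < 2 * D"
  shows "\<exists>S' T'. 0 \<le> S' \<and> S' \<le> D \<and> 0 \<le> S - S' \<and> S - S' \<le> D \<and>
     (\<forall>i\<le>n. b i \<le> int i * S' + T' \<and> b i \<le> int i * (S - S') + (T - T'))"
proof -
  define S' where "S' = S div 2"
  have S': "0 \<le> S'" "S' \<le> D" "S' \<le> S - S'" "S - S' \<le> D" "S - S' \<le> S' + 1" using S unfolding S'_def by auto
  have ex: "d n \<le> S'" using d(2) S' by simp
  \<comment> \<open>Edge \<open>k\<close> of the polygon spans the values of \<open>S\<close> from
    \<open>d k\<close> to \<open>d (k - 1)\<close>, without upper end for \<open>k = 0\<close>. It
    contains both halves, which are among \<open>S'\<close> and \<open>S' + 1\<close>;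
    \<open>d n = 0\<close> makes such a \<open>k\<close> exist.\<close>
  define k where "k = (LEAST k. d k \<le> S')"
  have k: "d k \<le> S'" "k \<le> n" unfolding k_def using ex by (auto intro: LeastI Least_le)
  have mvertex: "S' < d (k - 1)" if "0 < k" using not_less_Least[of "k - 1" "\<lambda>k. d k \<le> S'"] that unfolding k_def by auto
  have opt: "b i \<le> b k + (int i - int k) * X" if i: "i \<le> n" and X: "S' \<le> X" "X \<le> S' + 1" for i X
  proof (cases "k \<le> i")
    case True
    have "b i - b k \<le> int (i - k) * d k" using decreasing_chain(1)[of n d b k i] dec d True i by blast
    also have "\<dots> \<le> int (i - k) * X" using k X by (intro mult_left_mono) auto
    finally show ?thesis using True by (simp add: of_nat_diff)
  next
    case False
    have "int (k - i) * (if k = 0 then 0 else d (k - 1)) \<le> b k - b i"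
      using decreasing_chain(2)[of n d b i k] dec d False k by auto
    moreover have "int (k - i) * X \<le> int (k - i) * d (k - 1)" using mvertex X False by (intro mult_left_mono) auto
    moreover have "(if k = 0 then 0 else d (k - 1)) = d (k - 1)" using False by simp
    ultimately have "int (k - i) * X \<le> b k - b i" by (simp only:)
    then show ?thesis using False by (simp add: of_nat_diff algebra_simps)
  qed
  \<comment> \<open>The first summand is placed on edge \<open>k\<close> itself; the doubled
    inequality for \<open>k\<close> then puts the second one on or above that edge.\<close>
  let ?T' = "b k - int k * S'"
  have "b i \<le> int i * S' + ?T' \<and> b i \<le> int i * (S - S') + (T - ?T')" if i: "i \<le> n" for i
    using opt[OF i, of S'] opt[OF i, of "S - S'"] S' b[OF k(2)] by (simp add: algebra_simps)
  then show ?thesis using S' by (intro exI[of _ S'] exI[of _ ?T']) auto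
qed

lemma ip_chain_ray: "2 \<le> l \<Longrightarrow> ip l m (chain_ray l i) = int i * (\<Sum>j=1..l-1. m j) + m l"
proof -
  assume l: "2 \<le> l"
  have "ip l m (chain_ray l i) = int i * (\<Sum>j=1..l-1. ip l m (e j)) + ip l m (e l)"
  proof -
    have "chain_ray l i = (\<lambda>k. int i * (\<Sum>j=1..l-1. e j) k) + e l" by (simp add: chain_ray_def int_sum_apply)
    then show ?thesis by (simp only: ip_add_right ip_smult_right ip_sum_right)
  qed
  also have "(\<Sum>j=1..l-1. ip l m (e j)) = (\<Sum>j=1..l-1. m j)" by (rule sum.cong) (auto simp: ip_e)
  finally show ?thesis using l ip_e[of l l m] by simp
qed

lemma ip_final_ray: "2 \<le> l \<Longrightarrow> ip l m (final_ray l) = m 1 + 2 * (\<Sum>j=2..l-1. m j) + 2 * m l"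
proof -
  assume l: "2 \<le> l"
  have "(\<Sum>j=2..l. ip l m (e j)) = (\<Sum>j=2..l. m j)" by (rule sum.cong) (auto simp: ip_e)
  moreover have "{2..l} = insert l {2..l-1}" "{1..l-1} = insert 1 {2..l-1}" using l by auto
  ultimately show ?thesis unfolding final_ray_def ip_add_right ip_sum_right ip_chain_ray[OF l] using l by simp
qed

lemma sum_first: "2 \<le> l \<Longrightarrow> (\<Sum>j=1..l-1. m j) = (m (1::nat) :: int) + (\<Sum>j=2..l-1. m j)"
proof -
  assume l: "2 \<le> l"
  then have "{1..l-1} = insert 1 {2..l-1}" by auto
  then show ?thesis by simp
qed

text \<open>The heights define a polyhedron by \<open>h r \<le> ip l m r\<close>. Nefness is taken
  in the form that the vertices belonging to three kinds of maximal cones satisfy all its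
  inequalities.\<close>

locale nef_heights =
  fixes l n :: nat and h :: "(nat \<Rightarrow> int) \<Rightarrow> int"
  assumes l: "2 \<le> l" and n: "1 \<le> n"
    and nef_chain: "\<And>i. 1 \<le> i \<Longrightarrow> i < n \<Longrightarrow> \<exists>m. (\<forall>r\<in>insert (chain_ray l i) (insert (chain_ray l (Suc i)) (e ` {2..l-1})). ip l m r = h r) \<and>
      (\<forall>r\<in>rays l n. h r \<le> ip l m r)"
    and nef_last: "\<exists>m. (\<forall>r\<in>insert (chain_ray l n) (e ` {1..l-1}). ip l m r = h r) \<and> (\<forall>r\<in>rays l n. h r \<le> ip l m r)"
    and nef_new: "\<exists>m. (\<forall>r\<in>insert (final_ray l) (e ` {2..l}). ip l m r = h r) \<and> (\<forall>r\<in>rays l n. h r \<le> ip l m r)"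

locale nef_heights_normalized = nef_heights +
  assumes h_e: "\<And>j. 1 \<le> j \<Longrightarrow> j \<le> l \<Longrightarrow> h (e j) = 0"
begin

definition b where "b i = h (chain_ray l i)"
definition c where "c = h (final_ray l)"
text \<open>\<open>d i\<close> is the coordinate \<open>S\<close> of the vertex between the edges
  \<open>i\<close> and \<open>i + 1\<close> of the polygon. The value 0 from \<open>n\<close> on is
  the end of edge \<open>n\<close> on the axis \<open>S = 0\<close>.\<close>

definition d where "d i = (if i < n then b (Suc i) - b i else 0)"

lemma b0: "b 0 = 0" unfolding b_def chain_ray_0 using h_e l by simp

lemma in_rays:
  shows "i \<le> n \<Longrightarrow> chain_ray l i \<in> rays l n"
    and "1 \<le> j \<Longrightarrow> j \<le> l \<Longrightarrow> e j \<in> rays l n"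
    and "final_ray l \<in> rays l n"
proof -
  show "chain_ray l i \<in> rays l n" if "i \<le> n"
  proof (cases "i = 0")
    case True
    then show ?thesis using chain_ray_0[of l] l unfolding rays_def by auto
  next
    case False
    then show ?thesis using that unfolding rays_def by auto
  qed
qed (auto simp: rays_def)

text \<open>The vertex of the cone has \<open>m 1 = d i\<close>,
  \<open>m l = b i - int i * d i\<close> and zeros elsewhere. The claims are its inequalities at
  \<open>e 1\<close>, at the following chain ray if there is one, and at the final ray.\<close>

lemma chain_facts:
  assumes i: "1 \<le> i" "i < n"
  shows "0 \<le> d i" "d (Suc i) \<le> d i" "i = 1 \<Longrightarrow> c \<le> 2 * b 1 - d 1"
proof -
  obtain m where m: "\<And>r. r \<in> insert (chain_ray l i) (insert (chain_ray l (Suc i)) (e ` {2..l-1})) \<Longrightarrow> ip l m r = h r"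
      "\<And>r. r \<in> rays l n \<Longrightarrow> h r \<le> ip l m r" using nef_chain[OF i] by blast
  have z: "m j = 0" if "2 \<le> j" "j \<le> l - 1" for j
    using m(1)[of "e j"] ip_e[of j l m] h_e[of j] that by auto
  then have s0: "(\<Sum>j=2..l-1. m j) = 0" by simp
  have S: "(\<Sum>j=1..l-1. m j) = m 1" unfolding sum_first[OF l] s0 by simp
  have e1: "int i * m 1 + m l = b i" "int (Suc i) * m 1 + m l = b (Suc i)"
    using m(1)[of "chain_ray l i"] m(1)[of "chain_ray l (Suc i)"] unfolding ip_chain_ray[OF l] S b_def by auto
  then have m1: "m 1 = d i" unfolding d_def using i by (simp add: algebra_simps)
  show d0: "0 \<le> d i" using m(2)[OF in_rays(2)[of 1]] ip_e[of 1 l m] h_e[of 1] l m1 by simp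
  show "d (Suc i) \<le> d i"
  proof (cases "Suc i < n")
    case True
    then have "b (Suc (Suc i)) \<le> int (Suc (Suc i)) * m 1 + m l"
      using m(2)[OF in_rays(1)[of "Suc (Suc i)"]] unfolding ip_chain_ray[OF l] S b_def by simp
    then show ?thesis using e1 m1 True unfolding d_def by (simp add: algebra_simps)
  qed (use d0 in \<open>simp add: d_def\<close>)
  show "c \<le> 2 * b 1 - d 1" if "i = 1"
    using m(2)[OF in_rays(3)] e1 m1 that unfolding ip_final_ray[OF l] s0 c_def by simp
qed

text \<open>The vertex of the cone at \<open>chain_ray l n\<close> has last coordinate
  \<open>b n\<close> and zeros elsewhere; that of the cone at the final ray has first coordinate
  \<open>c\<close> and zeros elsewhere.\<close>

lemma facts:
  shows "i < n \<Longrightarrow> d (Suc i) \<le> d i" "0 \<le> d 1" "b 1 \<le> c" "c \<le> 2 * b 1 - d 1"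
proof -
  obtain m where m: "\<And>r. r \<in> insert (chain_ray l n) (e ` {1..l-1}) \<Longrightarrow> ip l m r = h r"
      "\<And>r. r \<in> rays l n \<Longrightarrow> h r \<le> ip l m r" using nef_last by blast
  have z: "m j = 0" if "1 \<le> j" "j \<le> l - 1" for j
    using m(1)[of "e j"] ip_e[of j l m] h_e[of j] that by auto
  then have s0: "(\<Sum>j=1..l-1. m j) = 0" "(\<Sum>j=2..l-1. m j) = 0" "m 1 = 0" using l by auto
  have ml: "m l = b n" using m(1)[of "chain_ray l n"] unfolding ip_chain_ray[OF l] s0 b_def by simp
  have cn: "c \<le> 2 * b n" using m(2)[OF in_rays(3)] unfolding ip_final_ray[OF l] s0 c_def ml by simp
  obtain m' where m': "\<And>r. r \<in> insert (final_ray l) (e ` {2..l}) \<Longrightarrow> ip l m' r = h r"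
      "\<And>r. r \<in> rays l n \<Longrightarrow> h r \<le> ip l m' r" using nef_new by blast
  have z': "m' j = 0" if "2 \<le> j" "j \<le> l" for j
    using m'(1)[of "e j"] ip_e[of j l m'] h_e[of j] that by auto
  then have s0': "(\<Sum>j=2..l-1. m' j) = 0" "m' l = 0" using l by (auto intro!: sum.neutral)
  have m1': "m' 1 = c" using m'(1)[of "final_ray l"] unfolding ip_final_ray[OF l] s0' c_def by simp
  show bc: "b 1 \<le> c"
    using m'(2)[OF in_rays(1)[OF n]] unfolding ip_chain_ray[OF l] sum_first[OF l] s0' b_def m1' by simp
  have dn: "d 1 = 0" if "n = 1" unfolding d_def using that by simp
  have n1: "1 < n" if "n \<noteq> 1" using n that by simp
  show d1: "0 \<le> d 1" using chain_facts(1)[of 1] n1 dn by (cases "n = 1") auto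
  show cd: "c \<le> 2 * b 1 - d 1"
    using chain_facts(3)[of 1] n1 cn dn by (cases "n = 1") auto
  show "d (Suc i) \<le> d i" if "i < n"
  proof (cases "i = 0")
    case True
    \<comment> \<open>The vertex between the edges 0 and 1 is cut off by the final blow-up, so
      \<open>d 1 \<le> d 0\<close> comes from the two bounds on \<open>c\<close>.\<close>
    have "d 0 = b 1" using n b0 unfolding d_def by simp
    then show ?thesis using True bc cd by simp
  qed (use chain_facts(2) that in simp)
qed

lemma decompose_normalized:
  assumes M: "M \<in> lattice_vecs l" "\<And>r. r \<in> rays l n \<Longrightarrow> 2 * h r \<le> ip l M r"
  shows "\<exists>m\<in>lattice_vecs l. \<forall>r\<in>rays l n. h r \<le> ip l m r \<and> h r \<le> ip l (M - m) r"
proof -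
  let ?J = "{2..l-1}"
  define R where "R = (\<Sum>j\<in>?J. M j)"
  define S where "S = M 1 + R"
  have Mj: "0 \<le> M j" if "1 \<le> j" "j \<le> l" for j
    using M(2)[OF in_rays(2)[OF that]] ip_e[OF that, of M] h_e[OF that] by simp
  have R0: "0 \<le> R" unfolding R_def by (rule sum_nonneg) (use Mj in auto)
  have Mb: "2 * b i \<le> int i * S + M l" if "i \<le> n" for i
    using M(2)[OF in_rays(1)[OF that]] unfolding ip_chain_ray[OF l] sum_first[OF l] S_def R_def b_def .
  have Mc: "2 * c \<le> M 1 + 2 * R + 2 * M l"
    using M(2)[OF in_rays(3)] unfolding ip_final_ray[OF l] c_def R_def by simp
  \<comment> \<open>The inequalities of the chain rays and the final ray involve only the first
    coordinate, the sum of the middle ones and the last coordinate; a prescribed middle sum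
    \<open>R'\<close> is realised by \<open>split_sum\<close>.\<close>
  have reduce: ?thesis
    if t: "0 \<le> A'" "A' \<le> M 1" "0 \<le> R'" "R' \<le> R" "0 \<le> T'" "T' \<le> M l"
      "\<And>i. 1 \<le> i \<Longrightarrow> i \<le> n \<Longrightarrow> b i \<le> int i * (A' + R') + T' \<and> b i \<le> int i * (S - (A' + R')) + (M l - T')"
      "c \<le> A' + 2 * R' + 2 * T'" "c \<le> (M 1 - A') + 2 * (R - R') + 2 * (M l - T')" for A' R' T'
  proof -
    obtain f where f: "\<And>j. j \<in> ?J \<Longrightarrow> 0 \<le> f j \<and> f j \<le> M j" "sum f ?J = R'"
    proof -
      have "0 \<le> M j" if "j \<in> ?J" for j using Mj[of j] that by auto
      then have "\<exists>f. (\<forall>j\<in>?J. 0 \<le> f j \<and> f j \<le> M j) \<and> sum f ?J = R'"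
        using t(3,4) unfolding R_def by (intro split_sum) auto
      then show thesis using that by blast
    qed
    define m where "m j = (if j = 1 then A' else if j = l then T' else if j \<in> ?J then f j else 0)" for j
    have mv: "m 1 = A'" "m l = T'" "(\<Sum>j\<in>?J. m j) = R'"
      using l f(2) by (auto simp: m_def intro!: sum.cong)
    have Mm: "(M - m) 1 = M 1 - A'" "(M - m) l = M l - T'" "(\<Sum>j\<in>?J. (M - m) j) = R - R'"
      using mv by (auto simp: R_def sum_subtractf)
    have "h r \<le> ip l m r \<and> h r \<le> ip l (M - m) r" if "r \<in> rays l n" for r
    proof -
      from that consider j where "1 \<le> j" "j \<le> l" "r = e j" | i where "1 \<le> i" "i \<le> n" "r = chain_ray l i" | "r = final_ray l"
        unfolding rays_def by auto
      then show ?thesis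
      proof cases
        case 1
        then show ?thesis using h_e[OF 1(1,2)] ip_e[OF 1(1,2)] t f(1)[of j]
          by (auto simp: m_def)
      next
        case 2
        then show ?thesis using t(7)[OF 2(1,2)] unfolding 2(3) ip_chain_ray[OF l] sum_first[OF l] Mm mv b_def[symmetric] S_def
          by (simp add: algebra_simps)
      next
        case 3
        then show ?thesis using t(8,9) unfolding 3 ip_final_ray[OF l] Mm mv c_def[symmetric] by simp
      qed
    qed
    moreover have "m \<in> lattice_vecs l" using l by (auto simp: m_def lattice_vecs_def)
    ultimately show ?thesis by blast
  qed
  show ?thesis
  proof (cases "S < 2 * d 1")
    case True
    \<comment> \<open>For \<open>n = 1\<close> the threshold \<open>d 1\<close> is 0 and this case
      is void, so \<open>chain_ray l 2\<close> is available.\<close>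
    have "n \<noteq> 1" using True Mj[of 1] R0 l unfolding S_def d_def by auto
    then have n2: "2 \<le> n" using n by simp
    then have b2: "b 2 = b 1 + d 1" unfolding d_def by (simp add: numeral_2_eq_2)
    have "0 \<le> S" unfolding S_def using Mj[of 1] R0 l by simp
    then obtain S' T' where st: "0 \<le> S'" "S' \<le> d 1" "0 \<le> S - S'" "S - S' \<le> d 1"
     "\<And>i. i \<le> n \<Longrightarrow> b i \<le> int i * S' + T' \<and> b i \<le> int i * (S - S') + (M l - T')"
      using split_narrow[of n d b S "M l" "d 1"] facts(1) Mb True unfolding d_def by auto
    obtain A' where A': "0 \<le> A'" "A' \<le> M 1" "0 \<le> S' - A'" "S' - A' \<le> R"
    proof
      show "0 \<le> min S' (M 1)" "min S' (M 1) \<le> M 1" "0 \<le> S' - min S' (M 1)" "S' - min S' (M 1) \<le> R"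
        using st R0 Mj[of 1] l unfolding S_def by (auto simp: min_def)
    qed
    have T0: "0 \<le> T'" "T' \<le> M l" using st(5)[of 0] b0 by auto
    have "b 1 + d 1 \<le> 2 * S' + T'" "b 1 + d 1 \<le> 2 * (S - S') + (M l - T')"
      using st(5)[OF n2] b2 by simp_all
    \<comment> \<open>Here \<open>chain_ray l 2\<close> implies the last inequality: \<open>X + 2 *
      Y \<ge> 2 * b 1 + 2 * d 1 - 3 * X \<ge> 2 * b 1 - d 1 \<ge> c\<close>.\<close>
    moreover have "c \<le> X + 2 * Y" if "b 1 + d 1 \<le> 2 * X + Y" "X \<le> d 1" for X Y using that facts(4) by linarith
    ultimately have "c \<le> S' + 2 * T'" "c \<le> (S - S') + 2 * (M l - T')" using st(2,4) by blast+
    then have c: "c \<le> A' + 2 * (S' - A') + 2 * T'" "c \<le> (M 1 - A') + 2 * (R - (S' - A')) + 2 * (M l - T')"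
    proof -
      have "c \<le> A' + 2 * X + 2 * Y" if "c \<le> A' + X + 2 * Y" "0 \<le> X" for A' X Y :: int using that by linarith
      then have *: "c \<le> A' + 2 * X + 2 * Y" if "c \<le> Z + 2 * Y" "0 \<le> X" "Z = A' + X" for A' X Y Z :: int using that by blast
      show "c \<le> A' + 2 * (S' - A') + 2 * T'"
        by (rule *[OF \<open>c \<le> S' + 2 * T'\<close> A'(3)]) simp
      show "c \<le> (M 1 - A') + 2 * (R - (S' - A')) + 2 * (M l - T')"
        by (rule *[OF \<open>c \<le> (S - S') + 2 * (M l - T')\<close>]) (use A' in \<open>auto simp: S_def\<close>)
    qed
    show ?thesis by (rule reduce[OF A' T0 _ c]) (use st(5) in simp)
  next
    case False
    obtain A' S' U' where *: "0 \<le> A'" "A' \<le> M 1" "0 \<le> S' - A'" "S' - A' \<le> S - M 1" "d 1 \<le> S'" "d 1 \<le> S - S'"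
     "S' \<le> U'" "S - S' \<le> (S + M l) - U'" "b 1 \<le> U'" "b 1 \<le> (S + M l) - U'"
     "c \<le> 2 * U' - A'" "c \<le> 2 * ((S + M l) - U') - (M 1 - A')"
      using split_wide[of "M 1" S "S + M l" "d 1" "b 1" c] Mj[of 1] Mj[of l] R0 l False Mb[OF n] Mc facts(2-4)
      unfolding S_def by auto
    have T: "0 \<le> U' - S'" "U' - S' \<le> M l" using * by auto
    \<comment> \<open>From \<open>X = d 1\<close> on, concavity of \<open>b\<close> makes the
      inequality of \<open>chain_ray l 1\<close> imply those of all later chain rays.\<close>
    have bi: "b i \<le> int i * X + Y" if i: "1 \<le> i" "i \<le> n" and X: "d 1 \<le> X" "b 1 \<le> X + Y" for i X Y
    proof -
      have "b i - b 1 \<le> int (i - 1) * d 1"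
        by (rule decreasing_chain(1)[of n d b 1 i]) (use facts(1) i in \<open>auto simp: d_def\<close>)
      also have "\<dots> \<le> int (i - 1) * X" using X by (intro mult_left_mono) auto
      finally show ?thesis using X i by (simp add: of_nat_diff algebra_simps)
    qed
    have "b i \<le> int i * (A' + (S' - A')) + (U' - S') \<and>
        b i \<le> int i * (S - (A' + (S' - A'))) + (M l - (U' - S'))" if i: "1 \<le> i" "i \<le> n" for i
      using bi[OF i, of S' "U' - S'"] bi[OF i, of "S - S'" "M l - (U' - S')"] * by simp
    moreover have "c \<le> A' + 2 * (S' - A') + 2 * (U' - S')"
      "c \<le> (M 1 - A') + 2 * (R - (S' - A')) + 2 * (M l - (U' - S'))" "S' - A' \<le> R"
      using * unfolding S_def by auto
    ultimately show ?thesis using reduce[OF *(1,2,3) _ T] by blast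
  qed
qed

end

context nef_heights
begin

text \<open>Translation by the lattice point whose coordinates are the heights of the
  \<open>e j\<close> reduces to the normalized case; the doubled polyhedron is translated by twice
  that point.\<close>

lemma decompose:
  assumes M: "M \<in> lattice_vecs l" "\<And>r. r \<in> rays l n \<Longrightarrow> 2 * h r \<le> ip l M r"
  shows "\<exists>m\<in>lattice_vecs l. \<forall>r\<in>rays l n. h r \<le> ip l m r \<and> h r \<le> ip l (M - m) r"
proof -
  define a where "a j = (if 1 \<le> j \<and> j \<le> l then h (e j) else 0)" for j
  have aL: "a \<in> lattice_vecs l" by (auto simp: a_def lattice_vecs_def)
  interpret N: nef_heights_normalized l n "\<lambda>r. h r - ip l a r"
  proof
    show "h (e j) - ip l a (e j) = 0" if "1 \<le> j" "j \<le> l" for j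
      unfolding ip_e[OF that] a_def using that by simp
    have shift: "\<exists>m'. (\<forall>r\<in>X. ip l m' r = h r - ip l a r) \<and> (\<forall>r\<in>rays l n. h r - ip l a r \<le> ip l m' r)"
      if ex: "\<exists>m. (\<forall>r\<in>X. ip l m r = h r) \<and> (\<forall>r\<in>rays l n. h r \<le> ip l m r)" for X
    proof -
      obtain m where "\<forall>r\<in>X. ip l m r = h r" "\<forall>r\<in>rays l n. h r \<le> ip l m r" using ex by blast
      then show ?thesis by (intro exI[of _ "m - a"]) (auto simp: ip_diff_left)
    qed
    show "\<exists>m. (\<forall>r\<in>insert (chain_ray l i) (insert (chain_ray l (Suc i)) (e ` {2..l-1})). ip l m r = h r - ip l a r) \<and>
      (\<forall>r\<in>rays l n. h r - ip l a r \<le> ip l m r)" if "1 \<le> i" "i < n" for i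
      by (rule shift[OF nef_chain[OF that]])
    show "\<exists>m. (\<forall>r\<in>insert (chain_ray l n) (e ` {1..l-1}). ip l m r = h r - ip l a r) \<and> (\<forall>r\<in>rays l n. h r - ip l a r \<le> ip l m r)"
      by (rule shift[OF nef_last])
    show "\<exists>m. (\<forall>r\<in>insert (final_ray l) (e ` {2..l}). ip l m r = h r - ip l a r) \<and> (\<forall>r\<in>rays l n. h r - ip l a r \<le> ip l m r)"
      by (rule shift[OF nef_new])
  qed (rule l n)+
  define M' where "M' = M - a - a"
  have ipM': "ip l M' r = ip l M r - 2 * ip l a r" for r unfolding M'_def ip_diff_left by simp
  have M'L: "M' \<in> lattice_vecs l" unfolding M'_def using M(1) aL by (intro lattice_vecs_closed)
  have "\<exists>m\<in>lattice_vecs l. \<forall>r\<in>rays l n. h r - ip l a r \<le> ip l m r \<and> h r - ip l a r \<le> ip l (M' - m) r"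
    by (rule N.decompose_normalized[OF M'L]) (use M(2) in \<open>simp add: ipM'\<close>)
  then obtain m where m: "m \<in> lattice_vecs l" "\<forall>r\<in>rays l n. h r - ip l a r \<le> ip l m r \<and>
      h r - ip l a r \<le> ip l (M' - m) r" by blast
  show ?thesis
    by (rule bexI[of _ "m + a"]) (use m aL in \<open>auto simp: ip_diff_left ip_add_left ipM'\<close>)
qed

end


section \<open>Charts of a smooth toric variety\<close>

definition dual_vec :: "nat \<Rightarrow> (nat \<Rightarrow> int) set \<Rightarrow> (nat \<Rightarrow> int) \<Rightarrow> nat \<Rightarrow> int" where
  "dual_vec l B = (SOME d. dual_basis l B d)"

lemma dual_vec: "is_basis l B \<Longrightarrow> dual_basis l B (dual_vec l B)"
  unfolding is_basis_def dual_vec_def by (rule someI_ex[of "dual_basis l B"])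

text \<open>At \<open>x = 0\<close> the law fails for opposite nonzero exponents, since
  \<open>0 powi 0 = 1\<close> and all other powers of 0 are 0; hence the sign condition
  there.\<close>

lemma power_int_add_nonneg: "(x::complex) \<noteq> 0 \<or> (0 \<le> a \<and> 0 \<le> b) \<Longrightarrow> x powi (a + b) = x powi a * x powi b"
  by (cases "x = 0 \<and> a + b = 0") (auto simp: power_int_add add_nonneg_eq_0_iff)

type_synonym coords = "(nat \<Rightarrow> int) \<Rightarrow> complex"

context smooth_complex
begin

definition Bs where "Bs = {B \<in> K. is_basis l B}"

text \<open>A basis \<open>B\<close> of the lattice identifies the chart of \<open>cone_of B\<close> with \<open>\<complex>\<^sup>B\<close>, the coordinate of index
  \<open>b\<close> being the character of the dual vector of \<open>b\<close>; coordinates outside \<open>B\<close> are ignored. The open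
  subset belonging to \<open>A \<subseteq> B\<close> is the locus \<open>nz_off B A\<close>.\<close>

definition chi :: "(nat \<Rightarrow> int) set \<Rightarrow> (nat \<Rightarrow> int) \<Rightarrow> coords \<Rightarrow> complex" where
  "chi B m z = (\<Prod>b\<in>B. z b powi ip l m b)"

definition nz_off :: "(nat \<Rightarrow> int) set \<Rightarrow> (nat \<Rightarrow> int) set \<Rightarrow> coords \<Rightarrow> bool" where
  "nz_off B A z \<longleftrightarrow> (\<forall>b\<in>B - A. z b \<noteq> 0)"

text \<open>The point of the chart of \<open>cone_of A\<close> with coordinates \<open>z\<close>
  relative to \<open>B\<close>, a semigroup homomorphism where \<open>nz_off B A z\<close> holds.
  \<open>A\<close> may also be a cone not contained in \<open>B\<close>.\<close>

definition affine_pt :: "(nat \<Rightarrow> int) set \<Rightarrow> (nat \<Rightarrow> int) set \<Rightarrow> coords \<Rightarrow> affine_point" where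
  "affine_pt B A z = (\<lambda>m. if m \<in> dual_monoid l (cone_of A) then chi B m z else 0)"

definition dpts :: "(nat \<Rightarrow> int) set \<Rightarrow> (nat \<Rightarrow> int) set" where
  "dpts A = dual_monoid l (cone_of A)"

lemma dpts_iff: "A \<in> K \<Longrightarrow> m \<in> dpts A \<longleftrightarrow> m \<in> lattice_vecs l \<and> (\<forall>a\<in>A. 0 \<le> ip l m a)"
  unfolding dpts_def by (subst dual_monoid_cone) (auto simp: fin)

lemma BsD:
  assumes "B \<in> Bs"
  shows "B \<in> K" "finite B" "dual_basis l B (dual_vec l B)"
  using assms dual_vec fin unfolding Bs_def by auto

lemma Bs_dual_vec:
  assumes "B \<in> Bs"
  shows "b \<in> B \<Longrightarrow> dual_vec l B b \<in> lattice_vecs l"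
    "b \<in> B \<Longrightarrow> b' \<in> B \<Longrightarrow> ip l (dual_vec l B b) b' = (if b = b' then 1 else 0)"
    "m \<in> lattice_vecs l \<Longrightarrow> m = (\<Sum>b\<in>B. (\<lambda>j. ip l m b * dual_vec l B b j))"
  using dual_basisD[OF BsD(3)[OF assms]] by blast+

lemma extend_Bs: "A \<in> K \<Longrightarrow> \<exists>B\<in>Bs. A \<subseteq> B"
  using extend unfolding Bs_def by blast

lemma ip_eq_basis:
  assumes "B \<in> Bs" "m \<in> lattice_vecs l" "m' \<in> lattice_vecs l" "\<And>b. b \<in> B \<Longrightarrow> ip l m b = ip l m' b"
  shows "m = m'"
proof -
  have "m = (\<Sum>b\<in>B. (\<lambda>j. ip l m b * dual_vec l B b j))" by (rule Bs_dual_vec(3)[OF assms(1,2)])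
  also have "\<dots> = (\<Sum>b\<in>B. (\<lambda>j. ip l m' b * dual_vec l B b j))" by (rule sum.cong) (use assms(4) in auto)
  also have "\<dots> = m'" by (rule Bs_dual_vec(3)[OF assms(1,3), symmetric])
  finally show ?thesis .
qed

lemma dpts_mono: "A \<in> K \<Longrightarrow> A' \<subseteq> A \<Longrightarrow> m \<in> dpts A \<Longrightarrow> m \<in> dpts A'"
  using dpts_iff[of A] dpts_iff[of A'] down by blast

lemma dual_vec_dm: "B \<in> Bs \<Longrightarrow> A \<subseteq> B \<Longrightarrow> b \<in> B \<Longrightarrow> dual_vec l B b \<in> dpts A"
proof -
  assume *: "B \<in> Bs" "A \<subseteq> B" "b \<in> B"
  then have "A \<in> K" using down BsD by blast
  moreover have "0 \<le> ip l (dual_vec l B b) a" if "a \<in> A" for a using Bs_dual_vec(2)[OF *(1,3), of a] that *(2) by auto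
  ultimately show ?thesis using dpts_iff Bs_dual_vec(1)[OF *(1,3)] by blast
qed

lemma chi_cong: "(\<And>b. b \<in> B \<Longrightarrow> z b = z' b) \<Longrightarrow> chi B m z = chi B m z'"
  unfolding chi_def by (rule prod.cong) auto

lemma chi_0 [simp]: "chi B 0 z = 1" "chi B (\<lambda>_. 0) z = 1"
  by (simp_all add: chi_def ip_def)

lemma chi_add:
  assumes "\<And>b. b \<in> B \<Longrightarrow> z b \<noteq> 0 \<or> (0 \<le> ip l m b \<and> 0 \<le> ip l m' b)"
  shows "chi B (m + m') z = chi B m z * chi B m' z"
  unfolding chi_def prod.distrib[symmetric]
  by (rule prod.cong) (use assms in \<open>auto simp: ip_add_left intro!: power_int_add_nonneg\<close>)

lemma chi_add_dm:
  assumes "A \<in> K" "nz_off B A z" "m \<in> dpts A" "m' \<in> dpts A"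
  shows "chi B (m + m') z = chi B m z * chi B m' z"
  using assms dpts_iff[OF assms(1)] by (intro chi_add) (auto simp: nz_off_def)

lemma chi_dl: "B \<in> Bs \<Longrightarrow> b \<in> B \<Longrightarrow> chi B (dual_vec l B b) z = z b"
proof -
  assume B: "B \<in> Bs" "b \<in> B"
  have "chi B (dual_vec l B b) z = (\<Prod>b'\<in>B. if b' = b then z b else 1)"
    unfolding chi_def by (rule prod.cong) (auto simp: Bs_dual_vec(2)[OF B])
  then show ?thesis using B BsD(2)[OF B(1)] by simp
qed

lemma affine_pt_eq: "m \<in> dpts A \<Longrightarrow> affine_pt B A z m = chi B m z"
  unfolding affine_pt_def dpts_def by simp

lemma dpts_add: "m \<in> dpts A \<Longrightarrow> m' \<in> dpts A \<Longrightarrow> m + m' \<in> dpts A"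
  unfolding dpts_def dual_monoid_def pairing_def
  by (auto simp: distrib_right sum.distrib intro!: add_nonneg_nonneg)

lemma dpts_zero: "0 \<in> dpts A"
  unfolding dpts_def dual_monoid_def pairing_def by auto

lemma affine_pt_affine:
  assumes "A \<in> K" "nz_off B A z"
  shows "affine_pt B A z \<in> affine_points l (cone_of A)"
  unfolding affine_points_def dpts_def[symmetric]
proof (rule CollectI, intro conjI ballI allI impI)
  show "affine_pt B A z 0 = 1" using affine_pt_eq[OF dpts_zero] by simp
  show "affine_pt B A z (m + m') = affine_pt B A z m * affine_pt B A z m'" if "m \<in> dpts A" "m' \<in> dpts A" for m m'
    using affine_pt_eq[OF dpts_add[OF that]] affine_pt_eq[OF that(1)] affine_pt_eq[OF that(2)] chi_add_dm[OF assms that] by simp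
  show "affine_pt B A z m = 0" if "m \<notin> dpts A" for m using that unfolding affine_pt_def dpts_def by simp
qed

lemma affineD:
  assumes "u \<in> affine_points l (cone_of A)"
  shows "u 0 = 1" "m \<in> dpts A \<Longrightarrow> m' \<in> dpts A \<Longrightarrow> u (m + m') = u m * u m'" "m \<notin> dpts A \<Longrightarrow> u m = 0"
  using assms unfolding affine_points_def dpts_def by auto

text \<open>A homomorphism is determined by its values on the dual basis. For \<open>b\<close>
  outside \<open>A\<close> the monoid also contains \<open>- dual_vec l B b\<close>, so these values
  are invertible.\<close>

lemma point_coords:
  assumes B: "B \<in> Bs" and A: "A \<subseteq> B" and u: "u \<in> affine_points l (cone_of A)"
    and z: "\<And>b. b \<in> B \<Longrightarrow> z b = u (dual_vec l B b)"
  shows "nz_off B A z" "u = affine_pt B A z"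
proof -
  have AK: "A \<in> K" using A B BsD(1) down by blast
  note uD = affineD[OF u]
  have neg: "- dual_vec l B b \<in> dpts A" if b: "b \<in> B" "b \<notin> A" for b
  proof -
    have "0 \<le> ip l (- dual_vec l B b) a" if "a \<in> A" for a
      using Bs_dual_vec(2)[OF B b(1), of a] that A b(2) by (auto simp: ip_uminus_left)
    then show ?thesis using dpts_iff[OF AK] Bs_dual_vec(1)[OF B b(1)] by simp
  qed
  have inv: "u (dual_vec l B b) * u (- dual_vec l B b) = 1" if "b \<in> B" "b \<notin> A" for b
    using uD(2)[OF dual_vec_dm[OF B A that(1)] neg[OF that]] uD(1) by simp
  then show nz_off: "nz_off B A z" unfolding nz_off_def using z by (metis DiffE mult_zero_left zero_neq_one)
  have mult_dpts: "(\<lambda>j. int n * v j) \<in> dpts A \<and> u (\<lambda>j. int n * v j) = u v ^ n" if v: "v \<in> dpts A" for v n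
  proof (induction n)
    case 0
    have "(\<lambda>j. int 0 * v j) = 0" by (auto simp: fun_eq_iff)
    then show ?case using dpts_zero uD(1) by simp
  next
    case (Suc n)
    have "(\<lambda>j. int (Suc n) * v j) = v + (\<lambda>j. int n * v j)" by (auto simp: fun_eq_iff algebra_simps)
    then show ?case using Suc uD(2)[OF v] dpts_add[OF v] by simp
  qed
  \<comment> \<open>Negative multiples occur only for \<open>b\<close> outside \<open>A\<close>,
    where the negative of the dual vector lies in the monoid.\<close>
  have pw: "(\<lambda>j. k * dual_vec l B b j) \<in> dpts A \<and> u (\<lambda>j. k * dual_vec l B b j) = z b powi k"
    if b: "b \<in> B" "b \<in> A \<Longrightarrow> 0 \<le> k" for b k
  proof (cases "0 \<le> k")
    case True
    then show ?thesis using mult_dpts[OF dual_vec_dm[OF B A b(1)], of "nat k"] z[OF b(1)] by (simp add: power_int_def)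
  next
    case False
    then have bA: "b \<notin> A" using b by blast
    have "u (- dual_vec l B b) = inverse (z b)" using inv[OF b(1) bA] z[OF b(1)] by (metis inverse_unique)
    moreover have "(\<lambda>j. k * dual_vec l B b j) = (\<lambda>j. int (nat (- k)) * (- dual_vec l B b) j)" using False by (auto simp: fun_eq_iff)
    ultimately show ?thesis using mult_dpts[OF neg[OF b(1) bA], of "nat (- k)"] False
      by (simp add: power_int_def)
  qed
  have "u m = chi B m z" if m: "m \<in> dpts A" for m
  proof -
    have part: "(\<Sum>b\<in>S. (\<lambda>j. ip l m b * dual_vec l B b j)) \<in> dpts A \<and>
        u (\<Sum>b\<in>S. (\<lambda>j. ip l m b * dual_vec l B b j)) = (\<Prod>b\<in>S. z b powi ip l m b)" if "finite S" "S \<subseteq> B" for S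
      using that
    proof (induction S)
      case empty
      then show ?case unfolding sum.empty prod.empty using dpts_zero uD(1) by blast
    next
      case (insert b S)
      have "b \<in> A \<Longrightarrow> 0 \<le> ip l m b" using m dpts_iff[OF AK] by blast
      then have t: "(\<lambda>j. ip l m b * dual_vec l B b j) \<in> dpts A" "u (\<lambda>j. ip l m b * dual_vec l B b j) = z b powi ip l m b"
        using pw[of b "ip l m b"] insert by auto
      have s: "(\<Sum>b\<in>S. (\<lambda>j. ip l m b * dual_vec l B b j)) \<in> dpts A"
        "u (\<Sum>b\<in>S. (\<lambda>j. ip l m b * dual_vec l B b j)) = (\<Prod>b\<in>S. z b powi ip l m b)" using insert by auto
      show ?case
        unfolding sum.insert[OF insert(1,2)] prod.insert[OF insert(1,2)]
        using dpts_add[OF t(1) s(1)] unfolding uD(2)[OF t(1) s(1)] t(2) s(2) by blast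
    qed
    have "m \<in> lattice_vecs l" using m dpts_iff[OF AK] by blast
    from Bs_dual_vec(3)[OF B this] part[OF BsD(2)[OF B] subset_refl] show ?thesis
      unfolding chi_def by simp
  qed
  then show "u = affine_pt B A z"
    using uD(3) unfolding affine_pt_def dpts_def[symmetric] by auto
qed

section \<open>Gluing of the charts\<close>

definition \<Delta> where "\<Delta> = cone_of ` K"

lemma affine_pt_restrict: "A \<in> K \<Longrightarrow> A' \<subseteq> A \<Longrightarrow> m \<in> dpts A \<Longrightarrow> affine_pt B A z m = affine_pt B A' z m"
  using affine_pt_eq dpts_mono by metis

lemma glueI:
  assumes "A1 \<in> K" "A2 \<in> K" "nz_off B A1 z" "nz_off B A2 z"
  shows "((cone_of A1, affine_pt B A1 z), (cone_of A2, affine_pt B A2 z)) \<in> glue_rel l \<Delta>"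
proof -
  have K: "A1 \<inter> A2 \<in> K" using down[OF assms(1)] by blast
  have "nz_off B (A1 \<inter> A2) z" using assms(3,4) unfolding nz_off_def by blast
  then have w: "affine_pt B (A1 \<inter> A2) z \<in> affine_points l (cone_of A1 \<inter> cone_of A2)"
    using affine_pt_affine[OF K] cone_Int[OF assms(1,2)] by simp
  have "\<forall>m\<in>dual_monoid l (cone_of A1). affine_pt B A1 z m = affine_pt B (A1 \<inter> A2) z m"
    "\<forall>m\<in>dual_monoid l (cone_of A2). affine_pt B A2 z m = affine_pt B (A1 \<inter> A2) z m"
    using affine_pt_restrict[OF assms(1), of "A1 \<inter> A2"] affine_pt_restrict[OF assms(2), of "A1 \<inter> A2"] unfolding dpts_def by blast+
  then have "\<exists>w\<in>affine_points l (cone_of A1 \<inter> cone_of A2).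
      (\<forall>m\<in>dual_monoid l (cone_of A1). affine_pt B A1 z m = w m) \<and> (\<forall>m\<in>dual_monoid l (cone_of A2). affine_pt B A2 z m = w m)"
    using w by blast
  then show ?thesis
    unfolding glue_rel_def \<Delta>_def using assms(1,2) affine_pt_affine[OF assms(1,3)] affine_pt_affine[OF assms(2,4)] by blast
qed

text \<open>The coordinates in \<open>B\<close> can be read off from the common restriction to
  \<open>cone_of (A \<inter> A')\<close>, so glued points have the same \<open>z\<close>.\<close>

lemma glueD:
  assumes B: "B \<in> Bs" and A: "A \<subseteq> B" "A' \<in> K"
    and g: "((cone_of A, affine_pt B A z), (cone_of A', u')) \<in> glue_rel l \<Delta>"
  shows "nz_off B A' z" "u' = affine_pt B A' z"
proof -
  have AK: "A \<in> K" using A B BsD(1) down by blast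
  have IK: "A \<inter> A' \<in> K" "A \<inter> A' \<subseteq> B" using down[OF AK] A by blast+
  obtain w where w: "w \<in> affine_points l (cone_of (A \<inter> A'))" "\<And>m. m \<in> dpts A \<Longrightarrow> affine_pt B A z m = w m"
     "\<And>m. m \<in> dpts A' \<Longrightarrow> u' m = w m" and u': "u' \<in> affine_points l (cone_of A')"
    using g cone_Int[OF AK A(2)] unfolding glue_rel_def dpts_def by auto
  have z: "z b = w (dual_vec l B b)" if "b \<in> B" for b
    using w(2)[OF dual_vec_dm[OF B A(1) that]] affine_pt_eq[OF dual_vec_dm[OF B A(1) that]] chi_dl[OF B that] by simp
  note pc = point_coords[OF B IK(2) w(1) z]
  show "nz_off B A' z" using pc(1) unfolding nz_off_def by blast
  show "u' = affine_pt B A' z"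
  proof
    fix m
    show "u' m = affine_pt B A' z m"
    proof (cases "m \<in> dpts A'")
      case True
      then have "u' m = affine_pt B (A \<inter> A') z m" using w(3) pc(2) by metis
      also have "\<dots> = affine_pt B A' z m" using affine_pt_restrict[OF A(2) _ True, of "A \<inter> A'"] by auto
      finally show ?thesis .
    next
      case False
      then show ?thesis using affineD(3)[OF u' False] unfolding affine_pt_def dpts_def by simp
    qed
  qed
qed

lemma glue_sym: "sym (glue_rel l \<Delta>)"
  unfolding sym_def glue_rel_def by (auto simp: Int_commute)

lemma glue_equiv: "equiv (SIGMA \<sigma>:\<Delta>. affine_points l \<sigma>) (glue_rel l \<Delta>)"
proof (rule equivI)
  show "glue_rel l \<Delta> \<subseteq> (SIGMA \<sigma>:\<Delta>. affine_points l \<sigma>) \<times> (SIGMA \<sigma>:\<Delta>. affine_points l \<sigma>)"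
    unfolding glue_rel_def by auto
  show "refl_on (SIGMA \<sigma>:\<Delta>. affine_points l \<sigma>) (glue_rel l \<Delta>)"
    unfolding refl_on_def glue_rel_def by auto
  show "sym (glue_rel l \<Delta>)" by (rule glue_sym)
  show "Relation.trans (glue_rel l \<Delta>)"
  proof (rule transI)
    fix x y w assume xy: "(x, y) \<in> glue_rel l \<Delta>" and yw: "(y, w) \<in> glue_rel l \<Delta>"
    obtain A1 A2 A3 u1 u2 u3 where A: "A1 \<in> K" "A2 \<in> K" "A3 \<in> K" "x = (cone_of A1, u1)" "y = (cone_of A2, u2)"
      "w = (cone_of A3, u3)" "u2 \<in> affine_points l (cone_of A2)"
      using xy yw unfolding glue_rel_def \<Delta>_def by auto
    \<comment> \<open>Coordinates in a basis containing the middle cone describe all three points by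
      one \<open>z\<close>.\<close>
    obtain B where B: "B \<in> Bs" "A2 \<subseteq> B" using extend_Bs A by blast
    define z where "z b = u2 (dual_vec l B b)" for b
    have u2: "u2 = affine_pt B A2 z" by (rule point_coords[OF B A(7)]) (simp add: z_def)
    have "(y, x) \<in> glue_rel l \<Delta>" using xy glue_sym unfolding sym_def by blast
    then have 1: "nz_off B A1 z" "u1 = affine_pt B A1 z" using glueD[OF B A(1)] A u2 by auto
    have 2: "nz_off B A3 z" "u3 = affine_pt B A3 z" using yw glueD[OF B A(3)] A u2 by auto
    show "(x, w) \<in> glue_rel l \<Delta>" using glueI[OF A(1,3) 1(1) 2(1)] A 1 2 by simp
  qed
qed

definition chart_pt :: "(nat \<Rightarrow> int) set \<Rightarrow> coords \<Rightarrow> toric_point" where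
  "chart_pt B z = chart l \<Delta> (cone_of B) (affine_pt B B z)"

lemma nz_off_refl [simp]: "nz_off B B z"
  unfolding nz_off_def by simp

lemma chart_eq_iff:
  assumes "A \<in> K" "A' \<in> K" "u \<in> affine_points l (cone_of A)" "u' \<in> affine_points l (cone_of A')"
  shows "chart l \<Delta> (cone_of A) u = chart l \<Delta> (cone_of A') u' \<longleftrightarrow> ((cone_of A, u), (cone_of A', u')) \<in> glue_rel l \<Delta>"
  unfolding chart_def using assms by (intro eq_equiv_class_iff[OF glue_equiv]) (auto simp: \<Delta>_def)

lemma chart_pt_eq_chart:
  assumes B: "B \<in> Bs" and A: "A \<in> K" "u \<in> affine_points l (cone_of A)"
  shows "chart_pt B z = chart l \<Delta> (cone_of A) u \<longleftrightarrow> nz_off B A z \<and> u = affine_pt B A z"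
proof -
  note BK = BsD(1)[OF B]
  have "chart_pt B z = chart l \<Delta> (cone_of A) u \<longleftrightarrow> ((cone_of B, affine_pt B B z), (cone_of A, u)) \<in> glue_rel l \<Delta>"
    unfolding chart_pt_def by (rule chart_eq_iff[OF BK A(1) affine_pt_affine[OF BK] A(2)]) simp
  also have "\<dots> \<longleftrightarrow> nz_off B A z \<and> u = affine_pt B A z"
    using glueD[OF B subset_refl A(1), of z u] glueI[OF BK A(1), of B z] by auto
  finally show ?thesis .
qed

lemma chart_pt_point: "B \<in> Bs \<Longrightarrow> chart_pt B z \<in> toric_points l \<Delta>"
  unfolding chart_pt_def chart_def toric_points_def
  using BsD(1) affine_pt_affine[of B B z] by (intro quotientI) (auto simp: \<Delta>_def)

lemma points_chart_pt:
  assumes "x \<in> toric_points l \<Delta>"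
  shows "\<exists>B\<in>Bs. \<exists>z. x = chart_pt B z"
proof -
  obtain A u where A: "A \<in> K" "u \<in> affine_points l (cone_of A)" "x = chart l \<Delta> (cone_of A) u"
    using assms unfolding toric_points_def chart_def \<Delta>_def by (auto elim!: quotientE)
  obtain B where B: "B \<in> Bs" "A \<subseteq> B" using extend_Bs A by blast
  define z where "z b = u (dual_vec l B b)" for b
  have "nz_off B A z" "u = affine_pt B A z" by (rule point_coords[OF B A(2)]; simp add: z_def)+
  then have "chart_pt B z = x" using chart_pt_eq_chart[OF B(1) A(1,2)] A(3) by simp
  then show ?thesis using B(1) by blast
qed

text \<open>The change of coordinates from the chart of \<open>B\<close> to that of
  \<open>B'\<close>, meaningful where \<open>nz_off B B' z\<close>. Coordinates outside
  \<open>B'\<close> get the default 0.\<close>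

definition T :: "(nat \<Rightarrow> int) set \<Rightarrow> (nat \<Rightarrow> int) set \<Rightarrow> coords \<Rightarrow> coords" where
  "T B B' z = (\<lambda>b. if b \<in> B' then chi B (dual_vec l B' b) z else 0)"

text \<open>Both sides evaluate the character at the same point \<open>affine_pt B A z\<close>,
  whose coordinates in \<open>B'\<close> are \<open>T B B' z\<close>.\<close>

lemma chi_T:
  assumes B: "B \<in> Bs" "B' \<in> Bs" and A: "A \<subseteq> B'" "nz_off B A z" and m: "m \<in> dpts A"
  shows "chi B' m (T B B' z) = chi B m z" "nz_off B' A (T B B' z)"
proof -
  have AK: "A \<in> K" using A B BsD(1) down by blast
  have u: "affine_pt B A z \<in> affine_points l (cone_of A)" by (rule affine_pt_affine[OF AK A(2)])
  have t: "T B B' z b = affine_pt B A z (dual_vec l B' b)" if "b \<in> B'" for b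
    unfolding T_def using affine_pt_eq[OF dual_vec_dm[OF B(2) A(1) that]] that by simp
  note pc = point_coords[OF B(2) A(1) u t]
  show "nz_off B' A (T B B' z)" by (rule pc(1))
  show "chi B' m (T B B' z) = chi B m z" using pc(2) affine_pt_eq[OF m] by metis
qed

lemma affine_pt_T:
  assumes B: "B \<in> Bs" "B' \<in> Bs" and z: "nz_off B B' z"
  shows "affine_pt B' B' (T B B' z) = affine_pt B B' z"
proof
  fix m
  show "affine_pt B' B' (T B B' z) m = affine_pt B B' z m"
    using chi_T(1)[OF B subset_refl z, of m] unfolding affine_pt_def dpts_def by simp
qed

lemma chart_pt_T: "B \<in> Bs \<Longrightarrow> B' \<in> Bs \<Longrightarrow> nz_off B B' z \<Longrightarrow> chart_pt B' (T B B' z) = chart_pt B z"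
  using chart_pt_eq_chart[of B B' "affine_pt B B' z" z] affine_pt_T[of B B' z] BsD(1)[of B'] affine_pt_affine[of B' B z] unfolding chart_pt_def by auto

lemma affine_pt_inj: "B \<in> Bs \<Longrightarrow> affine_pt B B z = affine_pt B B z' \<Longrightarrow> b \<in> B \<Longrightarrow> z b = z' b"
  using chi_dl affine_pt_eq[OF dual_vec_dm[OF _ subset_refl]] by metis

lemma chart_pt_eq:
  assumes B: "B \<in> Bs" "B' \<in> Bs" and eq: "chart_pt B z = chart_pt B' z'"
  shows "nz_off B B' z" "\<And>b. b \<in> B' \<Longrightarrow> z' b = T B B' z b"
proof -
  have *: "nz_off B B' z \<and> affine_pt B' B' z' = affine_pt B B' z"
    using chart_pt_eq_chart[OF B(1) BsD(1)[OF B(2)] affine_pt_affine[OF BsD(1)[OF B(2)] nz_off_refl, of z'], of z] eq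
    unfolding chart_pt_def by simp
  then show nz_off: "nz_off B B' z" by blast
  show "z' b = T B B' z b" if "b \<in> B'" for b
    by (rule affine_pt_inj[OF B(2) _ that]) (use * affine_pt_T[OF B nz_off] in simp)
qed

lemma chart_pt_inj: "B \<in> Bs \<Longrightarrow> chart_pt B z = chart_pt B z' \<Longrightarrow> b \<in> B \<Longrightarrow> z b = z' b"
  using chart_pt_eq(2)[of B B z z' b] unfolding T_def by (simp add: chi_dl)

section \<open>Coordinate rings\<close>

text \<open>Its nonvanishing locus is the overlap of the chart of \<open>B\<close> with that of
  \<open>A\<close>, so functions on the overlap are polynomials divided by powers of it.\<close>

definition off_prod :: "(nat \<Rightarrow> int) set \<Rightarrow> (nat \<Rightarrow> int) set \<Rightarrow> coords \<Rightarrow> complex" where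
  "off_prod B A z = (\<Prod>b\<in>B - A. z b)"

lemma off_prod_PF: "off_prod B A \<in> PF B"
proof -
  have "off_prod B A = (\<Prod>b\<in>B - A. (\<lambda>z. z b))" by (auto simp: off_prod_def fun_eq_iff fun_prod_apply)
  also have "\<dots> \<in> PF B" by (intro PF_prod) auto
  finally show ?thesis .
qed

lemma off_prod_nz: "B \<in> Bs \<Longrightarrow> off_prod B A z \<noteq> 0 \<longleftrightarrow> nz_off B A z"
  unfolding off_prod_def nz_off_def using BsD(2) by auto

text \<open>A negative exponent of the character can occur only at \<open>b\<close> outside
  \<open>A\<close>, and those coordinates are the factors of \<open>off_prod B A\<close>.\<close>

lemma chi_clear:
  assumes B: "B \<in> Bs" and A: "A \<in> K" and m: "m \<in> dpts A" and N: "\<And>b. b \<in> B \<Longrightarrow> - ip l m b \<le> int N"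
  shows "\<exists>p\<in>PF B. \<forall>z. nz_off B A z \<longrightarrow> p z = chi B m z * off_prod B A z ^ N"
proof -
  define k where "k b = nat (ip l m b + (if b \<in> A then 0 else int N))" for b
  define p where "p = (\<Prod>b\<in>B. (\<lambda>z::coords. z b) ^ k b)"
  have "p \<in> PF B" unfolding p_def by (intro PF_prod PF_power) auto
  moreover have "p z = chi B m z * off_prod B A z ^ N" if z: "nz_off B A z" for z
  proof -
    have "off_prod B A z ^ N = (\<Prod>b\<in>B. if b \<in> A then 1 else z b ^ N)"
      unfolding off_prod_def prod_power_distrib
      by (rule prod.mono_neutral_cong_left) (use BsD(2)[OF B] in auto)
    then have "chi B m z * off_prod B A z ^ N = (\<Prod>b\<in>B. z b powi ip l m b * (if b \<in> A then 1 else z b ^ N))"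
      unfolding chi_def by (simp add: prod.distrib)
    also have "\<dots> = (\<Prod>b\<in>B. z b ^ k b)"
    proof (rule prod.cong[OF refl])
      fix b assume b: "b \<in> B"
      show "z b powi ip l m b * (if b \<in> A then 1 else z b ^ N) = z b ^ k b"
      proof (cases "b \<in> A")
        case True
        then have "0 \<le> ip l m b" using m dpts_iff[OF A] by blast
        then show ?thesis using True by (simp add: k_def power_int_def)
      next
        case False
        then have zb: "z b \<noteq> 0" using z b unfolding nz_off_def by blast
        have "0 \<le> ip l m b + int N" using N[OF b] by simp
        then have "z b ^ k b = z b powi (ip l m b + int N)" using False by (simp add: k_def power_int_def)
        also have "\<dots> = z b powi ip l m b * z b ^ N" using zb by (simp add: power_int_add)
        finally show ?thesis using False by simp
      qed
    qed
    also have "\<dots> = p z" unfolding p_def by (simp add: fun_prod_apply fun_power_apply)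
    finally show ?thesis ..
  qed
  ultimately show ?thesis by blast
qed

lemma coordinate_ring_fraction:
  assumes B: "B \<in> Bs" and A: "A \<in> K" and f: "f \<in> coordinate_ring l (cone_of A)"
  shows "\<exists>p\<in>PF B. \<exists>N. \<forall>z. nz_off B A z \<longrightarrow> f (affine_pt B A z) = p z / off_prod B A z ^ N"
proof -
  obtain F c where F: "finite F" "F \<subseteq> dpts A" "f = (\<lambda>u. \<Sum>m\<in>F. c m * u m)"
    using f unfolding coordinate_ring_def dpts_def by blast
  define N where "N = nat (\<Sum>m\<in>F. \<Sum>b\<in>B. \<bar>ip l m b\<bar>)"
  have N: "- ip l m b \<le> int N" if "m \<in> F" "b \<in> B" for m b
  proof -
    have "\<bar>ip l m b\<bar> \<le> (\<Sum>b\<in>B. \<bar>ip l m b\<bar>)" by (rule member_le_sum) (use that BsD(2)[OF B] in auto)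
    also have "\<dots> \<le> (\<Sum>m\<in>F. \<Sum>b\<in>B. \<bar>ip l m b\<bar>)"
      by (rule member_le_sum[of m F "\<lambda>m. \<Sum>b\<in>B. \<bar>ip l m b\<bar>"]) (use that F in \<open>auto intro: sum_nonneg\<close>)
    finally show ?thesis unfolding N_def by linarith
  qed
  have "\<forall>m\<in>F. \<exists>p\<in>PF B. \<forall>z. nz_off B A z \<longrightarrow> p z = chi B m z * off_prod B A z ^ N"
    using chi_clear[OF B A] F(2) N by blast
  then obtain p where p: "\<And>m. m \<in> F \<Longrightarrow> p m \<in> PF B" "\<And>m z. m \<in> F \<Longrightarrow> nz_off B A z \<Longrightarrow> p m z = chi B m z * off_prod B A z ^ N"
    by metis
  define P where "P = (\<Sum>m\<in>F. (\<lambda>_. c m) * p m)"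
  have "P \<in> PF B" unfolding P_def using p(1) by (intro PF_sum PF.mult PF.const)
  moreover have "f (affine_pt B A z) = P z / off_prod B A z ^ N" if z: "nz_off B A z" for z
  proof -
    have "P z = (\<Sum>m\<in>F. c m * p m z)" unfolding P_def by (simp add: fun_sum_apply)
    also have "\<dots> = (\<Sum>m\<in>F. c m * affine_pt B A z m) * off_prod B A z ^ N"
      unfolding sum_distrib_right by (rule sum.cong) (use p(2) z F(2) affine_pt_eq in auto)
    finally show ?thesis using F(3) off_prod_nz[OF B] z by simp
  qed
  ultimately show ?thesis by blast
qed

lemma PF_expand:
  assumes B: "B \<in> Bs" and p: "p \<in> PF B"
  shows "\<exists>F c. finite F \<and> F \<subseteq> dpts B \<and> (\<forall>z. p z = (\<Sum>m\<in>F. c m * chi B m z))"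
  using p
proof induction
  case (const c)
  show ?case by (rule exI[of _ "{0}"], rule exI[of _ "\<lambda>_. c"]) (simp add: dpts_zero)
next
  case (var b)
  show ?case
    by (rule exI[of _ "{dual_vec l B b}"], rule exI[of _ "\<lambda>_. 1"])
      (use chi_dl[OF B var] dual_vec_dm[OF B subset_refl var] in simp)
next
  case (add f g)
  then obtain F c G d where *: "finite F" "F \<subseteq> dpts B" "\<forall>z. f z = (\<Sum>m\<in>F. c m * chi B m z)"
    "finite G" "G \<subseteq> dpts B" "\<forall>z. g z = (\<Sum>m\<in>G. d m * chi B m z)" by blast
  have "(f + g) z = (\<Sum>m\<in>F \<union> G. ((if m \<in> F then c m else 0) + (if m \<in> G then d m else 0)) * chi B m z)" for z
  proof -
    have "(\<Sum>m\<in>F. c m * chi B m z) = (\<Sum>m\<in>F \<union> G. (if m \<in> F then c m else 0) * chi B m z)"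
      by (rule sum.mono_neutral_cong_left) (use * in auto)
    moreover have "(\<Sum>m\<in>G. d m * chi B m z) = (\<Sum>m\<in>F \<union> G. (if m \<in> G then d m else 0) * chi B m z)"
      by (rule sum.mono_neutral_cong_left) (use * in auto)
    ultimately show ?thesis using * by (simp add: distrib_right sum.distrib)
  qed
  then show ?case using *(1,2,4,5)
    by (intro exI[of _ "F \<union> G"] exI[of _ "\<lambda>m. (if m \<in> F then c m else 0) + (if m \<in> G then d m else 0)"]) blast
next
  case (mult f g)
  then obtain F c G d where *: "finite F" "F \<subseteq> dpts B" "\<forall>z. f z = (\<Sum>m\<in>F. c m * chi B m z)"
    "finite G" "G \<subseteq> dpts B" "\<forall>z. g z = (\<Sum>m\<in>G. d m * chi B m z)" by blast
  let ?s = "\<lambda>(m, m'). m + m' :: nat \<Rightarrow> int"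
  define C where "C k = (\<Sum>x\<in>{x \<in> F \<times> G. ?s x = k}. c (fst x) * d (snd x))" for k
  have "(f * g) z = (\<Sum>k\<in>?s ` (F \<times> G). C k * chi B k z)" for z
  proof -
    have "(f * g) z = (\<Sum>x\<in>F \<times> G. (c (fst x) * chi B (fst x) z) * (d (snd x) * chi B (snd x) z))"
      using * by (simp add: sum_product sum.cartesian_product split_def)
    also have "\<dots> = (\<Sum>x\<in>F \<times> G. c (fst x) * d (snd x) * chi B (?s x) z)"
    proof (rule sum.cong[OF refl])
      fix x assume "x \<in> F \<times> G"
      then have "fst x \<in> dpts B" "snd x \<in> dpts B" using * by auto
      from chi_add_dm[OF BsD(1)[OF B] nz_off_refl this]
      show "(c (fst x) * chi B (fst x) z) * (d (snd x) * chi B (snd x) z) = c (fst x) * d (snd x) * chi B (?s x) z"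
        by (simp add: split_def)
    qed
    also have "\<dots> = (\<Sum>k\<in>?s ` (F \<times> G). \<Sum>x\<in>{x \<in> F \<times> G. ?s x = k}. c (fst x) * d (snd x) * chi B (?s x) z)"
      by (rule sum.image_gen) (use * in auto)
    also have "\<dots> = (\<Sum>k\<in>?s ` (F \<times> G). C k * chi B k z)"
      unfolding C_def sum_distrib_right by (intro sum.cong) auto
    finally show ?thesis .
  qed
  moreover have "a + b \<in> dpts B" if "a \<in> F" "b \<in> G" for a b
    by (rule dpts_add) (use that * in auto)
  then have "?s ` (F \<times> G) \<subseteq> dpts B" by auto
  moreover have "finite (?s ` (F \<times> G))" using * by auto
  ultimately show ?case by blast
qed

lemma PF_coordinate_ring:
  assumes B: "B \<in> Bs" and p: "p \<in> PF B"
  shows "\<exists>f\<in>coordinate_ring l (cone_of B). \<forall>z. f (affine_pt B B z) = p z"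
proof -
  obtain F c where F: "finite F" "F \<subseteq> dpts B" "\<forall>z. p z = (\<Sum>m\<in>F. c m * chi B m z)"
    using PF_expand[OF assms] by blast
  have "(\<lambda>u. \<Sum>m\<in>F. c m * u m) \<in> coordinate_ring l (cone_of B)"
    unfolding coordinate_ring_def using F(1,2) unfolding dpts_def by blast
  moreover have "(\<Sum>m\<in>F. c m * affine_pt B B z m) = p z" for z
    unfolding F(3)[rule_format] by (rule sum.cong) (use F(2) affine_pt_eq in auto)
  ultimately show ?thesis by (intro bexI[of _ "\<lambda>u. \<Sum>m\<in>F. c m * u m"]) auto
qed

lemma chi_PF: "B \<in> Bs \<Longrightarrow> m \<in> dpts B \<Longrightarrow> chi B m \<in> PF B"
proof -
  assume B: "B \<in> Bs" "m \<in> dpts B"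
  have "- ip l m b \<le> int 0" if "b \<in> B" for b using B dpts_iff[OF BsD(1)[OF B(1)]] that by auto
  then obtain p where "p \<in> PF B" "\<forall>z. p z = chi B m z"
    using chi_clear[OF B(1) BsD(1)[OF B(1)] B(2), of 0] by auto
  moreover from this have "p = chi B m" by blast
  ultimately show ?thesis by simp
qed

lemma PF_T:
  assumes B: "B \<in> Bs" "B' \<in> Bs" and p: "p \<in> PF B'"
  shows "\<exists>q\<in>PF B. \<exists>N. \<forall>z. nz_off B B' z \<longrightarrow> p (T B B' z) = q z / off_prod B B' z ^ N"
proof -
  obtain f where f: "f \<in> coordinate_ring l (cone_of B')" "\<And>z. f (affine_pt B' B' z) = p z"
    using PF_coordinate_ring[OF B(2) p] by blast
  obtain q N where q: "q \<in> PF B" "\<forall>z. nz_off B B' z \<longrightarrow> f (affine_pt B B' z) = q z / off_prod B B' z ^ N"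
    using coordinate_ring_fraction[OF B(1) BsD(1)[OF B(2)] f(1)] by blast
  have "p (T B B' z) = q z / off_prod B B' z ^ N" if "nz_off B B' z" for z
    using q(2) that f(2)[of "T B B' z"] affine_pt_T[OF B that] by simp
  then show ?thesis using q(1) by blast
qed

section \<open>Topology and regular functions in the charts\<close>

abbreviation X where "X \<equiv> toric_topology l \<Delta>"
abbreviation \<O> where "\<O> \<equiv> toric_regular l \<Delta>"

definition pull :: "(nat \<Rightarrow> int) set \<Rightarrow> toric_point set \<Rightarrow> coords set" where
  "pull B W = {z. chart_pt B z \<in> W}"

text \<open>Only the generating open sets need work: lying on the overlap and having a nonzero value
  there combine into the nonvanishing of one polynomial.\<close>

lemma open_pull:
  assumes B: "B \<in> Bs" and W: "openin X W"
  shows "zopen B (pull B W)"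
proof -
  have "generate_topology_on {chart l \<Delta> \<sigma> ` {u \<in> affine_points l \<sigma>. f u \<noteq> 0} | \<sigma> f. \<sigma> \<in> \<Delta> \<and> f \<in> coordinate_ring l \<sigma>} W"
    using W unfolding toric_topology_def openin_topology_generated_by_iff .
  then show ?thesis
  proof induction
    case Empty
    then show ?case by (simp add: pull_def zopen_def)
  next
    case (Int a b)
    have "pull B (a \<inter> b) = pull B a \<inter> pull B b" by (auto simp: pull_def)
    then show ?case using zopen_Int Int by metis
  next
    case (UN K')
    have "pull B (\<Union>K') = (\<Union>k\<in>K'. pull B k)" by (auto simp: pull_def)
    moreover have "zopen B (\<Union>k\<in>K'. pull B k)"
      unfolding zopen_def
    proof
      fix z assume "z \<in> (\<Union>k\<in>K'. pull B k)"
      then obtain k where k: "k \<in> K'" "z \<in> pull B k" by blast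
      obtain q where "q \<in> PF B" "q z \<noteq> 0" "\<And>y. q y \<noteq> 0 \<Longrightarrow> y \<in> pull B k"
        using zopenE[OF UN(2)[OF k(1)] k(2)] by blast
      then show "\<exists>q\<in>PF B. q z \<noteq> 0 \<and> (\<forall>y. q y \<noteq> 0 \<longrightarrow> y \<in> (\<Union>k\<in>K'. pull B k))" using k by blast
    qed
    ultimately show ?case by simp
  next
    case (Basis s)
    then obtain A f where A: "A \<in> K" "f \<in> coordinate_ring l (cone_of A)"
      "s = chart l \<Delta> (cone_of A) ` {u \<in> affine_points l (cone_of A). f u \<noteq> 0}" unfolding \<Delta>_def by blast
    obtain p N where p: "p \<in> PF B" "\<forall>z. nz_off B A z \<longrightarrow> f (affine_pt B A z) = p z / off_prod B A z ^ N"
      using coordinate_ring_fraction[OF B A(1,2)] by blast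
    have 1: "chart_pt B z \<in> s \<longleftrightarrow> nz_off B A z \<and> f (affine_pt B A z) \<noteq> 0" for z
      using chart_pt_eq_chart[OF B A(1), of _ z] affine_pt_affine[OF A(1), of B z] unfolding A(3) by auto
    have 2: "nz_off B A z \<and> f (affine_pt B A z) \<noteq> 0 \<longleftrightarrow> (p * off_prod B A) z \<noteq> 0" for z
      using p(2) off_prod_nz[OF B, of A z] by auto
    have "pull B s = {z. (p * off_prod B A) z \<noteq> 0}" unfolding pull_def 1 2 ..
    moreover have "p * off_prod B A \<in> PF B" using p(1) off_prod_PF by (intro PF.mult)
    ultimately show ?case using zopen_D by metis
  qed
qed

lemma open_push:
  assumes B: "B \<in> Bs" and q: "q \<in> PF B"
  shows "openin X (chart_pt B ` {z. q z \<noteq> 0})"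
proof -
  obtain f where f: "f \<in> coordinate_ring l (cone_of B)" "\<And>z. f (affine_pt B B z) = q z"
    using PF_coordinate_ring[OF B q] by blast
  note BK = BsD(1)[OF B]
  have "chart_pt B ` {z. q z \<noteq> 0} = chart l \<Delta> (cone_of B) ` {u \<in> affine_points l (cone_of B). f u \<noteq> 0}"
  proof (intro equalityI subsetI)
    fix x assume "x \<in> chart_pt B ` {z. q z \<noteq> 0}"
    then show "x \<in> chart l \<Delta> (cone_of B) ` {u \<in> affine_points l (cone_of B). f u \<noteq> 0}"
      unfolding chart_pt_def using f(2) affine_pt_affine[OF BK nz_off_refl] by auto
  next
    fix x assume "x \<in> chart l \<Delta> (cone_of B) ` {u \<in> affine_points l (cone_of B). f u \<noteq> 0}"
    then obtain u where u: "u \<in> affine_points l (cone_of B)" "f u \<noteq> 0" "x = chart l \<Delta> (cone_of B) u" by blast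
    have "u = affine_pt B B (\<lambda>b. u (dual_vec l B b))" by (rule point_coords[OF B subset_refl u(1)]) simp
    then show "x \<in> chart_pt B ` {z. q z \<noteq> 0}" unfolding chart_pt_def using f(2) u by (metis (mono_tags, lifting) imageI mem_Collect_eq)
  qed
  then show ?thesis
    unfolding toric_topology_def using BK f(1) by (intro topology_generated_by_Basis) (auto simp: \<Delta>_def)
qed

lemma regular_pull:
  assumes B: "B \<in> Bs" and f: "f \<in> \<O> U"
  shows "zreg B (pull B U) (\<lambda>z. f (chart_pt B z))"
  unfolding zreg_def
proof
  fix z assume "z \<in> pull B U"
  then have "chart_pt B z \<in> U" unfolding pull_def by simp
  from bspec[OF CollectD[OF f[unfolded toric_regular_def]] this]
  obtain \<sigma> p q V where *: "\<sigma> \<in> \<Delta>" "p \<in> coordinate_ring l \<sigma>" "q \<in> coordinate_ring l \<sigma>" "openin X V"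
    "chart_pt B z \<in> V" "V \<subseteq> U" "V \<subseteq> chart l \<Delta> \<sigma> ` affine_points l \<sigma>"
    "\<forall>u\<in>affine_points l \<sigma>. chart l \<Delta> \<sigma> u \<in> V \<longrightarrow> q u \<noteq> 0 \<and> f (chart l \<Delta> \<sigma> u) = p u / q u"
    by (elim bexE exE conjE) (rule that)
  obtain A where A: "A \<in> K" "\<sigma> = cone_of A" using *(1) unfolding \<Delta>_def by blast
  have V: "nz_off B A y \<and> q (affine_pt B A y) \<noteq> 0 \<and> f (chart_pt B y) = p (affine_pt B A y) / q (affine_pt B A y) \<and> chart_pt B y \<in> U" if y: "chart_pt B y \<in> V" for y
  proof -
    obtain u where u: "u \<in> affine_points l (cone_of A)" "chart_pt B y = chart l \<Delta> (cone_of A) u"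
      using *(7) y A(2) by blast
    then have "nz_off B A y" "u = affine_pt B A y" using chart_pt_eq_chart[OF B A(1) u(1)] by auto
    then show ?thesis using *(8) u y A(2) *(6) by auto
  qed
  obtain p' N where p': "p' \<in> PF B" "\<forall>z. nz_off B A z \<longrightarrow> p (affine_pt B A z) = p' z / off_prod B A z ^ N"
    using coordinate_ring_fraction[OF B A(1)] *(2) A(2) by blast
  obtain q' M where q': "q' \<in> PF B" "\<forall>z. nz_off B A z \<longrightarrow> q (affine_pt B A z) = q' z / off_prod B A z ^ M"
    using coordinate_ring_fraction[OF B A(1)] *(3) A(2) by blast
  have "z \<in> pull B V" using *(5) unfolding pull_def by simp
  then obtain r where r: "r \<in> PF B" "r z \<noteq> 0" "\<And>y. r y \<noteq> 0 \<Longrightarrow> y \<in> pull B V"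
    using zopenE[OF open_pull[OF B *(4)]] by blast
  \<comment> \<open>The factor \<open>r\<close> confines the points to \<open>V\<close>, where the
    local fraction is valid; the powers of \<open>off_prod\<close> clear the denominators of the two
    pulled back functions.\<close>
  let ?n = "p' * off_prod B A ^ M * r" and ?d = "q' * off_prod B A ^ N * r"
  have eq: "y \<in> pull B U \<and> f (chart_pt B y) = ?n y / ?d y" if y: "r y \<noteq> 0" for y
  proof -
    have v: "chart_pt B y \<in> V" using r(3)[OF y] unfolding pull_def by simp
    note vy = V[OF v]
    have "off_prod B A y \<noteq> 0" using off_prod_nz[OF B] vy by blast
    then show ?thesis using vy p'(2) q'(2) y unfolding pull_def
      by (auto simp: fun_power_apply field_simps)
  qed
  have "q' z \<noteq> 0" "off_prod B A z \<noteq> 0" using V[OF *(5)] q'(2) off_prod_nz[OF B, of A z] by auto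
  then have dz: "?d z \<noteq> 0" using r(2) by (simp add: fun_power_apply)
  have mem: "?n \<in> PF B" "?d \<in> PF B" by (intro PF.mult PF_power p'(1) q'(1) r(1) off_prod_PF)+
  have rep: "y \<in> pull B U \<and> f (chart_pt B y) = ?n y / ?d y" if "?d y \<noteq> 0" for y
    using eq[of y] that by auto
  show "\<exists>p\<in>PF B. \<exists>q\<in>PF B. q z \<noteq> 0 \<and> (\<forall>y. q y \<noteq> 0 \<longrightarrow> y \<in> pull B U \<and> f (chart_pt B y) = p y / q y)"
    by (rule bexI[OF _ mem(1)], rule bexI[OF _ mem(2)]) (use dz rep in blast)
qed

lemma regular_push:
  assumes U: "U \<subseteq> toric_points l \<Delta>" and f: "\<And>B. B \<in> Bs \<Longrightarrow> zreg B (pull B U) (\<lambda>z. f (chart_pt B z))"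
  shows "f \<in> \<O> U"
  unfolding toric_regular_def
proof (rule CollectI, rule ballI)
  fix x assume x: "x \<in> U"
  then obtain B z where B: "B \<in> Bs" "x = chart_pt B z" using points_chart_pt U by blast
  then have "z \<in> pull B U" using x unfolding pull_def by simp
  then obtain p q where pq: "p \<in> PF B" "q \<in> PF B" "q z \<noteq> 0"
    "\<And>y. q y \<noteq> 0 \<Longrightarrow> y \<in> pull B U \<and> f (chart_pt B y) = p y / q y"
    using zregE[OF f[OF B(1)]] by blast
  obtain p' where p': "p' \<in> coordinate_ring l (cone_of B)" "\<And>z. p' (affine_pt B B z) = p z"
    using PF_coordinate_ring[OF B(1) pq(1)] by blast
  obtain q' where q': "q' \<in> coordinate_ring l (cone_of B)" "\<And>z. q' (affine_pt B B z) = q z"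
    using PF_coordinate_ring[OF B(1) pq(2)] by blast
  let ?V = "chart_pt B ` {z. q z \<noteq> 0}"
  have 1: "openin X ?V" by (rule open_push[OF B(1) pq(2)])
  have 2: "x \<in> ?V" using B pq(3) by blast
  have 3: "?V \<subseteq> U" using pq(4) unfolding pull_def by blast
  have 4: "?V \<subseteq> chart l \<Delta> (cone_of B) ` affine_points l (cone_of B)"
    unfolding chart_pt_def using affine_pt_affine[OF BsD(1)[OF B(1)] nz_off_refl] by blast
  have 5: "q' u \<noteq> 0 \<and> f (chart l \<Delta> (cone_of B) u) = p' u / q' u"
    if u: "u \<in> affine_points l (cone_of B)" "chart l \<Delta> (cone_of B) u \<in> ?V" for u
  proof -
    define y where "y b = u (dual_vec l B b)" for b
    have uy: "u = affine_pt B B y" by (rule point_coords[OF B(1) subset_refl u(1)]) (simp add: y_def)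
    \<comment> \<open>The chart point determines only the coordinates in \<open>B\<close>, so
      \<open>y'\<close> may differ from \<open>y\<close> elsewhere; \<open>q\<close> does not see
      this.\<close>
    obtain y' where y': "chart_pt B y = chart_pt B y'" "q y' \<noteq> 0" using u(2) unfolding uy chart_pt_def[symmetric] by blast
    have "q y = q y'" using chart_pt_inj[OF B(1) y'(1)] by (intro PF_cong[OF pq(2)])
    then have "q y \<noteq> 0" using y' by simp
    then show ?thesis unfolding uy chart_pt_def[symmetric] p'(2) q'(2) using pq(4) by blast
  qed
  have "cone_of B \<in> \<Delta>" using BsD(1)[OF B(1)] unfolding \<Delta>_def by blast
  then show "\<exists>\<sigma>\<in>\<Delta>. \<exists>p\<in>coordinate_ring l \<sigma>. \<exists>q\<in>coordinate_ring l \<sigma>. \<exists>V. openin X V \<and> x \<in> V \<and> V \<subseteq> U \<and>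
      V \<subseteq> chart l \<Delta> \<sigma> ` affine_points l \<sigma> \<and>
      (\<forall>u\<in>affine_points l \<sigma>. chart l \<Delta> \<sigma> u \<in> V \<longrightarrow> q u \<noteq> 0 \<and> f (chart l \<Delta> \<sigma> u) = p u / q u)"
    using 1 2 3 4 5 p'(1) q'(1) by (intro bexI[of _ "cone_of B"] bexI[of _ p'] bexI[of _ q'] exI[of _ ?V]) auto
qed

end


section \<open>Line bundles on a smooth toric variety\<close>

lemma zreg_cong:
  assumes f: "zreg V U f" and z: "z \<in> U" and eq: "\<And>v. v \<in> V \<Longrightarrow> z v = z' v"
  shows "f z' = f z"
proof -
  obtain p q where pq: "p \<in> PF V" "q \<in> PF V" "q z \<noteq> 0" "\<And>y. q y \<noteq> 0 \<Longrightarrow> y \<in> U \<and> f y = p y / q y"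
    using zregE[OF f z] by blast
  have "p z = p z'" "q z = q z'" using PF_cong[OF pq(1) eq] PF_cong[OF pq(2) eq] by auto
  then show ?thesis using pq(3) pq(4)[of z] pq(4)[of z'] by simp
qed

lemma two_powi_inject: "(2::complex) powi a = 2 powi b \<Longrightarrow> a = b"
proof -
  assume "(2::complex) powi a = 2 powi b"
  then have "norm ((2::complex) powi a) = norm ((2::complex) powi b)" by simp
  then have eq: "(2::real) powi a = 2 powi b" by (simp add: norm_power_int)
  show ?thesis
  proof (rule linorder_cases[of a b])
    assume "a < b"
    then have "(2::real) powi a < 2 powi b" by (intro power_int_strict_increasing) auto
    with eq show ?thesis by simp
  next
    assume "b < a"
    then have "(2::real) powi b < 2 powi a" by (intro power_int_strict_increasing) auto
    with eq show ?thesis by simp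
  qed
qed

lemma cross_cancel:
  fixes a b t t' u v :: complex
  assumes "a * t = b * t'" "t * v = u * t'" "t' \<noteq> 0"
  shows "a * u = b * v"
proof -
  have "a * u * t' = a * t * v" using assms(2) by (simp add: mult.assoc)
  also have "\<dots> = b * v * t'" unfolding assms(1) by simp
  finally show ?thesis using assms(3) by simp
qed

context smooth_complex
begin

lemma chi_pow: "chi B (\<lambda>j. int k * m j) z = chi B m z ^ k"
proof -
  have "x powi (int k * a) = (x powi a) ^ k" for x :: complex and a
    by (metis mult.commute power_int_mult power_int_of_nat)
  then show ?thesis unfolding chi_def ip_smult_left prod_power_distrib by simp
qed

lemma chi_mult: "chi B m (\<lambda>b. z b * z' b) = chi B m z * chi B m z'"
  unfolding chi_def by (simp add: power_int_mult_distrib prod.distrib)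

lemma chi_separates:
  assumes B: "B \<in> Bs" and m: "m \<in> lattice_vecs l" "m' \<in> lattice_vecs l" "m \<noteq> m'"
  shows "\<exists>z. (\<forall>b. z b \<noteq> 0) \<and> chi B m z \<noteq> chi B m' z"
proof -
  obtain b where b: "b \<in> B" "ip l m b \<noteq> ip l m' b" using ip_eq_basis[OF B m(1,2)] m(3) by blast
  \<comment> \<open>The value 2 is not a root of unity, so its powers tell the exponents at
    \<open>b\<close> apart.\<close>
  define z where "z b' = (if b' = b then 2 else 1 :: complex)" for b'
  have "chi B k z = 2 powi ip l k b" for k
  proof -
    have "chi B k z = (\<Prod>b'\<in>B. if b' = b then 2 powi ip l k b else 1)"
      unfolding chi_def z_def by (rule prod.cong) auto
    then show ?thesis using b(1) BsD(2)[OF B] by simp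
  qed
  then have "chi B m z \<noteq> chi B m' z" using two_powi_inject b(2) by metis
  then show ?thesis by (intro exI[of _ z]) (auto simp: z_def)
qed

text \<open>Dedekind's argument: subtracting \<open>chi B m1 t\<close> times a relation from its translate by \<open>t\<close>
  removes the term of \<open>m1\<close>.\<close>

lemma chi_independent:
  assumes B: "B \<in> Bs" and F: "finite F" "F \<subseteq> lattice_vecs l"
    and eq: "\<And>z. (\<And>b. z b \<noteq> 0) \<Longrightarrow> (\<Sum>m\<in>F. c m * chi B m z) = 0" and m: "m \<in> F"
  shows "c m = 0"
  using F eq m
proof (induction F arbitrary: c m)
  case (insert m1 F)
  have rest: "c m = 0" if m: "m \<in> F" for m
  proof -
    have "m \<noteq> m1" using m insert(2) by blast
    then obtain t where t: "\<And>b. t b \<noteq> 0" "chi B m t \<noteq> chi B m1 t"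
      using chi_separates[OF B, of m m1] insert(4) m by blast
    have "(\<Sum>m\<in>F. c m * (chi B m t - chi B m1 t) * chi B m z) = 0" if z: "\<And>b. z b \<noteq> 0" for z
    proof -
      have 1: "c m1 * chi B m1 z + (\<Sum>m\<in>F. c m * chi B m z) = 0"
        using insert(5)[OF z] insert(1,2) by simp
      have "(\<Sum>m\<in>insert m1 F. c m * chi B m (\<lambda>b. t b * z b)) = 0"
        by (rule insert(5)) (use t(1) z in auto)
      then have 2: "c m1 * (chi B m1 t * chi B m1 z) + (\<Sum>m\<in>F. c m * (chi B m t * chi B m z)) = 0"
        using insert(1,2) by (simp add: chi_mult)
      have "(\<Sum>m\<in>F. c m * (chi B m t - chi B m1 t) * chi B m z) =
          (\<Sum>m\<in>F. c m * (chi B m t * chi B m z)) - chi B m1 t * (\<Sum>m\<in>F. c m * chi B m z)"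
        by (simp add: sum_distrib_left sum_subtractf algebra_simps)
      also have "(\<Sum>m\<in>F. c m * (chi B m t * chi B m z)) = - (c m1 * (chi B m1 t * chi B m1 z))"
        using 2 by (metis add.inverse_unique)
      also have "(\<Sum>m\<in>F. c m * chi B m z) = - (c m1 * chi B m1 z)"
        using 1 by (metis add.inverse_unique)
      finally show ?thesis by (simp add: algebra_simps)
    qed
    then have "c m * (chi B m t - chi B m1 t) = 0"
      using insert(3)[of "\<lambda>m. c m * (chi B m t - chi B m1 t)"] insert(4) m by blast
    then show ?thesis using t(2) by simp
  qed
  have "(\<Sum>m\<in>insert m1 F. c m * chi B m (\<lambda>_. 1)) = 0" by (rule insert(5)) auto
  moreover have "chi B m1 (\<lambda>_. 1) = 1" unfolding chi_def by simp
  ultimately have "c m1 = 0" using insert(1,2) rest by simp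
  then show ?case using rest insert(6) by blast
qed simp

end

locale toric_line_bundle = smooth_complex l K for l K +
  fixes L :: "('i, toric_point) line_bundle_data"
  assumes lb: "line_bundle (toric_topology l (cone_of ` K)) (toric_regular l (cone_of ` K)) L"
    and nonempty: "K \<noteq> {}"
begin

lemma lbD:
  "i \<in> index L \<Longrightarrow> openin X (cover L i)"
  "(\<Union>i\<in>index L. cover L i) = toric_points l \<Delta>"
  "i \<in> index L \<Longrightarrow> j \<in> index L \<Longrightarrow> trans L i j \<in> \<O> (cover L i \<inter> cover L j)"
  "i \<in> index L \<Longrightarrow> j \<in> index L \<Longrightarrow> x \<in> cover L i \<inter> cover L j \<Longrightarrow> trans L i j x \<noteq> 0"
  "i \<in> index L \<Longrightarrow> j \<in> index L \<Longrightarrow> k \<in> index L \<Longrightarrow> x \<in> cover L i \<inter> cover L j \<inter> cover L k \<Longrightarrow>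
     trans L i j x * trans L j k x = trans L i k x"
  using lb unfolding line_bundle_def topspace_toric_topology \<Delta>_def[symmetric] by blast+

lemma covered: "B \<in> Bs \<Longrightarrow> \<exists>i\<in>index L. chart_pt B z \<in> cover L i"
  using chart_pt_point[of B z] lbD(2) by blast

text \<open>A nowhere vanishing section of the pull-back of \<open>L\<close> to the coordinate
  space, given in the local trivialisations of \<open>L\<close>.\<close>

definition frame :: "(nat \<Rightarrow> int) set \<Rightarrow> ('i \<Rightarrow> coords \<Rightarrow> complex) \<Rightarrow> bool" where
  "frame B t \<longleftrightarrow> (\<forall>i\<in>index L. zreg B (pull B (cover L i)) (t i) \<and> (\<forall>z\<in>pull B (cover L i). t i z \<noteq> 0) \<and>
     (\<forall>j\<in>index L. \<forall>z\<in>pull B (cover L i) \<inter> pull B (cover L j). t i z = trans L i j (chart_pt B z) * t j z))"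

lemma frame_ex:
  assumes B: "B \<in> Bs"
  shows "\<exists>t. frame B t"
  unfolding frame_def
proof (rule line_bundle_trivial[OF BsD(2)[OF B]])
  show "zopen B (pull B (cover L i))" if "i \<in> index L" for i by (rule open_pull[OF B lbD(1)[OF that]])
  show "\<exists>i\<in>index L. z \<in> pull B (cover L i)" for z using covered[OF B] unfolding pull_def by simp
  fix i j assume ij: "i \<in> index L" "j \<in> index L"
  have "pull B (cover L i) \<inter> pull B (cover L j) = pull B (cover L i \<inter> cover L j)" unfolding pull_def by auto
  then show "zreg B (pull B (cover L i) \<inter> pull B (cover L j)) (\<lambda>z. trans L i j (chart_pt B z))"
    using regular_pull[OF B lbD(3)[OF ij]] by simp
  show "trans L i j (chart_pt B z) \<noteq> 0" if "z \<in> pull B (cover L i) \<inter> pull B (cover L j)" for z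
    using lbD(4)[OF ij] that unfolding pull_def by blast
  fix k z assume "k \<in> index L" "z \<in> pull B (cover L i) \<inter> pull B (cover L j) \<inter> pull B (cover L k)"
  then show "trans L i j (chart_pt B z) * trans L j k (chart_pt B z) = trans L i k (chart_pt B z)"
    using lbD(5)[OF ij] unfolding pull_def by blast
qed

definition \<tau> where "\<tau> B = (SOME t. frame B t)"

lemma tau:
  assumes "B \<in> Bs" "i \<in> index L"
  shows "zreg B (pull B (cover L i)) (\<tau> B i)"
    "chart_pt B z \<in> cover L i \<Longrightarrow> \<tau> B i z \<noteq> 0"
    "j \<in> index L \<Longrightarrow> chart_pt B z \<in> cover L i \<Longrightarrow> chart_pt B z \<in> cover L j \<Longrightarrow> \<tau> B i z = trans L i j (chart_pt B z) * \<tau> B j z"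
proof -
  have "frame B (\<tau> B)" unfolding \<tau>_def by (rule someI_ex[OF frame_ex[OF assms(1)]])
  note f = bspec[OF this[unfolded frame_def] assms(2)]
  show "zreg B (pull B (cover L i)) (\<tau> B i)" using f by blast
  have "\<forall>z\<in>pull B (cover L i). \<tau> B i z \<noteq> 0" using f by blast
  then show "chart_pt B z \<in> cover L i \<Longrightarrow> \<tau> B i z \<noteq> 0" by (simp add: pull_def)
  have "\<forall>j\<in>index L. \<forall>z\<in>pull B (cover L i) \<inter> pull B (cover L j). \<tau> B i z = trans L i j (chart_pt B z) * \<tau> B j z"
    using f by blast
  then show "j \<in> index L \<Longrightarrow> chart_pt B z \<in> cover L i \<Longrightarrow> chart_pt B z \<in> cover L j \<Longrightarrow> \<tau> B i z = trans L i j (chart_pt B z) * \<tau> B j z"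
    by (simp add: pull_def)
qed

lemma tau_cong:
  assumes "B \<in> Bs" "i \<in> index L" "chart_pt B z \<in> cover L i" "\<And>b. b \<in> B \<Longrightarrow> z b = z' b"
  shows "\<tau> B i z' = \<tau> B i z"
  by (rule zreg_cong[OF tau(1)[OF assms(1,2)]]) (use assms(3,4) in \<open>auto simp: pull_def\<close>)

text \<open>The ratio of the frames of two charts is a constant times a character that is invertible on
  their overlap.\<close>

definition frame_ratio :: "(nat \<Rightarrow> int) set \<Rightarrow> (nat \<Rightarrow> int) set \<Rightarrow> complex \<Rightarrow> (nat \<Rightarrow> int) \<Rightarrow> bool" where
  "frame_ratio B B' k m \<longleftrightarrow> k \<noteq> 0 \<and> m \<in> lattice_vecs l \<and> (\<forall>b\<in>B \<inter> B'. ip l m b = 0) \<and>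
     (\<forall>i\<in>index L. \<forall>z. nz_off B B' z \<longrightarrow> chart_pt B z \<in> cover L i \<longrightarrow> \<tau> B i z = k * chi B m z * \<tau> B' i (T B B' z))"

lemma frame_ratio_ex:
  assumes B: "B \<in> Bs" "B' \<in> Bs"
  shows "\<exists>k m. frame_ratio B B' k m"
proof -
  define ix where "ix z = (SOME i. i \<in> index L \<and> chart_pt B z \<in> cover L i)" for z
  have ix: "ix z \<in> index L" "chart_pt B z \<in> cover L (ix z)" for z
    using someI_ex[of "\<lambda>i. i \<in> index L \<and> chart_pt B z \<in> cover L i"] covered[OF B(1), of z] unfolding ix_def by blast+
  \<comment> \<open>The ratio of the two frames does not depend on the local trivialisation, as the
    transition function cancels.\<close>
  define r where "r z = \<tau> B (ix z) z / \<tau> B' (ix z) (T B B' z)" for z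
  have r: "r z = \<tau> B i z / \<tau> B' i (T B B' z)" "\<tau> B' i (T B B' z) \<noteq> 0" "r z \<noteq> 0"
    if z: "nz_off B B' z" "i \<in> index L" "chart_pt B z \<in> cover L i" for i z
  proof -
    have c: "chart_pt B' (T B B' z) = chart_pt B z" by (rule chart_pt_T[OF B z(1)])
    have g: "trans L (ix z) i (chart_pt B z) \<noteq> 0" by (rule lbD(4)) (use ix z in auto)
    show nz: "\<tau> B' i (T B B' z) \<noteq> 0" by (rule tau(2)[OF B(2) z(2)]) (simp add: c z(3))
    have "\<tau> B (ix z) z = trans L (ix z) i (chart_pt B z) * \<tau> B i z"
      by (rule tau(3)[OF B(1) ix(1) z(2) ix(2) z(3)])
    moreover have "\<tau> B' (ix z) (T B B' z) = trans L (ix z) i (chart_pt B z) * \<tau> B' i (T B B' z)"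
      using tau(3)[OF B(2) ix(1)[of z] z(2), of "T B B' z"] ix(2)[of z] z(3) c by simp
    ultimately show e: "r z = \<tau> B i z / \<tau> B' i (T B B' z)" unfolding r_def using g by simp
    show "r z \<noteq> 0" unfolding e using nz tau(2)[OF B(1) z(2,3)] by simp
  qed
  have A: "{z. \<forall>v\<in>B - B'. z v \<noteq> 0} = {z. nz_off B B' z}" unfolding nz_off_def ..
  have "zreg B {z. \<forall>v\<in>B - B'. z v \<noteq> 0} r"
    unfolding A zreg_def
  proof
    fix z assume "z \<in> {z. nz_off B B' z}"
    then have z: "nz_off B B' z" by simp
    let ?i = "ix z"
    note i = ix[of z]
    have c: "chart_pt B' (T B B' z) = chart_pt B z" by (rule chart_pt_T[OF B z])
    obtain p q where pq: "p \<in> PF B" "q \<in> PF B" "q z \<noteq> 0"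
      "\<And>y. q y \<noteq> 0 \<Longrightarrow> y \<in> pull B (cover L ?i) \<and> \<tau> B ?i y = p y / q y"
      using zregE[OF tau(1)[OF B(1) i(1)], of z] i(2) unfolding pull_def by blast
    obtain p1 q1 where pq1: "p1 \<in> PF B'" "q1 \<in> PF B'" "q1 (T B B' z) \<noteq> 0"
      "\<And>y. q1 y \<noteq> 0 \<Longrightarrow> y \<in> pull B' (cover L ?i) \<and> \<tau> B' ?i y = p1 y / q1 y"
      using zregE[OF tau(1)[OF B(2) i(1)], of "T B B' z"] i(2) c unfolding pull_def by auto
    have p1z: "p1 (T B B' z) \<noteq> 0" using r(2)[OF z i] pq1(4)[OF pq1(3)] by auto
    obtain P N where P: "P \<in> PF B" "\<forall>z. nz_off B B' z \<longrightarrow> p1 (T B B' z) = P z / off_prod B B' z ^ N"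
      using PF_T[OF B pq1(1)] by blast
    obtain Q M where Q: "Q \<in> PF B" "\<forall>z. nz_off B B' z \<longrightarrow> q1 (T B B' z) = Q z / off_prod B B' z ^ M"
      using PF_T[OF B pq1(2)] by blast
    let ?e = "off_prod B B'"
    \<comment> \<open>The additional factor \<open>Q * ?e\<close> in both parts makes a nonzero
      denominator imply that the point lies on the overlap and that the fraction for
      \<open>\<tau> B'\<close> is valid there.\<close>
    let ?n = "p * Q * ?e ^ N * Q * ?e" and ?d = "q * P * ?e ^ M * Q * ?e"
    have mem: "?n \<in> PF B" "?d \<in> PF B" by (intro PF.mult PF_power pq(1,2) P(1) Q(1) off_prod_PF)+
    have bz: "?e z \<noteq> 0" using off_prod_nz[OF B(1)] z by blast
    have dz: "?d z \<noteq> 0" using pq(3) P(2) Q(2) p1z pq1(3) z bz by (auto simp: fun_power_apply)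
    have rep: "y \<in> {z. nz_off B B' z} \<and> r y = ?n y / ?d y" if y: "?d y \<noteq> 0" for y
    proof -
      have y': "q y \<noteq> 0" "P y \<noteq> 0" "Q y \<noteq> 0" "?e y \<noteq> 0" using y by auto
      then have o: "nz_off B B' y" using off_prod_nz[OF B(1)] by blast
      have 1: "chart_pt B y \<in> cover L ?i" "\<tau> B ?i y = p y / q y" using pq(4)[OF y'(1)] unfolding pull_def by auto
      have "q1 (T B B' y) \<noteq> 0" using Q(2) o y' by auto
      then have "\<tau> B' ?i (T B B' y) = p1 (T B B' y) / q1 (T B B' y)" using pq1(4) by blast
      then have "\<tau> B' ?i (T B B' y) = (P y / ?e y ^ N) / (Q y / ?e y ^ M)" using P(2) Q(2) o by simp
      then have "r y = (p y / q y) / ((P y / ?e y ^ N) / (Q y / ?e y ^ M))" using r(1)[OF o i(1) 1(1)] 1(2) by simp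
      also have "\<dots> = ?n y / ?d y" using y' by (simp add: fun_power_apply field_simps)
      finally show ?thesis using o by simp
    qed
    show "\<exists>p\<in>PF B. \<exists>q\<in>PF B. q z \<noteq> 0 \<and> (\<forall>y. q y \<noteq> 0 \<longrightarrow> y \<in> {z. nz_off B B' z} \<and> r y = p y / q y)"
      by (rule bexI[OF _ mem(1)], rule bexI[OF _ mem(2)]) (use dz rep in blast)
  qed
  moreover have "r z \<noteq> 0" if z: "\<forall>v\<in>B - B'. z v \<noteq> 0" for z
    using r(3)[OF _ ix[of z]] z unfolding nz_off_def by blast
  ultimately obtain k n where k: "k \<noteq> 0" "\<And>z. (\<forall>v\<in>B - B'. z v \<noteq> 0) \<Longrightarrow> r z = k * (\<Prod>v\<in>B - B'. z v powi n v)"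
    using zreg_unit_monomial[OF BsD(2)[OF B(1)], of "B - B'" r] by blast
  \<comment> \<open>The exponents of the Laurent monomial become the values of a lattice vector on
    \<open>B\<close>, with 0 at the common generators.\<close>
  define m where "m = (\<Sum>b\<in>B - B'. (\<lambda>j. n b * dual_vec l B b j))"
  have finB: "finite B" by (rule BsD(2)[OF B(1)])
  have ipm: "ip l m b = (if b \<in> B' then 0 else n b)" if b: "b \<in> B" for b
  proof -
    have "ip l m b = (\<Sum>b'\<in>B - B'. if b' = b then n b' else 0)"
      unfolding m_def ip_sum_left ip_smult_left by (rule sum.cong) (use Bs_dual_vec(2)[OF B(1) _ b] in auto)
    then show ?thesis using finB b by simp
  qed
  have mL: "m \<in> lattice_vecs l" unfolding m_def
    by (rule lattice_vecs_sum) (use Bs_dual_vec(1)[OF B(1)] in auto)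
  have "chi B m z = (\<Prod>v\<in>B - B'. z v powi n v)" for z
    unfolding chi_def by (rule prod.mono_neutral_cong_right) (use finB ipm in auto)
  then have "\<tau> B i z = k * chi B m z * \<tau> B' i (T B B' z)"
    if "nz_off B B' z" "i \<in> index L" "chart_pt B z \<in> cover L i" for i z
    using r(1,2)[OF that] k(2)[of z] that(1) unfolding nz_off_def by (simp add: field_simps)
  then have "frame_ratio B B' k m" unfolding frame_ratio_def using k(1) mL ipm by auto
  then show ?thesis by blast
qed

section \<open>Vertices relative to a reference chart\<close>

definition B0 where "B0 = (SOME B. B \<in> Bs)"

lemma B0: "B0 \<in> Bs"
  using nonempty extend_Bs unfolding B0_def by (metis ex_in_conv someI_ex)

text \<open>On the torus the frame of \<open>B\<close> is \<open>frame_const B\<close> times the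
  character of \<open>vertex B\<close> times the frame of \<open>B0\<close>; these are the Cartier
  data of the line bundle.\<close>

definition frame_const where "frame_const B = (SOME k. \<exists>m. frame_ratio B B0 k m)"
definition vertex where "vertex B = (SOME m. frame_ratio B B0 (frame_const B) m)"

lemma frame_ratio_B0: "B \<in> Bs \<Longrightarrow> frame_ratio B B0 (frame_const B) (vertex B)"
  unfolding vertex_def frame_const_def
  by (rule someI_ex[of "\<lambda>m. frame_ratio B B0 (SOME k. \<exists>m. frame_ratio B B0 k m) m"],
      rule someI_ex[of "\<lambda>k. \<exists>m. frame_ratio B B0 k m"], rule frame_ratio_ex[OF _ B0])

lemma cmpD:
  assumes "frame_ratio B B' k m"
  shows "k \<noteq> 0" "m \<in> lattice_vecs l" "b \<in> B \<Longrightarrow> b \<in> B' \<Longrightarrow> ip l m b = 0"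
   "i \<in> index L \<Longrightarrow> nz_off B B' z \<Longrightarrow> chart_pt B z \<in> cover L i \<Longrightarrow> \<tau> B i z = k * chi B m z * \<tau> B' i (T B B' z)"
  using assms unfolding frame_ratio_def by auto

lemma frame_const_nz: "B \<in> Bs \<Longrightarrow> frame_const B \<noteq> 0"
  using cmpD(1)[OF frame_ratio_B0] .

lemma vertex_lattice: "B \<in> Bs \<Longrightarrow> vertex B \<in> lattice_vecs l"
  using cmpD(2)[OF frame_ratio_B0] .

lemma empty_in: "{} \<in> K"
  using nonempty down by blast

lemma dpts_empty: "m \<in> lattice_vecs l \<Longrightarrow> m \<in> dpts {}"
  using dpts_iff[OF empty_in] by simp

lemma torus:
  assumes B: "B \<in> Bs" "B' \<in> Bs" and z: "\<And>b. z b \<noteq> 0"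
  shows "nz_off B A z" "m \<in> lattice_vecs l \<Longrightarrow> chi B' m (T B B' z) = chi B m z" "nz_off B' A (T B B' z)"
    "B'' \<in> Bs \<Longrightarrow> T B' B'' (T B B' z) = T B B'' z"
proof -
  show nz_off: "nz_off B A z" for A using z unfolding nz_off_def by blast
  show mT: "chi B' m (T B B' z) = chi B m z" if "m \<in> lattice_vecs l" for m
    by (rule chi_T(1)[OF B empty_subsetI nz_off dpts_empty[OF that]])
  show "nz_off B' A (T B B' z)"
    using chi_T(2)[OF B empty_subsetI nz_off dpts_zero] unfolding nz_off_def by blast
  show "T B' B'' (T B B' z) = T B B'' z" if "B'' \<in> Bs"
    unfolding T_def[of B' B''] T_def[of B B''] using mT[OF Bs_dual_vec(1)[OF that]] by auto
qed

text \<open>On the torus the frames of \<open>B\<close>, \<open>B'\<close> and \<open>B0\<close> can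
  all be compared. The point with all coordinates 1 leaves only the constants, and characters are
  determined by their values on the torus.\<close>

lemma frame_ratio_mB:
  assumes B: "B \<in> Bs" "B' \<in> Bs" and c: "frame_ratio B B' k m"
  shows "k = frame_const B / frame_const B'" "m = vertex B - vertex B'"
proof -
  note L = vertex_lattice[OF B(1)] vertex_lattice[OF B(2)] cmpD(2)[OF c]
  have eq: "frame_const B * chi B (vertex B) z = k * frame_const B' * chi B (m + vertex B') z" if z: "\<And>b. z b \<noteq> 0" for z
  proof -
    note t = torus[OF B z]
    obtain i where i: "i \<in> index L" "chart_pt B z \<in> cover L i" using covered[OF B(1)] by blast
    have ci: "chart_pt B' (T B B' z) \<in> cover L i" using chart_pt_T[OF B t(1)] i(2) by simp
    have tt: "T B' B0 (T B B' z) = T B B0 z" by (rule t(4)[OF B0])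
    have 1: "\<tau> B i z = frame_const B * chi B (vertex B) z * \<tau> B0 i (T B B0 z)"
      by (rule cmpD(4)[OF frame_ratio_B0[OF B(1)] i(1) t(1) i(2)])
    have 2: "\<tau> B i z = k * chi B m z * \<tau> B' i (T B B' z)" by (rule cmpD(4)[OF c i(1) t(1) i(2)])
    have 3: "\<tau> B' i (T B B' z) = frame_const B' * chi B (vertex B') z * \<tau> B0 i (T B B0 z)"
      using cmpD(4)[OF frame_ratio_B0[OF B(2)] i(1) t(3) ci] t(2)[OF L(2)] tt by simp
    have nz: "\<tau> B0 i (T B B0 z) \<noteq> 0"
      using tau(2)[OF B0 i(1)] chart_pt_T[OF B(1) B0 t(1)] i(2) by simp
    have "chi B (m + vertex B') z = chi B m z * chi B (vertex B') z" by (rule chi_add) (use z in auto)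
    then have "(frame_const B * chi B (vertex B) z) * \<tau> B0 i (T B B0 z) = (k * frame_const B' * chi B (m + vertex B') z) * \<tau> B0 i (T B B0 z)"
      using 1 unfolding 2 3 by (simp only: ac_simps)
    then show ?thesis using nz by simp
  qed
  have "chi B n (\<lambda>_. 1) = 1" for n unfolding chi_def by simp
  then have k: "frame_const B = k * frame_const B'" using eq[of "\<lambda>_. 1"] by simp
  then show "k = frame_const B / frame_const B'" using frame_const_nz[OF B(2)] by simp
  have "vertex B = m + vertex B'"
  proof (rule ccontr)
    assume "vertex B \<noteq> m + vertex B'"
    then obtain z where z: "\<And>b. z b \<noteq> 0" "chi B (vertex B) z \<noteq> chi B (m + vertex B') z"
      using chi_separates[OF B(1), of "vertex B" "m + vertex B'"] L by auto
    then show False using eq[OF z(1)] k frame_const_nz[OF B(1)] by simp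
  qed
  then show "m = vertex B - vertex B'" by (simp add: fun_eq_iff)
qed

lemma tau_change:
  assumes B: "B \<in> Bs" "B' \<in> Bs"
  shows "b \<in> B \<Longrightarrow> b \<in> B' \<Longrightarrow> ip l (vertex B) b = ip l (vertex B') b"
    and "i \<in> index L \<Longrightarrow> nz_off B B' z \<Longrightarrow> chart_pt B z \<in> cover L i \<Longrightarrow>
      \<tau> B i z = frame_const B / frame_const B' * chi B (vertex B - vertex B') z * \<tau> B' i (T B B' z)"
proof -
  obtain k m where c: "frame_ratio B B' k m" using frame_ratio_ex[OF B] by blast
  note e = frame_ratio_mB[OF B c]
  show "b \<in> B \<Longrightarrow> b \<in> B' \<Longrightarrow> ip l (vertex B) b = ip l (vertex B') b"
    using cmpD(3)[OF c] unfolding e by (simp add: ip_diff_left)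
  show "i \<in> index L \<Longrightarrow> nz_off B B' z \<Longrightarrow> chart_pt B z \<in> cover L i \<Longrightarrow>
      \<tau> B i z = frame_const B / frame_const B' * chi B (vertex B - vertex B') z * \<tau> B' i (T B B' z)"
    using cmpD(4)[OF c] unfolding e .
qed

text \<open>The support function of the line bundle on the rays; by \<open>tau_change\<close> the
  vertices of all bases in \<open>Bs\<close> containing \<open>r\<close> give the same
  value.\<close>

definition h :: "(nat \<Rightarrow> int) \<Rightarrow> int" where
  "h r = ip l (vertex (SOME B. B \<in> Bs \<and> r \<in> B)) r"

lemma h_eq:
  assumes "B \<in> Bs" "b \<in> B"
  shows "ip l (vertex B) b = h b"
proof -
  have "(SOME B. B \<in> Bs \<and> b \<in> B) \<in> Bs \<and> b \<in> (SOME B. B \<in> Bs \<and> b \<in> B)"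
    by (rule someI_ex[of "\<lambda>B. B \<in> Bs \<and> b \<in> B"]) (use assms in blast)
  then show ?thesis unfolding h_def using tau_change(1)[OF assms(1)] assms(2) by blast
qed

definition P :: "nat \<Rightarrow> (nat \<Rightarrow> int) set" where
  "P k = {m \<in> lattice_vecs l. \<forall>r\<in>\<Union>K. int k * h r \<le> ip l m r}"

definition mvertex :: "nat \<Rightarrow> (nat \<Rightarrow> int) set \<Rightarrow> nat \<Rightarrow> int" where
  "mvertex k B = (\<lambda>j. int k * vertex B j)"

lemma mvertex_lattice: "B \<in> Bs \<Longrightarrow> mvertex k B \<in> lattice_vecs l"
  unfolding mvertex_def using vertex_lattice by simp

lemma ip_mvertex: "ip l (mvertex k B) r = int k * ip l (vertex B) r"
  unfolding mvertex_def by (rule ip_smult_left)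

lemma P_iff: "m \<in> P k \<longleftrightarrow> m \<in> lattice_vecs l \<and> (\<forall>B\<in>Bs. m - mvertex k B \<in> dpts B)"
proof -
  have "(\<forall>r\<in>\<Union>K. int k * h r \<le> ip l m r) \<longleftrightarrow> (\<forall>B\<in>Bs. \<forall>b\<in>B. int k * h b \<le> ip l m b)"
  proof (intro iffI ballI)
    fix B b assume *: "\<forall>r\<in>\<Union>K. int k * h r \<le> ip l m r" "B \<in> Bs" "b \<in> B"
    then have "b \<in> \<Union>K" using BsD(1) by blast
    then show "int k * h b \<le> ip l m b" using *(1) by blast
  next
    fix r assume *: "\<forall>B\<in>Bs. \<forall>b\<in>B. int k * h b \<le> ip l m b" "r \<in> \<Union>K"
    then obtain B where "B \<in> Bs" "r \<in> B" using extend_Bs by blast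
    then show "int k * h r \<le> ip l m r" using *(1) by blast
  qed
  also have "\<dots> \<longleftrightarrow> (\<forall>B\<in>Bs. \<forall>b\<in>B. 0 \<le> ip l (m - mvertex k B) b)"
    using h_eq by (auto simp: ip_diff_left ip_mvertex)
  finally have 1: "(\<forall>r\<in>\<Union>K. int k * h r \<le> ip l m r) \<longleftrightarrow> (\<forall>B\<in>Bs. \<forall>b\<in>B. 0 \<le> ip l (m - mvertex k B) b)" .
  have 2: "m - mvertex k B \<in> dpts B \<longleftrightarrow> (\<forall>b\<in>B. 0 \<le> ip l (m - mvertex k B) b)" if "m \<in> lattice_vecs l" "B \<in> Bs" for B
    using dpts_iff[OF BsD(1)[OF that(2)], of "m - mvertex k B"] lattice_vecs_closed(3)[OF that(1) mvertex_lattice[OF that(2)]] by blast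
  show ?thesis
  proof (cases "m \<in> lattice_vecs l")
    case True
    have "(\<forall>B\<in>Bs. \<forall>b\<in>B. 0 \<le> ip l (m - mvertex k B) b) \<longleftrightarrow> (\<forall>B\<in>Bs. m - mvertex k B \<in> dpts B)"
      using 2[OF True] by simp
    then show ?thesis using 1 True by (simp add: P_def)
  qed (simp add: P_def)
qed

text \<open>On the torus this is the character of \<open>m\<close> times the \<open>k\<close>-th
  power of the frame of \<open>B0\<close>, rewritten in the frame of \<open>B\<close> so that it
  makes sense on the whole chart.\<close>

definition char_val where
  "char_val k m B i z = inverse (frame_const B) ^ k * chi B (m - mvertex k B) z * \<tau> B i z ^ k"

lemma char_val_change:
  assumes m: "m \<in> P k" and B: "B \<in> Bs" "B' \<in> Bs" and i: "i \<in> index L" and z: "nz_off B B' z" "chart_pt B z \<in> cover L i"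
  shows "char_val k m B i z = char_val k m B' i (T B B' z)"
proof -
  let ?A = "B \<inter> B'" and ?n = "\<lambda>j. int k * (vertex B - vertex B') j"
  \<comment> \<open>The computation is done with the generators \<open>B \<inter> B'\<close>: on
    them the exponents are nonnegative, so characters multiply although those coordinates may
    vanish.\<close>
  have AK: "?A \<in> K" using down[OF BsD(1)[OF B(1)]] by blast
  have okA: "nz_off B ?A z" using z(1) unfolding nz_off_def by blast
  have d1: "m - mvertex k B \<in> dpts ?A" by (rule dpts_mono[OF BsD(1)[OF B(1)]]) (use m P_iff B in auto)
  have d2: "m - mvertex k B' \<in> dpts ?A" by (rule dpts_mono[OF BsD(1)[OF B(2)]]) (use m P_iff B in auto)
  have "ip l ?n b = 0" if "b \<in> ?A" for b
    using tau_change(1)[OF B] that unfolding ip_smult_left ip_diff_left by auto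
  moreover have "?n \<in> lattice_vecs l" using vertex_lattice B by (intro lattice_vecs_closed) auto
  ultimately have d3: "?n \<in> dpts ?A" using dpts_iff[OF AK] by simp
  have eq: "(m - mvertex k B) + ?n = m - mvertex k B'" by (auto simp: fun_eq_iff mvertex_def algebra_simps)
  have 1: "chi B (m - mvertex k B) z * chi B (vertex B - vertex B') z ^ k = chi B (m - mvertex k B') z"
    using chi_add_dm[OF AK okA d1 d3] unfolding eq chi_pow by (rule sym)
  have 2: "chi B' (m - mvertex k B') (T B B' z) = chi B (m - mvertex k B') z"
    by (rule chi_T(1)[OF B _ okA d2]) auto
  have "char_val k m B i z = inverse (frame_const B) ^ k * (frame_const B / frame_const B') ^ k * (chi B (m - mvertex k B) z * chi B (vertex B - vertex B') z ^ k)
      * \<tau> B' i (T B B' z) ^ k"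
    unfolding char_val_def tau_change(2)[OF B i z] power_mult_distrib by (simp only: ac_simps)
  also have "inverse (frame_const B) ^ k * (frame_const B / frame_const B') ^ k = inverse (frame_const B') ^ k"
    unfolding power_mult_distrib[symmetric] using frame_const_nz[OF B(1)] by (simp add: field_simps)
  finally show ?thesis unfolding char_val_def 1 2 .
qed

text \<open>The chart is picked by choice; \<open>char_val_change\<close> makes the value
  independent of it. Off the cover the value 0 follows the convention of \<open>H0\<close>.\<close>

definition char_sec :: "nat \<Rightarrow> (nat \<Rightarrow> int) \<Rightarrow> 'i \<Rightarrow> toric_point \<Rightarrow> complex" where
  "char_sec k m i x = (if i \<in> index L \<and> x \<in> cover L i then
     (let y = (SOME y. fst y \<in> Bs \<and> x = chart_pt (fst y) (snd y)) in char_val k m (fst y) i (snd y)) else 0)"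

lemma char_sec_eq:
  assumes m: "m \<in> P k" and B: "B \<in> Bs" and i: "i \<in> index L" and z: "chart_pt B z \<in> cover L i"
  shows "char_sec k m i (chart_pt B z) = char_val k m B i z"
proof -
  define y where "y = (SOME y. fst y \<in> Bs \<and> chart_pt B z = chart_pt (fst y) (snd y))"
  have y: "fst y \<in> Bs \<and> chart_pt B z = chart_pt (fst y) (snd y)"
    unfolding y_def by (rule someI[of _ "(B, z)"]) (simp add: B)
  let ?B = "fst y" and ?z = "snd y"
  have yB: "?B \<in> Bs" using y by blast
  have e: "nz_off B ?B z" "\<And>b. b \<in> ?B \<Longrightarrow> ?z b = T B ?B z b" using chart_pt_eq[OF B yB] y by auto
  have "\<tau> ?B i (T B ?B z) = \<tau> ?B i ?z"
    by (rule tau_cong[OF yB i]) (use y z e in auto)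
  moreover have "chi ?B n ?z = chi ?B n (T B ?B z)" for n by (rule chi_cong) (use e in auto)
  ultimately have "char_val k m ?B i ?z = char_val k m ?B i (T B ?B z)" unfolding char_val_def by simp
  also have "\<dots> = char_val k m B i z" using char_val_change[OF m B yB i e(1) z] by simp
  finally show ?thesis unfolding char_sec_def y_def[symmetric] Let_def using i z by simp
qed

lemma cover_points: "i \<in> index L \<Longrightarrow> cover L i \<subseteq> toric_points l \<Delta>"
  using lbD(2) by blast

text \<open>Sections in terms of frames: one polynomial coefficient per chart encodes both
  regularity and the transition rule.\<close>

definition in_charts where
  "in_charts k s \<longleftrightarrow> (\<forall>i x. \<not> (i \<in> index L \<and> x \<in> cover L i) \<longrightarrow> s i x = 0) \<and>
     (\<forall>B\<in>Bs. \<exists>F\<in>PF B. \<forall>i\<in>index L. \<forall>z. chart_pt B z \<in> cover L i \<longrightarrow> s i (chart_pt B z) = F z * \<tau> B i z ^ k)"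

lemma lb_power_sel:
  "index (lb_power L k) = index L" "cover (lb_power L k) = cover L" "trans (lb_power L k) i j x = trans L i j x ^ k"
  by (simp_all add: lb_power_def)

lemma H0_power_iff:
  "s \<in> H0 \<O> (lb_power L k) \<longleftrightarrow> (\<forall>i\<in>index L. s i \<in> \<O> (cover L i)) \<and>
     (\<forall>i\<in>index L. \<forall>j\<in>index L. \<forall>x\<in>cover L i \<inter> cover L j. s i x = trans L i j x ^ k * s j x) \<and>
     (\<forall>i x. \<not> (i \<in> index L \<and> x \<in> cover L i) \<longrightarrow> s i x = 0)"
  by (simp only: H0_def lb_power_sel mem_Collect_eq)

text \<open>The quotient of the section by the \<open>k\<close>-th power of the frame is independent
  of the trivialisation, hence regular on the whole coordinate space, hence a polynomial.\<close>

lemma H0_in_charts: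
  assumes s: "s \<in> H0 \<O> (lb_power L k)"
  shows "in_charts k s"
proof -
  have sD: "\<And>i. i \<in> index L \<Longrightarrow> s i \<in> \<O> (cover L i)"
    "\<And>i j x. i \<in> index L \<Longrightarrow> j \<in> index L \<Longrightarrow> x \<in> cover L i \<inter> cover L j \<Longrightarrow> s i x = trans L i j x ^ k * s j x"
    "\<And>i x. \<not> (i \<in> index L \<and> x \<in> cover L i) \<Longrightarrow> s i x = 0"
  proof -
    have *: "\<forall>i\<in>index L. s i \<in> \<O> (cover L i)"
      "\<forall>i\<in>index L. \<forall>j\<in>index L. \<forall>x\<in>cover L i \<inter> cover L j. s i x = trans L i j x ^ k * s j x"
      "\<forall>i x. \<not> (i \<in> index L \<and> x \<in> cover L i) \<longrightarrow> s i x = 0"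
      using s unfolding H0_power_iff by blast+
    show "\<And>i. i \<in> index L \<Longrightarrow> s i \<in> \<O> (cover L i)"
      "\<And>i j x. i \<in> index L \<Longrightarrow> j \<in> index L \<Longrightarrow> x \<in> cover L i \<inter> cover L j \<Longrightarrow> s i x = trans L i j x ^ k * s j x"
      "\<And>i x. \<not> (i \<in> index L \<and> x \<in> cover L i) \<Longrightarrow> s i x = 0"
      using * by blast+
  qed
  have "\<exists>F\<in>PF B. \<forall>i\<in>index L. \<forall>z. chart_pt B z \<in> cover L i \<longrightarrow> s i (chart_pt B z) = F z * \<tau> B i z ^ k" if B: "B \<in> Bs" for B
  proof -
    define ix where "ix z = (SOME i. i \<in> index L \<and> chart_pt B z \<in> cover L i)" for z
    have ix: "ix z \<in> index L" "chart_pt B z \<in> cover L (ix z)" for z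
      using someI_ex[of "\<lambda>i. i \<in> index L \<and> chart_pt B z \<in> cover L i"] covered[OF B, of z] unfolding ix_def by blast+
    define F where "F z = s (ix z) (chart_pt B z) / \<tau> B (ix z) z ^ k" for z
    have F: "F z = s i (chart_pt B z) / \<tau> B i z ^ k" if i: "i \<in> index L" "chart_pt B z \<in> cover L i" for i z
    proof -
      have g: "trans L (ix z) i (chart_pt B z) \<noteq> 0" by (rule lbD(4)) (use ix i in auto)
      have "\<tau> B (ix z) z = trans L (ix z) i (chart_pt B z) * \<tau> B i z"
        by (rule tau(3)[OF B ix(1) i(1) ix(2) i(2)])
      moreover have "s (ix z) (chart_pt B z) = trans L (ix z) i (chart_pt B z) ^ k * s i (chart_pt B z)"
        by (rule sD(2)) (use ix i in auto)
      ultimately show ?thesis unfolding F_def using g by (simp add: power_mult_distrib)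
    qed
    have "zreg B UNIV F"
      unfolding zreg_def
    proof
      fix z :: coords
      let ?i = "ix z"
      note i = ix[of z]
      have zi: "z \<in> pull B (cover L ?i)" using i unfolding pull_def by simp
      obtain p q where pq: "p \<in> PF B" "q \<in> PF B" "q z \<noteq> 0"
        "\<And>y. q y \<noteq> 0 \<Longrightarrow> y \<in> pull B (cover L ?i) \<and> s ?i (chart_pt B y) = p y / q y"
        using zregE[OF regular_pull[OF B sD(1)[OF i(1)]] zi] by blast
      obtain p1 q1 where pq1: "p1 \<in> PF B" "q1 \<in> PF B" "q1 z \<noteq> 0"
        "\<And>y. q1 y \<noteq> 0 \<Longrightarrow> y \<in> pull B (cover L ?i) \<and> \<tau> B ?i y = p1 y / q1 y"
        using zregE[OF tau(1)[OF B i(1)] zi] by blast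
      have p1z: "p1 z \<noteq> 0" using tau(2)[OF B i] pq1(3) pq1(4)[of z] by auto
      let ?n = "p * q1 ^ k * q1" and ?d = "q * p1 ^ k * q1"
      have mem: "?n \<in> PF B" "?d \<in> PF B" by (intro PF.mult PF_power pq(1,2) pq1(1,2))+
      have dz: "?d z \<noteq> 0" using pq(3) pq1(3) p1z by (simp add: fun_power_apply)
      have rep: "y \<in> UNIV \<and> F y = ?n y / ?d y" if y: "?d y \<noteq> 0" for y
      proof -
        have y': "q y \<noteq> 0" "q1 y \<noteq> 0" using y by auto
        have c: "chart_pt B y \<in> cover L ?i" using pq(4)[OF y'(1)] unfolding pull_def by simp
        show ?thesis using F[OF i(1) c] pq(4)[OF y'(1)] pq1(4)[OF y'(2)] y'
          by (simp add: fun_power_apply power_divide)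
      qed
      show "\<exists>p\<in>PF B. \<exists>q\<in>PF B. q z \<noteq> 0 \<and> (\<forall>y. q y \<noteq> 0 \<longrightarrow> y \<in> UNIV \<and> F y = p y / q y)"
        by (rule bexI[OF _ mem(1)], rule bexI[OF _ mem(2)]) (use dz rep in blast)
    qed
    then have "F \<in> PF B" by (rule zreg_UNIV[OF BsD(2)[OF B]])
    moreover have "s i (chart_pt B z) = F z * \<tau> B i z ^ k" if "i \<in> index L" "chart_pt B z \<in> cover L i" for i z
      using F[OF that] tau(2)[OF B that] by simp
    ultimately show ?thesis by blast
  qed
  then show ?thesis unfolding in_charts_def using sD(3) by blast
qed

lemma in_charts_H0:
  assumes s: "in_charts k s"
  shows "s \<in> H0 \<O> (lb_power L k)"
proof -
  have z: "\<And>i x. \<not> (i \<in> index L \<and> x \<in> cover L i) \<Longrightarrow> s i x = 0"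
    and ex: "\<And>B. B \<in> Bs \<Longrightarrow> \<exists>F\<in>PF B. \<forall>i\<in>index L. \<forall>z. chart_pt B z \<in> cover L i \<longrightarrow> s i (chart_pt B z) = F z * \<tau> B i z ^ k"
    using s unfolding in_charts_def by auto
  have "s i \<in> \<O> (cover L i)" if i: "i \<in> index L" for i
  proof (rule regular_push[OF cover_points[OF i]])
    fix B assume B: "B \<in> Bs"
    obtain F where F: "F \<in> PF B" "\<And>i z. i \<in> index L \<Longrightarrow> chart_pt B z \<in> cover L i \<Longrightarrow> s i (chart_pt B z) = F z * \<tau> B i z ^ k"
      using ex[OF B] by blast
    show "zreg B (pull B (cover L i)) (\<lambda>z. s i (chart_pt B z))"
      unfolding zreg_def
    proof
      fix z assume "z \<in> pull B (cover L i)"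
      then obtain p q where pq: "p \<in> PF B" "q \<in> PF B" "q z \<noteq> 0"
        "\<And>y. q y \<noteq> 0 \<Longrightarrow> y \<in> pull B (cover L i) \<and> \<tau> B i y = p y / q y"
        using zregE[OF tau(1)[OF B i]] by blast
      let ?n = "F * p ^ k * q" and ?d = "q ^ k * q"
      have mem: "?n \<in> PF B" "?d \<in> PF B" by (intro PF.mult PF_power pq(1,2) F(1))+
      have dz: "?d z \<noteq> 0" using pq(3) by (simp add: fun_power_apply)
      have rep: "y \<in> pull B (cover L i) \<and> s i (chart_pt B y) = ?n y / ?d y" if y: "?d y \<noteq> 0" for y
      proof -
        have y': "q y \<noteq> 0" using y by auto
        have c: "chart_pt B y \<in> cover L i" using pq(4)[OF y'] unfolding pull_def by simp
        show ?thesis using F(2)[OF i c] pq(4)[OF y'] y' by (simp add: fun_power_apply power_divide)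
      qed
      show "\<exists>p\<in>PF B. \<exists>q\<in>PF B. q z \<noteq> 0 \<and> (\<forall>y. q y \<noteq> 0 \<longrightarrow> y \<in> pull B (cover L i) \<and> s i (chart_pt B y) = p y / q y)"
        by (rule bexI[OF _ mem(1)], rule bexI[OF _ mem(2)]) (use dz rep in blast)
    qed
  qed
  moreover have "s i x = trans L i j x ^ k * s j x" if ij: "i \<in> index L" "j \<in> index L" "x \<in> cover L i \<inter> cover L j" for i j x
  proof -
    obtain B z where B: "B \<in> Bs" "x = chart_pt B z" using points_chart_pt[of x] cover_points[OF ij(1)] ij(3) by blast
    obtain F where F: "F \<in> PF B" "\<And>i z. i \<in> index L \<Longrightarrow> chart_pt B z \<in> cover L i \<Longrightarrow> s i (chart_pt B z) = F z * \<tau> B i z ^ k"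
      using ex[OF B(1)] by blast
    have "\<tau> B i z = trans L i j x * \<tau> B j z" using tau(3)[OF B(1) ij(1,2), of z] ij(3) B(2) by simp
    then show ?thesis using F(2)[OF ij(1), of z] F(2)[OF ij(2), of z] ij(3) B(2)
      by (simp add: power_mult_distrib)
  qed
  ultimately show ?thesis unfolding H0_power_iff using z by blast
qed

lemma char_sec_H0:
  assumes m: "m \<in> P k"
  shows "char_sec k m \<in> H0 \<O> (lb_power L k)"
proof (rule in_charts_H0)
  have "\<exists>F\<in>PF B. \<forall>i\<in>index L. \<forall>z. chart_pt B z \<in> cover L i \<longrightarrow> char_sec k m i (chart_pt B z) = F z * \<tau> B i z ^ k" if B: "B \<in> Bs" for B
  proof (rule bexI)
    show "(\<lambda>_. inverse (frame_const B) ^ k) * chi B (m - mvertex k B) \<in> PF B"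
      using chi_PF[OF B] m P_iff B by (intro PF.mult PF.const) auto
    show "\<forall>i\<in>index L. \<forall>z. chart_pt B z \<in> cover L i \<longrightarrow>
        char_sec k m i (chart_pt B z) = ((\<lambda>_. inverse (frame_const B) ^ k) * chi B (m - mvertex k B)) z * \<tau> B i z ^ k"
      using char_sec_eq[OF m B] unfolding char_val_def by simp
  qed
  then show "in_charts k (char_sec k m)" unfolding in_charts_def by (auto simp: char_sec_def)
qed

lemma char_sec_mult:
  assumes m: "m \<in> P 1" "m' \<in> P 1"
  shows "m + m' \<in> P 2" "char_sec 2 (m + m') i x = char_sec 1 m i x * char_sec 1 m' i x"
proof -
  have s: "(m - mvertex 1 B) + (m' - mvertex 1 B) = m + m' - mvertex 2 B" for B by (auto simp: fun_eq_iff mvertex_def)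
  have "m + m' - mvertex 2 B \<in> dpts B" if "B \<in> Bs" for B
    unfolding s[symmetric] by (rule dpts_add) (use m that P_iff in blast)+
  moreover have "m + m' \<in> lattice_vecs l" using m unfolding P_iff by (intro lattice_vecs_closed) auto
  ultimately show P2: "m + m' \<in> P 2" unfolding P_iff by blast
  show "char_sec 2 (m + m') i x = char_sec 1 m i x * char_sec 1 m' i x"
  proof (cases "i \<in> index L \<and> x \<in> cover L i")
    case True
    then obtain B z where B: "B \<in> Bs" "x = chart_pt B z" using points_chart_pt[of x] cover_points[of i] by blast
    have i: "i \<in> index L" "chart_pt B z \<in> cover L i" using True B by auto
    have "chi B (m + m' - mvertex 2 B) z = chi B (m - mvertex 1 B) z * chi B (m' - mvertex 1 B) z"
      unfolding s[symmetric] by (rule chi_add_dm[OF BsD(1)[OF B(1)] nz_off_refl]) (use m P_iff B in auto)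
    then show ?thesis unfolding B(2) char_sec_eq[OF P2 B(1) i] char_sec_eq[OF m(1) B(1) i] char_sec_eq[OF m(2) B(1) i] char_val_def
      by (simp add: power2_eq_square)
  qed (auto simp: char_sec_def)
qed

text \<open>In each chart the section is a combination of characters. On the torus these expansions
  coincide by independence of characters, so every exponent that occurs satisfies the inequalities
  of all charts.\<close>

lemma expand:
  assumes s: "s \<in> H0 \<O> (lb_power L k)"
  shows "\<exists>F A. finite F \<and> F \<subseteq> P k \<and> s = (\<lambda>i x. \<Sum>m\<in>F. A m * char_sec k m i x)"
proof -
  have ic: "in_charts k s" by (rule H0_in_charts[OF s])
  have "\<forall>B\<in>Bs. \<exists>G a. finite G \<and> G \<subseteq> dpts B \<and>
     (\<forall>i\<in>index L. \<forall>z. chart_pt B z \<in> cover L i \<longrightarrow> s i (chart_pt B z) = (\<Sum>g\<in>G. a g * chi B g z) * \<tau> B i z ^ k)"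
  proof
    fix B assume B: "B \<in> Bs"
    obtain F where F: "F \<in> PF B" "\<forall>i\<in>index L. \<forall>z. chart_pt B z \<in> cover L i \<longrightarrow> s i (chart_pt B z) = F z * \<tau> B i z ^ k"
      using ic B unfolding in_charts_def by blast
    obtain G a where "finite G" "G \<subseteq> dpts B" "\<forall>z. F z = (\<Sum>g\<in>G. a g * chi B g z)"
      using PF_expand[OF B F(1)] by blast
    then show "\<exists>G a. finite G \<and> G \<subseteq> dpts B \<and>
     (\<forall>i\<in>index L. \<forall>z. chart_pt B z \<in> cover L i \<longrightarrow> s i (chart_pt B z) = (\<Sum>g\<in>G. a g * chi B g z) * \<tau> B i z ^ k)"
      using F(2) by auto
  qed
  from bchoice[OF this] obtain G where "\<forall>B\<in>Bs. \<exists>a. finite (G B) \<and> G B \<subseteq> dpts B \<and>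
     (\<forall>i\<in>index L. \<forall>z. chart_pt B z \<in> cover L i \<longrightarrow> s i (chart_pt B z) = (\<Sum>g\<in>G B. a g * chi B g z) * \<tau> B i z ^ k)" by blast
  from bchoice[OF this] obtain a where "\<forall>B\<in>Bs. finite (G B) \<and> G B \<subseteq> dpts B \<and>
     (\<forall>i\<in>index L. \<forall>z. chart_pt B z \<in> cover L i \<longrightarrow> s i (chart_pt B z) = (\<Sum>g\<in>G B. a B g * chi B g z) * \<tau> B i z ^ k)" by blast
  then have Ga: "\<And>B. B \<in> Bs \<Longrightarrow> finite (G B)" "\<And>B. B \<in> Bs \<Longrightarrow> G B \<subseteq> dpts B"
    "\<And>B i z. B \<in> Bs \<Longrightarrow> i \<in> index L \<Longrightarrow> chart_pt B z \<in> cover L i \<Longrightarrow>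
       s i (chart_pt B z) = (\<Sum>g\<in>G B. a B g * chi B g z) * \<tau> B i z ^ k"
    by blast+
  \<comment> \<open>The coefficient of the character of \<open>m\<close> in the expansion on
    \<open>B\<close>, transferred to the frame of \<open>B0\<close>: exponents shift by
    \<open>mvertex k B\<close>, and coefficients acquire the \<open>k\<close>-th power of
    \<open>frame_const B\<close>.\<close>
  define A where "A B m = (if m - mvertex k B \<in> G B then frame_const B ^ k * a B (m - mvertex k B) else 0)" for B m
  define S where "S B = (\<lambda>g. g + mvertex k B) ` G B" for B
  have A0: "A B m = 0" if "m \<notin> S B" for B m
  proof -
    have "m \<in> S B" if "m - mvertex k B \<in> G B"
      unfolding S_def by (rule image_eqI[OF _ that]) simp
    then show ?thesis using that unfolding A_def by auto
  qed
  have finS: "finite (S B)" if "B \<in> Bs" for B unfolding S_def using Ga(1)[OF that] by simp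
  have SL: "S B \<subseteq> lattice_vecs l" if B: "B \<in> Bs" for B
    using Ga(2)[OF B] mvertex_lattice[OF B] dpts_iff[OF BsD(1)[OF B]] unfolding S_def by auto
  have reind: "(\<Sum>m\<in>S B. A B m * f m) = frame_const B ^ k * (\<Sum>g\<in>G B. a B g * f (g + mvertex k B))" for B f
  proof -
    have "inj_on (\<lambda>g. g + mvertex k B) (G B)" by (auto simp: inj_on_def)
    then have "(\<Sum>m\<in>S B. A B m * f m) = (\<Sum>g\<in>G B. A B (g + mvertex k B) * f (g + mvertex k B))"
      unfolding S_def by (simp add: sum.reindex)
    also have "\<dots> = (\<Sum>g\<in>G B. frame_const B ^ k * (a B g * f (g + mvertex k B)))"
      by (rule sum.cong) (auto simp: A_def)
    finally show ?thesis by (simp add: sum_distrib_left)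
  qed
  have same: "A B = A B'" if B: "B \<in> Bs" "B' \<in> Bs" for B B'
  proof
    fix m
    let ?S = "S B \<union> S B'"
    have finS2: "finite ?S" using finS B by blast
    have "(\<Sum>m\<in>?S. (A B m - A B' m) * chi B m z) = 0" if z: "\<And>b. z b \<noteq> 0" for z
    proof -
      note t = torus[OF B z]
      have add: "chi B (g + n) z = chi B g z * chi B n z" for g n by (rule chi_add) (use z in auto)
      obtain i where i: "i \<in> index L" "chart_pt B z \<in> cover L i" using covered[OF B(1)] by blast
      have c: "chart_pt B' (T B B' z) = chart_pt B z" by (rule chart_pt_T[OF B t(1)])
      let ?\<Sigma> = "\<Sum>g\<in>G B. a B g * chi B g z" and ?\<Sigma>' = "\<Sum>g\<in>G B'. a B' g * chi B g z"
      have "(\<Sum>g\<in>G B'. a B' g * chi B' g (T B B' z)) = ?\<Sigma>'"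
        by (rule sum.cong) (use t(2) Ga(2)[OF B(2)] dpts_iff[OF BsD(1)[OF B(2)]] in auto)
      then have e1: "?\<Sigma> * \<tau> B i z ^ k = ?\<Sigma>' * \<tau> B' i (T B B' z) ^ k"
        using Ga(3)[OF B(1) i] Ga(3)[OF B(2) i(1), of "T B B' z"] i(2) c by simp
      have nz: "\<tau> B' i (T B B' z) \<noteq> 0" by (rule tau(2)[OF B(2) i(1)]) (simp add: c i)
      have "chi B (vertex B - vertex B') z * chi B (vertex B') z = chi B (vertex B) z"
        using add[of "vertex B - vertex B'" "vertex B'"] by simp
      then have "\<tau> B i z * (frame_const B' * chi B (vertex B') z) = frame_const B * chi B (vertex B) z * \<tau> B' i (T B B' z)"
        unfolding tau_change(2)[OF B i(1) t(1) i(2)] using frame_const_nz[OF B(2)] by (simp add: field_simps)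
      then have e2: "\<tau> B i z ^ k * (frame_const B' ^ k * chi B (mvertex k B') z) = frame_const B ^ k * chi B (mvertex k B) z * \<tau> B' i (T B B' z) ^ k"
        unfolding mvertex_def chi_pow power_mult_distrib[symmetric] by simp
      have eq: "?\<Sigma> * (frame_const B ^ k * chi B (mvertex k B) z) = ?\<Sigma>' * (frame_const B' ^ k * chi B (mvertex k B') z)"
        by (rule cross_cancel[OF e1 e2]) (use nz in simp)
      have "(\<Sum>m\<in>S B. A B m * chi B m z) = (\<Sum>m\<in>S B'. A B' m * chi B m z)"
        unfolding reind add using eq by (simp add: sum_distrib_left sum_distrib_right ac_simps)
      moreover have "(\<Sum>m\<in>S B. A B m * chi B m z) = (\<Sum>m\<in>?S. A B m * chi B m z)"
        by (rule sum.mono_neutral_left) (use finS2 A0 in auto)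
      moreover have "(\<Sum>m\<in>S B'. A B' m * chi B m z) = (\<Sum>m\<in>?S. A B' m * chi B m z)"
        by (rule sum.mono_neutral_left) (use finS2 A0 in auto)
      ultimately show ?thesis by (simp add: left_diff_distrib sum_subtractf)
    qed
    then have "A B m - A B' m = 0" if "m \<in> ?S"
      using chi_independent[OF B(1) finS2 _ _ that, of "\<lambda>m. A B m - A B' m"] SL B by blast
    then show "A B m = A B' m" using A0[of m B] A0[of m B'] by (cases "m \<in> ?S") auto
  qed
  define F where "F = {m \<in> S B0. A B0 m \<noteq> 0}"
  have finF: "finite F" unfolding F_def using finS[OF B0] by simp
  have FP: "F \<subseteq> P k"
  proof
    fix m assume m: "m \<in> F"
    then have "m \<in> lattice_vecs l" using SL[OF B0] unfolding F_def by blast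
    moreover have "m - mvertex k B \<in> dpts B" if B: "B \<in> Bs" for B
    proof -
      have "A B m \<noteq> 0" using m same[OF B B0] unfolding F_def by auto
      then show ?thesis using Ga(2)[OF B] unfolding A_def by (auto split: if_splits)
    qed
    ultimately show "m \<in> P k" unfolding P_iff by blast
  qed
  have "s i x = (\<Sum>m\<in>F. A B0 m * char_sec k m i x)" for i x
  proof (cases "i \<in> index L \<and> x \<in> cover L i")
    case True
    then obtain B z where B: "B \<in> Bs" "x = chart_pt B z" using points_chart_pt[of x] cover_points[of i] by blast
    have i: "i \<in> index L" "chart_pt B z \<in> cover L i" using True B by auto
    have "(\<Sum>m\<in>F. A B0 m * char_sec k m i x) = (\<Sum>m\<in>F. A B m * char_val k m B i z)"
      by (rule sum.cong) (use char_sec_eq[OF _ B(1) i] FP B(2) same[OF B(1) B0] in auto)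
    also have "\<dots> = (\<Sum>m\<in>S B. A B m * char_val k m B i z)"
    proof (rule sum.mono_neutral_left[OF finS[OF B(1)]])
      show "F \<subseteq> S B"
      proof
        fix m assume "m \<in> F"
        then have "A B m \<noteq> 0" using same[OF B(1) B0] by (simp add: F_def)
        then show "m \<in> S B" using A0[of m B] by blast
      qed
      show "\<forall>m\<in>S B - F. A B m * char_val k m B i z = 0"
        using A0[of _ B0] same[OF B(1) B0] by (auto simp: F_def)
    qed
    also have "\<dots> = frame_const B ^ k * (\<Sum>g\<in>G B. a B g * char_val k (g + mvertex k B) B i z)" by (rule reind)
    also have "\<dots> = (\<Sum>g\<in>G B. a B g * chi B g z) * \<tau> B i z ^ k"
      using frame_const_nz[OF B(1)] unfolding char_val_def
      by (simp add: sum_distrib_left sum_distrib_right field_simps)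
    finally show ?thesis using Ga(3)[OF B(1) i] B(2) by simp
  next
    case False
    then have "s i x = 0" using ic unfolding in_charts_def by blast
    then show ?thesis using False by (auto simp: char_sec_def)
  qed
  then show ?thesis using finF FP by blast
qed

text \<open>At the fixed point, where all coordinates of \<open>B\<close> are 0, a character
  survives only if all its exponents on \<open>B\<close> vanish. So a section that is nonzero there
  involves \<open>mvertex k B\<close>, and the inequalities for it can be divided by
  \<open>k\<close>.\<close>

lemma nef:
  assumes am: "ample X \<O> L" and B: "B \<in> Bs"
  shows "vertex B \<in> P 1"
proof -
  let ?x = "chart_pt B (\<lambda>_. 0)"
  have "openin X (toric_points l \<Delta>)" using openin_topspace[of X] unfolding topspace_toric_topology .
  moreover have "?x \<in> toric_points l \<Delta>" by (rule chart_pt_point[OF B])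
  ultimately obtain k s where k: "k \<ge> 1" "s \<in> H0 \<O> (lb_power L k)" "?x \<in> nonvanishing_locus L s"
    using am unfolding ample_def by blast
  obtain F A where F: "finite F" "F \<subseteq> P k" "s = (\<lambda>i x. \<Sum>m\<in>F. A m * char_sec k m i x)" using expand[OF k(2)] by blast
  obtain i where i: "i \<in> index L" "?x \<in> cover L i" "s i ?x \<noteq> 0" using k(3) unfolding nonvanishing_locus_def by blast
  have "\<exists>m\<in>F. char_sec k m i ?x \<noteq> 0"
  proof (rule ccontr)
    assume "\<not> ?thesis"
    then have "s i ?x = 0" unfolding F(3) by simp
    with i show False by blast
  qed
  then obtain m where m: "m \<in> F" "char_sec k m i ?x \<noteq> 0" by blast
  then have mP: "m \<in> P k" using F by blast
  have "chi B (m - mvertex k B) (\<lambda>_. 0) \<noteq> 0"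
    using m(2) char_sec_eq[OF mP B i(1,2)] unfolding char_val_def by auto
  then have "ip l (m - mvertex k B) b = 0" if "b \<in> B" for b
    using that BsD(2)[OF B] unfolding chi_def by (auto simp: prod_zero_iff split: if_splits)
  then have "m = mvertex k B"
    using mP mvertex_lattice[OF B] unfolding P_iff by (intro ip_eq_basis[OF B]) (auto simp: ip_diff_left)
  then have ineq: "int k * h r \<le> int k * ip l (vertex B) r" if "r \<in> \<Union>K" for r
    using mP that unfolding P_def by (auto simp: ip_mvertex)
  have "h r \<le> ip l (vertex B) r" if "r \<in> Y" "Y \<in> K" for r Y
    using k(1) ineq[OF UnionI[OF that(2,1)]] by simp
  then show ?thesis unfolding P_def using vertex_lattice[OF B] by auto
qed

end


section \<open>The product of sections\<close>

lemma lb_tensor_power: "lb_tensor L L = lb_power L 2"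
  by (simp add: lb_tensor_def lb_power_def power2_eq_square)

lemma lb_power_1: "lb_power L 1 = L"
  by (simp add: lb_power_def)

section \<open>The product on formal sums\<close>

definition fin_supp :: "('s \<Rightarrow> complex) \<Rightarrow> bool" where
  "fin_supp a \<longleftrightarrow> finite {p. a p \<noteq> 0}"

text \<open>The support of a combination may shrink by cancellation; linearity is proved by summing
  over a fixed larger finite set.\<close>

lemma formal_product_superset:
  assumes "finite Y" "{p. a p \<noteq> 0} \<subseteq> Y"
  shows "formal_product a i x = (\<Sum>p\<in>Y. a p * (fst p i x * snd p i x))"
proof -
  have "formal_product a i x = (\<Sum>p\<in>{p. a p \<noteq> 0}. a p * (fst p i x * snd p i x))"
    unfolding formal_product_def by (rule sum.cong) auto
  also have "\<dots> = (\<Sum>p\<in>Y. a p * (fst p i x * snd p i x))"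
    by (rule sum.mono_neutral_left) (use assms in auto)
  finally show ?thesis .
qed

lemma formal_product_lincomb:
  assumes a: "fin_supp a" and b: "fin_supp b"
  shows "fin_supp (\<lambda>p. c * a p + d * b p)"
    and "formal_product (\<lambda>p. c * a p + d * b p) i x = c * formal_product a i x + d * formal_product b i x"
proof -
  let ?Y = "{p. a p \<noteq> 0} \<union> {p. b p \<noteq> 0}"
  have Y: "finite ?Y" using a b unfolding fin_supp_def by simp
  have sub: "{p. c * a p + d * b p \<noteq> 0} \<subseteq> ?Y" by auto
  show "fin_supp (\<lambda>p. c * a p + d * b p)" unfolding fin_supp_def by (rule finite_subset[OF sub Y])
  have "formal_product a i x = (\<Sum>p\<in>?Y. a p * (fst p i x * snd p i x))"
    "formal_product b i x = (\<Sum>p\<in>?Y. b p * (fst p i x * snd p i x))"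
    by (rule formal_product_superset[OF Y]; auto)+
  then show "formal_product (\<lambda>p. c * a p + d * b p) i x = c * formal_product a i x + d * formal_product b i x"
    unfolding formal_product_superset[OF Y sub]
    by (simp add: sum_distrib_left sum.distrib[symmetric] algebra_simps)
qed

lemma formal_product_pair: "fin_supp (formal_pair p)" "formal_product (formal_pair p) i x = fst p i x * snd p i x"
proof -
  have *: "{q. formal_pair p q \<noteq> 0} = {p}" by (auto simp: formal_pair_def)
  then show "fin_supp (formal_pair p)" unfolding fin_supp_def by simp
  show "formal_product (formal_pair p) i x = fst p i x * snd p i x"
    unfolding formal_product_superset[of "{p}" "formal_pair p", unfolded *, OF _ subset_refl, simplified]
    by (simp add: formal_pair_def)
qed

lemma fin_supp_zero: "fin_supp (\<lambda>p. 0)"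
  by (simp add: fin_supp_def)

text \<open>Finite support is carried along because linearity of \<open>formal_product\<close>
  depends on it.\<close>

definition null_product :: "(('i, 'p) lb_section \<times> ('i, 'p) lb_section \<Rightarrow> complex) \<Rightarrow> bool" where
  "null_product a \<longleftrightarrow> fin_supp a \<and> (\<forall>i x. formal_product a i x = 0)"

lemma null_product_relations:
  assumes "a \<in> bilinear_relations V W"
  shows "null_product a"
proof -
  have three: "null_product (formal_pair p - formal_pair q - formal_pair r)"
    if "\<And>i x. fst p i x * snd p i x = fst q i x * snd q i x + fst r i x * snd r i x"
    for p q r :: "('a, 'b) lb_section \<times> ('a, 'b) lb_section"
  proof -
    let ?f = "\<lambda>t. 1 * formal_pair p t + (-1) * formal_pair q t"
    have f: "fin_supp ?f" "formal_product ?f i x = fst p i x * snd p i x - fst q i x * snd q i x" for i x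
      using formal_product_lincomb[OF formal_product_pair(1)[of p] formal_product_pair(1)[of q], of 1 "-1"]
        formal_product_pair(2)[of p] formal_product_pair(2)[of q] by auto
    have eq: "formal_pair p - formal_pair q - formal_pair r = (\<lambda>t. 1 * ?f t + (-1) * formal_pair r t)"
      by (auto simp: fun_eq_iff)
    show ?thesis
      unfolding null_product_def eq
      using formal_product_lincomb[OF f(1) formal_product_pair(1)[of r], of 1 "-1"] f(2)
        formal_product_pair(2)[of r] that by auto
  qed
  have two: "null_product (formal_pair p - (\<lambda>t. c * formal_pair q t))"
    if "\<And>i x. fst p i x * snd p i x = c * (fst q i x * snd q i x)"
    for p q :: "('a, 'b) lb_section \<times> ('a, 'b) lb_section" and c
  proof -
    have eq: "formal_pair p - (\<lambda>t. c * formal_pair q t) = (\<lambda>t. 1 * formal_pair p t + (- c) * formal_pair q t)"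
      by (auto simp: fun_eq_iff)
    show ?thesis
      unfolding null_product_def eq
      using formal_product_lincomb[OF formal_product_pair(1)[of p] formal_product_pair(1)[of q], of 1 "- c"]
        formal_product_pair(2)[of p] formal_product_pair(2)[of q] that by auto
  qed
  from assms consider s s' t where "a = formal_pair (s + s', t) - formal_pair (s, t) - formal_pair (s', t)"
    | s t t' where "a = formal_pair (s, t + t') - formal_pair (s, t) - formal_pair (s, t')"
    | c s t where "a = formal_pair (sec_scale c s, t) - (\<lambda>p. c * formal_pair (s, t) p)"
    | c s t where "a = formal_pair (s, sec_scale c t) - (\<lambda>p. c * formal_pair (s, t) p)"
    unfolding bilinear_relations_def by blast
  then show ?thesis
  proof cases
    case 1
    show ?thesis unfolding 1 by (rule three) (simp add: distrib_right)
  next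
    case 2
    show ?thesis unfolding 2 by (rule three) (simp add: distrib_left)
  next
    case 3
    show ?thesis unfolding 3 by (rule two) (simp add: sec_scale_def)
  next
    case 4
    show ?thesis unfolding 4 by (rule two) (simp add: sec_scale_def)
  qed
qed

interpretation formal: module "\<lambda>(c::complex) a p. c * a p"
  by standard (auto simp: fun_eq_iff algebra_simps)

lemma null_product_span:
  assumes "a \<in> module.span (\<lambda>(c::complex) a p. c * a p) (bilinear_relations V W)"
  shows "null_product a"
  using assms
proof (induction rule: formal.span_induct_alt)
  case base
  have "null_product (\<lambda>p. 0)" unfolding null_product_def using fin_supp_zero
    by (simp add: formal_product_def)
  then show ?case by (simp add: zero_fun_def)
next
  case (step c x y)
  have x: "null_product x" by (rule null_product_relations[OF step(1)])
  have eq: "(\<lambda>p. c * x p) + y = (\<lambda>p. c * x p + 1 * y p)" by (auto simp: fun_eq_iff)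
  show ?case unfolding eq null_product_def
    using formal_product_lincomb[of x y c 1] x step(2) unfolding null_product_def by auto
qed

text \<open>Equivalent formal sums differ by an element of the span of the relations, on which the
  product vanishes; so the image of a class is a singleton and \<open>the_elem\<close> returns its
  member.\<close>

lemma section_product_class:
  assumes a: "a \<in> formal_sums V W"
  shows "section_product ({(a, b). a \<in> formal_sums V W \<and> b \<in> formal_sums V W \<and>
        a - b \<in> module.span (\<lambda>(c::complex) a p. c * a p) (bilinear_relations V W)} `` {a}) = formal_product a"
    (is "section_product (?R `` {a}) = _")
proof -
  have "formal_product b = formal_product a" if b: "b \<in> ?R `` {a}" for b
  proof -
    have bV: "b \<in> formal_sums V W" "a - b \<in> module.span (\<lambda>(c::complex) a p. c * a p) (bilinear_relations V W)"
      using b by auto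
    have n: "null_product (a - b)" by (rule null_product_span[OF bV(2)])
    have fb: "fin_supp b" using bV(1) unfolding formal_sums_def fin_supp_def by blast
    have eq: "a = (\<lambda>p. 1 * (a - b) p + 1 * b p)" by (auto simp: fun_eq_iff)
    have "formal_product a i x = formal_product b i x" for i x
      by (subst eq, subst formal_product_lincomb(2)) (use n fb in \<open>auto simp: null_product_def\<close>)
    then show ?thesis by (auto simp: fun_eq_iff)
  qed
  moreover have "a - a \<in> module.span (\<lambda>(c::complex) a p. c * a p) (bilinear_relations V W)"
    using formal.span_zero by simp
  then have "a \<in> ?R `` {a}" using a by blast
  ultimately have "formal_product ` (?R `` {a}) = {formal_product a}" by blast
  then show ?thesis unfolding section_product_def by simp
qed

lemma section_product_image:
  "section_product ` tensor_product V W = formal_product ` formal_sums V W"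
proof -
  let ?R = "{(a, b). a \<in> formal_sums V W \<and> b \<in> formal_sums V W \<and>
        a - b \<in> module.span (\<lambda>(c::complex) a p. c * a p) (bilinear_relations V W)}"
  have "tensor_product V W = (\<lambda>a. ?R `` {a}) ` formal_sums V W"
    unfolding tensor_product_def quotient_def by (rule UNION_singleton_eq_range)
  then show ?thesis by (simp only: image_image) (rule image_cong[OF refl section_product_class])
qed

section \<open>Sections of the square as sums of products\<close>

context toric_line_bundle
begin

lemma product_in_H0:
  assumes a: "a \<in> formal_sums (H0 \<O> L) (H0 \<O> L)"
  shows "formal_product a \<in> H0 \<O> (lb_power L 2)"
proof (rule in_charts_H0)
  let ?S = "{p. a p \<noteq> 0}"
  have S: "finite ?S" "\<And>p. p \<in> ?S \<Longrightarrow> in_charts 1 (fst p) \<and> in_charts 1 (snd p)"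
    using a H0_in_charts[of _ 1] unfolding formal_sums_def lb_power_1 by auto
  have fp: "formal_product a i x = (\<Sum>p\<in>?S. a p * (fst p i x * snd p i x))" for i x
    by (rule formal_product_superset[OF S(1)]) simp
  have "\<exists>F\<in>PF B. \<forall>i\<in>index L. \<forall>z. chart_pt B z \<in> cover L i \<longrightarrow> formal_product a i (chart_pt B z) = F z * \<tau> B i z ^ 2"
    if B: "B \<in> Bs" for B
  proof -
    have "\<forall>p\<in>?S. \<exists>f. f \<in> PF B \<and> (\<forall>i\<in>index L. \<forall>z. chart_pt B z \<in> cover L i \<longrightarrow> fst p i (chart_pt B z) = f z * \<tau> B i z)"
      using S(2) B unfolding in_charts_def by fastforce
    from bchoice[OF this] obtain f where f: "\<And>p. p \<in> ?S \<Longrightarrow> f p \<in> PF B"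
      "\<And>p i z. p \<in> ?S \<Longrightarrow> i \<in> index L \<Longrightarrow> chart_pt B z \<in> cover L i \<Longrightarrow> fst p i (chart_pt B z) = f p z * \<tau> B i z" by blast
    have "\<forall>p\<in>?S. \<exists>f. f \<in> PF B \<and> (\<forall>i\<in>index L. \<forall>z. chart_pt B z \<in> cover L i \<longrightarrow> snd p i (chart_pt B z) = f z * \<tau> B i z)"
      using S(2) B unfolding in_charts_def by fastforce
    from bchoice[OF this] obtain g where g: "\<And>p. p \<in> ?S \<Longrightarrow> g p \<in> PF B"
      "\<And>p i z. p \<in> ?S \<Longrightarrow> i \<in> index L \<Longrightarrow> chart_pt B z \<in> cover L i \<Longrightarrow> snd p i (chart_pt B z) = g p z * \<tau> B i z" by blast
    define F where "F = (\<Sum>p\<in>?S. (\<lambda>_. a p) * (f p * g p))"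
    have "F \<in> PF B" unfolding F_def by (intro PF_sum PF.mult PF.const f(1) g(1))
    moreover have "formal_product a i (chart_pt B z) = F z * \<tau> B i z ^ 2" if i: "i \<in> index L" "chart_pt B z \<in> cover L i" for i z
    proof -
      have "formal_product a i (chart_pt B z) = (\<Sum>p\<in>?S. a p * (f p z * g p z) * \<tau> B i z ^ 2)"
        unfolding fp by (rule sum.cong[OF refl]) (use f(2)[OF _ i] g(2)[OF _ i] in \<open>simp add: power2_eq_square\<close>)
      then show ?thesis unfolding F_def by (simp add: fun_sum_apply sum_distrib_right)
    qed
    ultimately show ?thesis by blast
  qed
  moreover have "formal_product a i x = 0" if "\<not> (i \<in> index L \<and> x \<in> cover L i)" for i x
    unfolding fp by (rule sum.neutral) (use S(2) that in \<open>auto simp: in_charts_def\<close>)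
  ultimately show "in_charts 2 (formal_product a)" unfolding in_charts_def by blast
qed

text \<open>By \<open>dec\<close> and \<open>char_sec_mult\<close> each character section of the
  square is a product of two character sections of \<open>L\<close>; the formal sum is built up one
  exponent at a time.\<close>

lemma H0_product:
  assumes dec: "\<And>M. M \<in> P 2 \<Longrightarrow> \<exists>m. m \<in> P 1 \<and> M - m \<in> P 1"
    and s: "s \<in> H0 \<O> (lb_power L 2)"
  shows "s \<in> formal_product ` formal_sums (H0 \<O> L) (H0 \<O> L)"
proof -
  let ?V = "H0 \<O> L"
  obtain F A where F: "finite F" "F \<subseteq> P 2" "s = (\<lambda>i x. \<Sum>m\<in>F. A m * char_sec 2 m i x)" using expand[OF s] by blast
  have "\<forall>M\<in>F. \<exists>m. m \<in> P 1 \<and> M - m \<in> P 1" using dec F(2) by blast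
  from bchoice[OF this] obtain f where f: "\<And>M. M \<in> F \<Longrightarrow> f M \<in> P 1" "\<And>M. M \<in> F \<Longrightarrow> M - f M \<in> P 1" by blast
  have "\<exists>a\<in>formal_sums ?V ?V. \<forall>i x. formal_product a i x = (\<Sum>m\<in>G. A m * char_sec 2 m i x)" if "G \<subseteq> F" for G
    using finite_subset[OF that F(1)] that
  proof (induction G)
    case empty
    show ?case by (rule bexI[of _ "\<lambda>_. 0"]) (auto simp: formal_product_def formal_sums_def)
  next
    case (insert M G)
    then obtain a where a: "a \<in> formal_sums ?V ?V" "\<And>i x. formal_product a i x = (\<Sum>m\<in>G. A m * char_sec 2 m i x)" by auto
    have M: "f M \<in> P 1" "M - f M \<in> P 1" using f insert by auto
    let ?p = "(char_sec 1 (f M), char_sec 1 (M - f M))"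
    let ?b = "\<lambda>p. A M * formal_pair ?p p + 1 * a p"
    have fa: "fin_supp a" using a(1) unfolding formal_sums_def fin_supp_def by blast
    note lc = formal_product_lincomb[OF formal_product_pair(1)[of ?p] fa, of "A M" 1]
    have "?p \<in> ?V \<times> ?V" using char_sec_H0[OF M(1)] char_sec_H0[OF M(2)] unfolding lb_power_1 by simp
    moreover have "{p. ?b p \<noteq> 0} \<subseteq> insert ?p {p. a p \<noteq> 0}" by (auto simp: formal_pair_def)
    ultimately have "?b \<in> formal_sums ?V ?V" using lc(1) a(1) unfolding formal_sums_def fin_supp_def by blast
    moreover have "formal_product ?b i x = (\<Sum>m\<in>insert M G. A m * char_sec 2 m i x)" for i x
    proof -
      have "char_sec 2 M i x = char_sec 1 (f M) i x * char_sec 1 (M - f M) i x" using char_sec_mult(2)[OF M, of i x] by simp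
      then show ?thesis unfolding lc(2) formal_product_pair(2) a(2) using insert(1,2) by simp
    qed
    ultimately show ?case by blast
  qed
  from this[OF subset_refl] obtain a where "a \<in> formal_sums ?V ?V" "\<And>i x. formal_product a i x = s i x"
    unfolding F(3) by blast
  then have "s = formal_product a" by (auto simp: fun_eq_iff)
  then show ?thesis using \<open>a \<in> formal_sums ?V ?V\<close> by blast
qed

lemma section_product_surjective:
  assumes dec: "\<And>M. M \<in> P 2 \<Longrightarrow> \<exists>m. m \<in> P 1 \<and> M - m \<in> P 1"
  shows "section_product ` tensor_product (H0 \<O> L) (H0 \<O> L) = H0 \<O> (lb_tensor L L)"
  unfolding section_product_image lb_tensor_power using product_in_H0 H0_product[OF dec] by blast

end

theorem theorem6p2:
  fixes l n :: nat
    and L :: "('i, toric_point) line_bundle_data"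
  assumes "l \<ge> 2" and "n \<ge> 1"
    and "line_bundle (toric_topology l (Z_tilde_fan l n)) (toric_regular l (Z_tilde_fan l n)) L"
    and "ample (toric_topology l (Z_tilde_fan l n)) (toric_regular l (Z_tilde_fan l n)) L"
  shows "section_product `
           tensor_product (H0 (toric_regular l (Z_tilde_fan l n)) L)
                          (H0 (toric_regular l (Z_tilde_fan l n)) L)
         = H0 (toric_regular l (Z_tilde_fan l n)) (lb_tensor L L)"
proof -
  let ?K = "final_complex l n"
  note fan = fan_description[OF assms(1,2)]
  interpret smooth_complex l ?K by (rule fan(2))
  interpret toric_line_bundle l ?K L
    by standard (use assms(3) fan(5) in \<open>auto simp: fan(1)\<close>)
  have fan_eq: "Z_tilde_fan l n = \<Delta>" unfolding \<Delta>_def by (rule fan(1))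
  \<comment> \<open>The polyhedra \<open>P k\<close> refer to the generators occurring in the
    complex, the decomposition to \<open>rays l n\<close>; the two sets have to be
    identified.\<close>
  have rays_sub: "rays l n \<subseteq> \<Union>?K"
  proof
    fix r assume "r \<in> rays l n"
    then consider j where "1 \<le> j" "j \<le> l" "r = e j" | i where "1 \<le> i" "i \<le> n" "r = chain_ray l i" | "r = final_ray l"
      unfolding rays_def by auto
    then show "r \<in> \<Union>?K"
    proof cases
      case 1
      show ?thesis
      proof (cases "j = l")
        case True
        then have "e j \<in> insert (final_ray l) (e ` {2..l})" using assms(1) by auto
        then show ?thesis unfolding 1(3) using fan(6) by blast
      next
        case False
        then have "e j \<in> insert (chain_ray l n) (e ` {1..l-1})" using 1 by auto
        then show ?thesis unfolding 1(3) using fan(5) by blast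
      qed
    next
      case 2
      show ?thesis
      proof (cases "i = n")
        case True
        then show ?thesis unfolding 2(3) using fan(5) by blast
      next
        case False
        then have "insert (chain_ray l i) (insert (chain_ray l (Suc i)) (e ` {2..l-1})) \<in> ?K" using 2 by (intro fan(4)) auto
        then show ?thesis unfolding 2(3) by blast
      qed
    next
      case 3
      then show ?thesis using fan(6) by blast
    qed
  qed
  have K_rays: "\<Union>?K = rays l n" using rays_sub fan(3) by blast
  \<comment> \<open>A cone inherits the vertex of a maximal cone containing it, and
    \<open>nef\<close> puts this vertex into the polyhedron.\<close>
  have vertex: "\<exists>m. (\<forall>r\<in>A. ip l m r = h r) \<and> (\<forall>r\<in>rays l n. h r \<le> ip l m r)" if A: "A \<in> ?K" for A
  proof -
    obtain B where B: "B \<in> Bs" "A \<subseteq> B" using extend_Bs[OF A] by blast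
    have "vertex B \<in> P 1" by (rule nef[OF _ B(1)]) (use assms(4) in \<open>simp add: fan_eq\<close>)
    then have "\<forall>r\<in>rays l n. h r \<le> ip l (vertex B) r" unfolding P_def K_rays by simp
    moreover have "\<forall>r\<in>A. ip l (vertex B) r = h r" using h_eq[OF B(1)] B(2) by blast
    ultimately show ?thesis by blast
  qed
  interpret N: nef_heights l n h
    by standard (rule assms(1,2) vertex fan(4,5,6); assumption?)+
  have "\<exists>m. m \<in> P 1 \<and> M - m \<in> P 1" if M: "M \<in> P 2" for M
  proof -
    have M12: "M \<in> lattice_vecs l" "\<And>r. r \<in> rays l n \<Longrightarrow> 2 * h r \<le> ip l M r"
      using M unfolding P_def K_rays by auto
    obtain m where "m \<in> lattice_vecs l" "\<forall>r\<in>rays l n. h r \<le> ip l m r \<and> h r \<le> ip l (M - m) r"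
      using N.decompose[OF M12] by blast
    then show ?thesis using M12(1) unfolding P_def K_rays by (intro exI[of _ m]) auto
  qed
  then show ?thesis unfolding fan_eq by (rule section_product_surjective)
qed

end
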